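(* Let $\alpha\ge1$ and let $\delta$ be any constant with $0<\delta<10^{-5}$. For the unsplittable capacitated vehicle routing problem (with general capacity), there exists an algorithm running in $n^{\mathcal{O}(1/\delta)}$ time which, given an $\alpha$-approximate TSP tour $\mathcal{A}$ on $V\cup\{r\}$, achieves an approximation ratio of $\alpha+1+y_1+\ln(2-2y_1)+\delta<\alpha+1.6759$, where $y_1>0.17458$ is the unique root of the equation $\frac{1}{2}y+6(1-y)\left(1-e^{-\frac{1}{2}y}\right)=\ln(2-2y)$.
   Context: Unsplittable capacitated vehicle routing problem (CVRP): an instance consists of a complete undirected graph on vertex set $V\cup\{r\}$, where $V=\{v_1,\dots,v_n\}$ is the set of customers and $r$ is the depot, a metric edge-cost function $c$ (nonnegative, $c(x,x)=0$, symmetric, satisfying the triangle inequality), an integer vehicle capacity $k\ge 1$ (arbitrary, part of the input), and integer demands $d_v\in\{1,\dots,k\}$ for $v\in V$. A tour is a cycle $(r,u_1,\dots,u_\ell,r)$ through distinct customers, with cost equal to the sum of its edge costs. A feasible solution is a set of tours together with an assignment of each customer to a single tour that visits it, such that the total demand assigned to each tour is at most $k$; its cost is the total cost of its tours. $\mathrm{OPT}$ denotes the minimum cost of a feasible solution. A TSP tour on $V\cup\{r\}$ is a cycle visiting every vertex of $V\cup\{r\}$ exactly once; it is $\alpha$-approximate if its cost is at most $\alpha$ times the minimum cost of such a cycle. An algorithm has approximation ratio $\rho$ if the (expected, for randomized algorithms) cost of its output is at most $\rho\cdot\mathrm{OPT}$ on every instance. *)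

theory Defs
  imports "HOL-Probability.Probability"
begin

section \<open>Unsplittable capacitated vehicle routing\<close>

text \<open>The customers are \<open>1, \<dots>, n\<close> and the depot is \<open>0\<close>. The values of the cost function and
  of the demands outside these ranges are irrelevant.\<close>

definition customers :: "nat \<Rightarrow> nat set" where
  "customers n = {1..n}"

definition vertices :: "nat \<Rightarrow> nat set" where
  "vertices n = {0..n}"

definition metric_cost :: "nat \<Rightarrow> (nat \<Rightarrow> nat \<Rightarrow> real) \<Rightarrow> bool" where
  "metric_cost n c \<longleftrightarrow>
     (\<forall>u\<in>vertices n. \<forall>v\<in>vertices n. 0 \<le> c u v \<and> c u v = c v u) \<and>
     (\<forall>u\<in>vertices n. c u u = 0) \<and>
     (\<forall>u\<in>vertices n. \<forall>v\<in>vertices n. \<forall>w\<in>vertices n. c u w \<le> c u v + c v w)"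

definition cvrp_instance ::
  "nat \<Rightarrow> (nat \<Rightarrow> nat \<Rightarrow> real) \<Rightarrow> nat \<Rightarrow> (nat \<Rightarrow> nat) \<Rightarrow> bool" where
  "cvrp_instance n c k d \<longleftrightarrow>
     1 \<le> n \<and> 1 \<le> k \<and> metric_cost n c \<and> (\<forall>v\<in>customers n. 1 \<le> d v \<and> d v \<le> k)"

definition cycle_cost :: "(nat \<Rightarrow> nat \<Rightarrow> real) \<Rightarrow> nat list \<Rightarrow> real" where
  "cycle_cost c xs = (\<Sum>i<length xs. c (xs ! i) (xs ! (Suc i mod length xs)))"

text \<open>A tour \<open>(r, u\<^sub>1, \<dots>, u\<^sub>l, r)\<close> is represented by the list of its customers \<open>u\<^sub>1, \<dots>, u\<^sub>l\<close>.\<close>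

definition is_tour :: "nat \<Rightarrow> nat list \<Rightarrow> bool" where
  "is_tour n us \<longleftrightarrow> us \<noteq> [] \<and> distinct us \<and> set us \<subseteq> customers n"

definition tour_cost :: "(nat \<Rightarrow> nat \<Rightarrow> real) \<Rightarrow> nat list \<Rightarrow> real" where
  "tour_cost c us = cycle_cost c (0 # us)"

text \<open>A solution is a set \<open>S\<close> of tours together with a map \<open>a\<close> assigning each customer to
  a tour of \<open>S\<close> visiting it. A tour may also visit customers that are not assigned to it.\<close>

definition feasible ::
  "nat \<Rightarrow> nat \<Rightarrow> (nat \<Rightarrow> nat) \<Rightarrow> nat list set \<Rightarrow> (nat \<Rightarrow> nat list) \<Rightarrow> bool" where
  "feasible n k d S a \<longleftrightarrow>
     finite S \<and> (\<forall>t\<in>S. is_tour n t) \<and>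
     (\<forall>v\<in>customers n. a v \<in> S \<and> v \<in> set (a v)) \<and>
     (\<forall>t\<in>S. (\<Sum>v | v \<in> customers n \<and> a v = t. d v) \<le> k)"

definition solution_cost :: "(nat \<Rightarrow> nat \<Rightarrow> real) \<Rightarrow> nat list set \<Rightarrow> real" where
  "solution_cost c S = (\<Sum>t\<in>S. tour_cost c t)"

definition OPT :: "nat \<Rightarrow> (nat \<Rightarrow> nat \<Rightarrow> real) \<Rightarrow> nat \<Rightarrow> (nat \<Rightarrow> nat) \<Rightarrow> real" where
  "OPT n c k d = Min {solution_cost c S |S a. feasible n k d S a}"

definition tsp_tour :: "nat \<Rightarrow> nat list \<Rightarrow> bool" where
  "tsp_tour n A \<longleftrightarrow> distinct A \<and> set A = vertices n"

definition approx_tsp_tour ::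
  "real \<Rightarrow> nat \<Rightarrow> (nat \<Rightarrow> nat \<Rightarrow> real) \<Rightarrow> nat list \<Rightarrow> bool" where
  "approx_tsp_tour \<alpha> n c A \<longleftrightarrow>
     tsp_tour n A \<and> cycle_cost c A \<le> \<alpha> * Min {cycle_cost c B |B. tsp_tour n B}"

text \<open>Both minima above are taken over finite nonempty sets.\<close>

lemma finite_tours: "finite {t. is_tour n t}"
proof (rule finite_subset)
  have "length t \<le> n" if "distinct t" "set t \<subseteq> {1..n}" for t
    using card_mono[OF _ that(2)] distinct_card[OF that(1)] by simp
  then show "{t. is_tour n t} \<subseteq> {t. set t \<subseteq> customers n \<and> length t \<le> n}"
    by (auto simp: is_tour_def customers_def)
  show "finite {t. set t \<subseteq> customers n \<and> length t \<le> n}"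
    by (rule finite_lists_length_le) (simp add: customers_def)
qed

lemma finite_solution_costs: "finite {solution_cost c S |S a. feasible n k d S a}"
proof (rule finite_subset)
  show "{solution_cost c S |S a. feasible n k d S a} \<subseteq> solution_cost c ` Pow {t. is_tour n t}"
    by (auto simp: feasible_def)
qed (simp add: finite_tours)

lemma solution_costs_nonempty:
  assumes "cvrp_instance n c k d"
  shows "{solution_cost c S |S a. feasible n k d S a} \<noteq> {}"
proof -
  have "{v. v \<in> customers n \<and> [v] = [u]} = {u}" if "u \<in> customers n" for u
    using that by auto
  then have "feasible n k d ((\<lambda>v. [v]) ` customers n) (\<lambda>v. [v])"
    using assms by (auto simp: feasible_def is_tour_def cvrp_instance_def customers_def)
  then show ?thesis by blast
qed

lemma finite_tsp_costs: "finite {cycle_cost c B |B. tsp_tour n B}"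
proof -
  have "finite {B. set B = vertices n \<and> distinct B}"
    by (rule finite_subset[OF _ finite_lists_length_eq[of "vertices n" "Suc n"]])
      (auto simp: vertices_def dest!: distinct_card)
  then have "finite (cycle_cost c ` {B. set B = vertices n \<and> distinct B})" by simp
  then show ?thesis
    by (rule rev_finite_subset) (auto simp: tsp_tour_def)
qed

lemma tsp_costs_nonempty: "{cycle_cost c B |B. tsp_tour n B} \<noteq> {}"
proof -
  have "tsp_tour n [0..<Suc n]" by (auto simp: tsp_tour_def vertices_def)
  then show ?thesis by blast
qed


section \<open>Model of computation\<close>

text \<open>Algorithms are programs of a randomized real RAM, presented as a while language. The memory
  consists of arrays of naturals and of arrays of reals. An array has a fixed name (a number) and
  two computed indices, so that \<open>NAt a i j\<close> is the cell \<open>a[i, j]\<close>; a scalar variable is, say,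
  the cell \<open>a[0, 0]\<close>.

  Naturals are only added, subtracted (truncated at \<open>0\<close>) and compared; in particular there is no
  unit-cost multiplication or division of naturals. Reals admit the four field operations (with
  \<open>x / 0 = 0\<close>) and comparison, and no rounding to a natural is available. The only literals are
  natural numbers, so that no program can contain an arbitrary real constant.\<close>

datatype nexp =
    Lit nat
  | NAt nat nexp nexp
  | NPlus nexp nexp
  | NMinus nexp nexp

datatype rexp =
    OfNat nexp
  | RAt nat nexp nexp
  | RPlus rexp rexp
  | RMinus rexp rexp
  | RTimes rexp rexp
  | RDivide rexp rexp

datatype bexp =
    NLess nexp nexp
  | RLess rexp rexp
  | Neg bexp
  | Conj bexp bexp

datatype com =
    Skip
  | NAssign nat nexp nexp nexp
  | RAssign nat nexp nexp rexp
  | Flip nat nexp nexp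
  | Seq com com
  | Cond bexp com com
  | While bexp com

record state =
  nmem :: "nat \<Rightarrow> nat \<Rightarrow> nat \<Rightarrow> nat"
  rmem :: "nat \<Rightarrow> nat \<Rightarrow> nat \<Rightarrow> real"

primrec nval :: "nexp \<Rightarrow> state \<Rightarrow> nat" where
  "nval (Lit m) s = m"
| "nval (NAt a e f) s = nmem s a (nval e s) (nval f s)"
| "nval (NPlus e f) s = nval e s + nval f s"
| "nval (NMinus e f) s = nval e s - nval f s"

primrec rval :: "rexp \<Rightarrow> state \<Rightarrow> real" where
  "rval (OfNat e) s = real (nval e s)"
| "rval (RAt a e f) s = rmem s a (nval e s) (nval f s)"
| "rval (RPlus p q) s = rval p s + rval q s"
| "rval (RMinus p q) s = rval p s - rval q s"
| "rval (RTimes p q) s = rval p s * rval q s"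
| "rval (RDivide p q) s = rval p s / rval q s"

primrec bval :: "bexp \<Rightarrow> state \<Rightarrow> bool" where
  "bval (NLess e f) s \<longleftrightarrow> nval e s < nval f s"
| "bval (RLess p q) s \<longleftrightarrow> rval p s < rval q s"
| "bval (Neg b) s \<longleftrightarrow> \<not> bval b s"
| "bval (Conj b b') s \<longleftrightarrow> bval b s \<and> bval b' s"

definition upd :: "(nat \<Rightarrow> nat \<Rightarrow> nat \<Rightarrow> 'a) \<Rightarrow> nat \<Rightarrow> nat \<Rightarrow> nat \<Rightarrow> 'a \<Rightarrow> nat \<Rightarrow> nat \<Rightarrow> nat \<Rightarrow> 'a" where
  "upd m a i j x = m(a := (m a)(i := (m a i)(j := x)))"

definition nset :: "nat \<Rightarrow> nat \<Rightarrow> nat \<Rightarrow> nat \<Rightarrow> state \<Rightarrow> state" where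
  "nset a i j x s = s\<lparr>nmem := upd (nmem s) a i j x\<rparr>"

definition rset :: "nat \<Rightarrow> nat \<Rightarrow> nat \<Rightarrow> real \<Rightarrow> state \<Rightarrow> state" where
  "rset a i j x s = s\<lparr>rmem := upd (rmem s) a i j x\<rparr>"

text \<open>Small-step semantics. A program has halted when it has become \<open>Skip\<close>. Running time is the
  number of steps: a step performs at most as many elementary operations as there are
  in the largest expression of the program, which is a constant independent of the input.
  \<open>Flip\<close> stores the result of a fair coin flip.\<close>

primrec step :: "com \<Rightarrow> state \<Rightarrow> (com \<times> state) pmf" where
  "step Skip s = return_pmf (Skip, s)"
| "step (NAssign a e f g) s = return_pmf (Skip, nset a (nval e s) (nval f s) (nval g s) s)"
| "step (RAssign a e f p) s = return_pmf (Skip, rset a (nval e s) (nval f s) (rval p s) s)"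
| "step (Flip a e f) s =
     map_pmf (\<lambda>b. (Skip, nset a (nval e s) (nval f s) (of_bool b) s)) (bernoulli_pmf (1 / 2))"
| "step (Seq P Q) s =
     (if P = Skip then return_pmf (Q, s) else map_pmf (\<lambda>(P', s'). (Seq P' Q, s')) (step P s))"
| "step (Cond b P Q) s = return_pmf (if bval b s then P else Q, s)"
| "step (While b P) s = return_pmf (if bval b s then Seq P (While b P) else Skip, s)"

primrec run :: "nat \<Rightarrow> com \<Rightarrow> state \<Rightarrow> (com \<times> state) pmf" where
  "run 0 P s = return_pmf (P, s)"
| "run (Suc t) P s = bind_pmf (run t P s) (\<lambda>(Q, s'). step Q s')"


section \<open>Algorithms for vehicle routing\<close>

text \<open>Input: \<open>N0[0,0] = n\<close>, \<open>N0[0,1] = k\<close>, \<open>N1[v,0]\<close> is the demand of customer \<open>v\<close>, \<open>N2[i,0]\<close> is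
  the vertex at position \<open>i\<close> of the given TSP tour, and \<open>R0[u,v]\<close> is the cost of the edge \<open>uv\<close>.
  All other cells are \<open>0\<close>.\<close>

definition input ::
  "nat \<Rightarrow> (nat \<Rightarrow> nat \<Rightarrow> real) \<Rightarrow> nat \<Rightarrow> (nat \<Rightarrow> nat) \<Rightarrow> nat list \<Rightarrow> state" where
  "input n c k d A = \<lparr>
     nmem = (\<lambda>a i j.
       if a = 0 \<and> i = 0 \<and> j = 0 then n
       else if a = 0 \<and> i = 0 \<and> j = 1 then k
       else if a = 1 \<and> i \<in> customers n \<and> j = 0 then d i
       else if a = 2 \<and> i < length A \<and> j = 0 then A ! i
       else 0),
     rmem = (\<lambda>a i j. if a = 0 \<and> i \<in> vertices n \<and> j \<in> vertices n then c i j else 0)\<rparr>"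

text \<open>Output: \<open>N3[0,0]\<close> is the number of tours, the tour with index \<open>j\<close> is
  \<open>N4[j,1], \<dots>, N4[j,l]\<close> where \<open>l = N4[j,0]\<close>, and customer \<open>v\<close> is assigned to the
  tour with index \<open>N5[v,0]\<close>.\<close>

definition output_tour :: "state \<Rightarrow> nat \<Rightarrow> nat list" where
  "output_tour s j = map (nmem s 4 j) [1..<Suc (nmem s 4 j 0)]"

definition output_tours :: "state \<Rightarrow> nat list set" where
  "output_tours s = output_tour s ` {..<nmem s 3 0 0}"

definition output_assignment :: "state \<Rightarrow> nat \<Rightarrow> nat list" where
  "output_assignment s v = output_tour s (nmem s 5 v 0)"

text \<open>Given an \<open>\<alpha>\<close>-approximate TSP tour, the program \<open>P\<close> always halts within \<open>T n\<close> steps.\<close>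

definition runs_in_time :: "real \<Rightarrow> com \<Rightarrow> (nat \<Rightarrow> nat) \<Rightarrow> bool" where
  "runs_in_time \<alpha> P T \<longleftrightarrow>
     (\<forall>n c k d A. cvrp_instance n c k d \<and> approx_tsp_tour \<alpha> n c A \<longrightarrow>
        (\<forall>(Q, s) \<in> set_pmf (run (T n) P (input n c k d A)). Q = Skip))"

text \<open>Given an \<open>\<alpha>\<close>-approximate TSP tour, the program \<open>P\<close>, which halts within \<open>T n\<close> steps, always
  outputs a feasible solution, and the expected cost of its output is at most \<open>\<rho> * OPT\<close>.\<close>

definition has_approx_ratio :: "real \<Rightarrow> com \<Rightarrow> (nat \<Rightarrow> nat) \<Rightarrow> real \<Rightarrow> bool" where
  "has_approx_ratio \<alpha> P T \<rho> \<longleftrightarrow>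
     (\<forall>n c k d A. cvrp_instance n c k d \<and> approx_tsp_tour \<alpha> n c A \<longrightarrow>
        (\<forall>(Q, s) \<in> set_pmf (run (T n) P (input n c k d A)).
           feasible n k d (output_tours s) (output_assignment s)) \<and>
        measure_pmf.expectation (run (T n) P (input n c k d A))
          (\<lambda>(Q, s). solution_cost c (output_tours s)) \<le> \<rho> * OPT n c k d)"

end

(* Write radial v = 2 c(0,v) d_v / k, so that the total radial cost is a lower bound on OPT, and let
   t, m, l be the parts of it due to the customers with d_v <= k/q (where q is about 4/delta), with
   k/q < d_v <= k/3 and with d_v > k/3, relative to OPT.

   Every variant first serves some customers and then cuts the given tour, shortcut to the remaining
   ones, optimally into segments. Cutting at a random offset shows that a remaining customer costs
   about radial v if d_v <= k/q and at most 2 radial v otherwise; alternatively 3/2 radial v if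
   d_v <= k/3 and at most 2 radial v otherwise.

   (1) Serve customers with d_v > k/q by tours chosen greedily by the ratio of the penalties covered
   to the tour cost, while this ratio exceeds 1. No linear program is needed: with initial penalty W,
   cost plus remaining penalty is at most 1 + ln W (in units of OPT). The two penalties above give
   t + 1 + ln (2 m + 2 l) and 3/2 t + 1 + ln (3/2 m + 2 l).
   (2) Serve the customers with d_v > k/3, at most two of which fit in a tour, by a matching which
   local search finds up to a factor 1 + O(1/q); the total is 1 + 3/2 (t + m).

   The best of the three exceeds 1 by at most y1 + ln (2 - 2 y1), up to O(1/q); all come on top of the
   cost of the given tour, which is at most alpha OPT. *)

theory Submission
  imports Defs "HOL-Library.Sublist"
begin

text \<open>The equation for y1 says that all three variants are equally bad. Take t + m + l = 1.
  The first gives t + ln (2 - 2 t), which decreases in t. If the matching variant exceeds an excess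
  E, then m >= 2/3 E - t, so 3/2 m + 2 l <= 2 - 3/2 t - E/3, and the bound 3/2 t + ln (2 - 3/2 t -
  E/3) of the remaining variant increases in t. Equating both at t = y with E = y + ln (2 - 2 y)
  leaves exactly the balance equation.

  Three obstacles shape the rest. With real costs nothing evident bounds the number of improving
  steps to a local optimum, so the local search runs for a fixed number of rounds and a gap is shown
  to contract. The optimum may be 0 while the greedy potential needs a positive scale, so the bounds
  are proved for every positive M >= OPT. The machine has natural literals only and no rounding, so
  \<delta> enters the program through the integer q alone; the program is deterministic and consists
  of loops with n + 1 or constantly many rounds, from whose nesting the running time is read
  off.\<close>

section \<open>The root of the balance equation\<close>

lemma exp_upper_10:
  fixes x :: real
  assumes "0 \<le> x" "x \<le> 1"
  shows "exp x \<le> (\<Sum>m<10. x ^ m / fact m) + 3 / fact 10 * x ^ 10"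
proof -
  obtain t :: real where t: "\<bar>t\<bar> \<le> \<bar>x\<bar>"
      "exp x = (\<Sum>m<10. x ^ m / fact m) + exp t / fact 10 * x ^ 10"
    using Maclaurin_exp_le by blast
  have "exp t \<le> exp (1::real)" using t(1) assms by simp
  also have "\<dots> \<le> 3" by (rule exp_le)
  finally have "exp t / fact 10 * x ^ 10 \<le> (3::real) / fact 10 * x ^ 10"
    using assms by (intro mult_right_mono divide_right_mono) auto
  then show ?thesis using t(2) by simp
qed

lemma exp_lower_10:
  fixes x :: real
  shows "(\<Sum>m<10. x ^ m / fact m) \<le> exp x"
proof -
  obtain t :: real where t: 
      "exp x = (\<Sum>m<10. x ^ m / fact m) + exp t / fact 10 * x ^ 10"
    using Maclaurin_exp_le by blast
  have "0 \<le> exp t / fact 10 * x ^ 10" by simp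
  then show ?thesis using t by linarith
qed

definition balance :: "real \<Rightarrow> real" where
  "balance y = y / 2 + 6 * (1 - y) * (1 - exp (- (y / 2))) - ln (2 - 2 * y)"

text \<open>With \<open>u = exp (- (y / 2)) > 0.6065\<close> and \<open>w = 1 - y > 0\<close>, the
  derivative is 1/2 - 6 (1 - u) + 3 w u + 1/w. The first two terms exceed -1.87, while the last two
  are at least 2.6. Monotonicity on the whole half-line y < 1 makes the root unique there.\<close>

lemma balance_strict_mono:
  assumes "a < b" "b < 1"
  shows "balance a < balance b"
proof (rule DERIV_pos_imp_increasing[OF assms(1)])
  fix y :: real
  assume "a \<le> y" "y \<le> b"
  then have y: "y < 1" using assms by simp
  define u where "u = exp (- (y / 2))"
  have der: "(balance has_real_derivative 1 / 2 - 6 * (1 - u) + 3 * (1 - y) * u + 1 / (1 - y)) (at y)"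
    unfolding balance_def[abs_def] u_def
    by (rule derivative_eq_intros refl | use y in \<open>simp add: field_simps\<close>)+
  have u0: "exp (- (1 / 2)) < u" unfolding u_def using y by simp
  have "(6065::real) / 10000 < exp (- (1 / 2))"
  proof -
    have "exp (1/2::real) < 16487213 / 10000000"
      by (rule le_less_trans[OF exp_upper_10]) (simp_all add: lessThan_nat_numeral fact_numeral power_divide)
    then show ?thesis by (simp add: exp_minus field_simps)
  qed
  then have u: "6065 / 10000 < u" using u0 by simp
  define w where "w = 1 - y"
  have w: "0 < w" using y by (simp add: w_def)
  have "1.8195 * w \<le> 3 * w * u" using u w by simp
  moreover have "1.8 * w + 1 / w \<ge> 2.6"
  proof -
    \<comment> \<open>AM-GM for 1.69 w and 1/w, whose geometric mean is 1.3; the coefficient 1.8 is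
      at least 1.69.\<close>
    have "0 \<le> (w * 1.3 - 1)\<^sup>2" by simp
    then have "2.6 * w \<le> 1.69 * (w * w) + 1" by (simp add: power2_eq_square algebra_simps)
    then have "2.6 * w \<le> 1.8 * (w * w) + 1" using mult_pos_pos[OF w w] by (simp add: field_simps)
    then show ?thesis using w by (simp add: field_simps)
  qed
  moreover have "1 / 2 - 6 * (1 - u) + a + b > 0"
    if "1.8195 * w \<le> a" "1.8 * w + b \<ge> 2.6" for a b :: real
    using that u w by (simp add: field_simps)
  ultimately have "1 / 2 - 6 * (1 - u) + 3 * w * u + 1 / w > 0" by blast
  then show "\<exists>z. (balance has_real_derivative z) (at y) \<and> 0 < z"
    using der unfolding w_def by blast
qed

text \<open>The value is within 1e-4 of zero, so the estimates carry about six digits. The constants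
  are 2 - 2 * 0.17458 = 1.65084 and 6 * (1 - 0.17458) = 4.95252.\<close>

lemma balance_neg: "balance 0.17458 < 0"
proof -
  have "exp (0.501275::real) \<le> 1.65084"
    by (rule order_trans[OF exp_upper_10]) (simp_all add: lessThan_nat_numeral fact_numeral power_divide)
  then have "0.501275 \<le> ln (1.65084::real)"
    using ln_mono[of "exp (0.501275::real)" "1.65084"] by simp
  moreover have "exp (- 0.08729::real) \<ge> 0.916410"
    by (rule order_trans[OF _ exp_lower_10]) (simp add: lessThan_nat_numeral fact_numeral power_divide)
  moreover have "balance 0.17458 = 0.08729 + 4.95252 * (1 - exp (- 0.08729)) - ln 1.65084"
    by (simp add: balance_def)
  moreover have "0.08729 + 4.95252 * (1 - e) - L < 0" if "0.501275 \<le> L" "e \<ge> 0.916410" for e L :: real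
    using that by (simp add: field_simps)
  ultimately show ?thesis by metis
qed

lemma balance_pos: "0 < balance 0.2"
proof -
  have "(1.6::real) \<le> exp (1 / 2)"
    using exp_lower_Taylor_quadratic[of "1/2::real"] by (simp add: power2_eq_square)
  then have "ln (1.6::real) \<le> 1 / 2"
    using ln_mono[of "1.6" "exp (1 / 2::real)"] by simp
  moreover have "exp (- 0.1::real) \<le> 0.91"
  proof -
    have "1.1 \<le> exp (0.1::real)" using exp_ge_add_one_self[of "0.1::real"] by simp
    then show ?thesis by (simp add: exp_minus field_simps)
  qed
  moreover have "balance 0.2 = 0.1 + 4.8 * (1 - exp (- 0.1)) - ln 1.6" by (simp add: balance_def)
  moreover have "0 < 0.1 + 4.8 * (1 - e) - L" if "L \<le> 1 / 2" "e \<le> 0.91" for e L :: real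
    using that by (simp add: field_simps)
  ultimately show ?thesis by metis
qed

definition balance_root :: real where
  "balance_root = (THE y. y < 1 \<and> balance y = 0)"

lemma balance_root_exists: "\<exists>!y. y < 1 \<and> balance y = 0"
proof -
  have "continuous_on {0.17458..0.2} balance"
    unfolding balance_def[abs_def] by (intro continuous_intros) auto
  then obtain y where "0.17458 \<le> y" "y \<le> 0.2" "balance y = 0"
    using IVT'[of balance "0.17458" 0 "0.2"] balance_neg balance_pos by force
  moreover have "y' = y" if "y' < 1" "balance y' = 0" for y'
    using balance_strict_mono[of y y'] balance_strict_mono[of y' y] that calculation
    by (cases y y' rule: linorder_cases) auto
  ultimately show ?thesis by (intro ex1I[of _ y]) auto
qed

lemma balance_root: "balance_root < 1" "balance balance_root = 0"
  using theI'[OF balance_root_exists] by (simp_all add: balance_root_def)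

lemma balance_root_unique: "y < 1 \<and> balance y = 0 \<longleftrightarrow> y = balance_root"
  using balance_root balance_root_exists by blast

lemma balance_root_bounds: "0.17458 < balance_root" "balance_root < 0.2"
proof -
  have mono: "balance a \<le> balance b" if "a \<le> b" "b < 1" for a b
    using balance_strict_mono[of a b] that by (cases "a = b") auto
  show "0.17458 < balance_root"
    using mono[of balance_root "0.17458"] balance_neg balance_root(2) by (rule_tac ccontr) simp
  show "balance_root < 0.2"
    using mono[of "0.2" balance_root] balance_pos balance_root by (rule_tac ccontr) simp
qed

section \<open>The best of the three variants\<close>

definition excess :: real where
  "excess = balance_root + ln (2 - 2 * balance_root)"

lemma add_ln_decreasing:
  fixes s t :: real
  assumes "0 \<le> s" "s \<le> t" "t < 1"
  shows "t + ln (2 - 2 * t) \<le> s + ln (2 - 2 * s)"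
proof -
  have "ln (2 - 2 * t) - ln (2 - 2 * s) = ln ((2 - 2 * t) / (2 - 2 * s))"
    using assms by (simp add: ln_div)
  also have "\<dots> \<le> (2 - 2 * t) / (2 - 2 * s) - 1"
    using assms by (intro ln_le_minus_one) simp
  also have "\<dots> \<le> s - t"
  proof -
    have "(2 - 2 * t) / (2 - 2 * s) - 1 = - ((t - s) / (1 - s))"
      using assms by (simp add: field_simps)
    moreover have "t - s \<le> (t - s) / (1 - s)"
      using assms mult_left_mono[of s t s] by (simp add: field_simps)
    ultimately show ?thesis by linarith
  qed
  finally show ?thesis by simp
qed

text \<open>The map y + ln (2 - 2 y) decreases, so bounds on the root turn around. The upper bound
  stays 2e-5 below 0.6759, which pays for \<delta> < 1e-5.\<close>

lemma excess_bounds: "1 / 2 < excess" "excess \<le> 0.67588"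
proof -
  have "exp (0.5013::real) \<ge> 1.65084"
    by (rule order_trans[OF _ exp_lower_10]) (simp add: lessThan_nat_numeral fact_numeral power_divide)
  then have "ln (1.65084::real) \<le> 0.5013"
    using ln_mono[of "1.65084" "exp (0.5013::real)"] by simp
  moreover have "excess \<le> 0.17458 + ln (2 - 2 * 0.17458)"
    unfolding excess_def using balance_root_bounds by (intro add_ln_decreasing) auto
  ultimately show "excess \<le> 0.67588" by simp
  have "0.2 + ln (2 - 2 * 0.2) \<le> excess"
    unfolding excess_def using balance_root_bounds by (intro add_ln_decreasing) auto
  moreover have "ln (1.6::real) \<ge> 0.375"
    using ln_le_minus_one[of "1 / 1.6::real"] by (simp add: ln_div)
  ultimately show "1 / 2 < excess" by simp
qed

text \<open>The integral of min 1 (1/w) over w from 0 to x. With the optimum scaled to 1, some tour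
  covers a remaining penalty w at ratio at least w, so removing dw costs at most dw / w; a remainder
  below 1 is simply paid.\<close>

definition greedy_bound :: "real \<Rightarrow> real" where
  "greedy_bound x = (if x \<le> 1 then x else 1 + ln x)"

lemma greedy_bound_mono: "x \<le> y \<Longrightarrow> greedy_bound x \<le> greedy_bound y"
  by (cases "y \<le> 1"; cases "x \<le> 1") (auto simp: greedy_bound_def intro: order_trans[of _ 1])

lemma best_of_three:
  fixes t m l :: real
  assumes "0 \<le> t" "0 \<le> m" "0 \<le> l" "t + m + l \<le> 1"
  shows "t + greedy_bound (2 * m + 2 * l) \<le> 1 + excess \<or>
    3 / 2 * t + greedy_bound (3 / 2 * m + 2 * l) \<le> 1 + excess \<or>
    1 + 3 / 2 * (t + m) \<le> 1 + excess"
proof (cases "balance_root \<le> t")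
  case True
  have "t + greedy_bound (2 * m + 2 * l) \<le> t + greedy_bound (2 - 2 * t)"
    using assms greedy_bound_mono[of "2 * m + 2 * l" "2 - 2 * t"] by simp
  also have "\<dots> \<le> 1 + excess"
  proof (cases "t < 1 / 2")
    case True
    then show ?thesis
      using add_ln_decreasing[of balance_root t] \<open>balance_root \<le> t\<close> balance_root_bounds
      by (simp add: greedy_bound_def excess_def)
  next
    case False
    \<comment> \<open>Now 2 - 2 t <= 1 and \<open>greedy_bound\<close> is linear: t + 2 - 2 t <= 3/2
      < 1 + \<open>excess\<close>.\<close>
    then show ?thesis using excess_bounds by (simp add: greedy_bound_def)
  qed
  finally show ?thesis by blast
next
  case False
  define y where "y = balance_root"
  have y: "0.17458 < y" "y < 0.2" using balance_root_bounds by (simp_all add: y_def)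
  have bal: "y / 2 + 6 * (1 - y) * (1 - exp (- (y / 2))) = ln (2 - 2 * y)"
    using balance_root(2) by (simp add: balance_def y_def)
  show ?thesis
  proof (cases "3 / 2 * (t + m) \<le> excess")
    case False
    \<comment> \<open>An upper bound for 3/2 m + 2 l = 2 (m + l) - m / 2: the failure of the
      matching variant gives m > 2/3 \<open>excess\<close> - t.\<close>
    define z where "z = 2 - 3 / 2 * t - excess / 3"
    define z1 where "z1 = 2 - 3 / 2 * y - excess / 3"
    have z1: "1 \<le> z1" using y excess_bounds by (simp add: z1_def)
    have zz: "z1 < z" using \<open>\<not> balance_root \<le> t\<close> by (simp add: z_def z1_def y_def)
    have "3 / 2 * m + 2 * l \<le> z" using False assms by (simp add: z_def)
    then have "greedy_bound (3 / 2 * m + 2 * l) \<le> 1 + ln z"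
      using greedy_bound_mono[of _ z] z1 zz by (force simp: greedy_bound_def)
    \<comment> \<open>As z >= 1, the logarithm has slope at most 3/2 in 3/2 (y - t); lowering t
      below y therefore raises it by no more than the term 3/2 t falls.\<close>
    moreover have "ln z \<le> ln z1 + 3 / 2 * (y - t)"
    proof -
      have "ln z - ln z1 = ln (z / z1)" using z1 zz by (simp add: ln_div)
      also have "\<dots> \<le> z / z1 - 1" using z1 zz by (intro ln_le_minus_one) simp
      also have "\<dots> = (z - z1) / z1" using z1 by (simp add: field_simps)
      also have "\<dots> \<le> z - z1" using z1 zz mult_nonneg_nonneg[of "z - z1" "z1 - 1"] by (simp add: field_simps)
      also have "\<dots> = 3 / 2 * (y - t)" by (simp add: z_def z1_def algebra_simps)
      finally show ?thesis by linarith
    qed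
    moreover have "ln z1 = ln (2 - 2 * y) - y / 2"
    proof -
      \<comment> \<open>The only use of the balance equation: it turns \<open>z1\<close> into (2 - 2
        y) exp (- y / 2).\<close>
      have "excess = 3 / 2 * y + 6 * (1 - y) * (1 - exp (- (y / 2)))"
        using bal by (simp add: excess_def y_def)
      then have "z1 = (2 - 2 * y) * exp (- (y / 2))" by (simp add: z1_def field_simps)
      then show ?thesis using y by (simp add: ln_mult)
    qed
    moreover have "3 / 2 * t + g \<le> 1 + (y + L)"
      if "g \<le> 1 + Z" "Z \<le> L1 + 3 / 2 * (y - t)" "L1 = L - y / 2" for g Z L1 L
      using that by (simp add: field_simps)
    ultimately have "3 / 2 * t + greedy_bound (3 / 2 * m + 2 * l) \<le> 1 + excess"
      unfolding excess_def y_def by metis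
    then show ?thesis by blast
  qed simp
qed

section \<open>Walks, shortcuts and lower bounds on the optimum\<close>

text \<open>Replaces the indices modulo the length in \<open>cycle_cost\<close> by a recursion over
  the list; a closed tour is a walk whose list ends with its start.\<close>

primrec walk_cost :: "(nat \<Rightarrow> nat \<Rightarrow> real) \<Rightarrow> nat \<Rightarrow> nat list \<Rightarrow> real" where
  "walk_cost c u [] = 0"
| "walk_cost c u (v # vs) = c u v + walk_cost c v vs"

lemma walk_cost_append: "walk_cost c u (xs @ ys) = walk_cost c u xs + walk_cost c (last (u # xs)) ys"
  by (induction xs arbitrary: u) auto

lemma walk_cost_snoc: "walk_cost c u (xs @ [v]) = walk_cost c u xs + c (last (u # xs)) v"
  by (simp add: walk_cost_append)

lemma walk_cost_eq_sum: "walk_cost c u xs = (\<Sum>i<length xs. c ((u # xs) ! i) (xs ! i))"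
proof (induction xs arbitrary: u)
  case (Cons v vs)
  then show ?case by (simp add: sum.lessThan_Suc_shift del: sum.lessThan_Suc)
qed simp

lemma cycle_cost_eq_path: "cycle_cost c (u # xs) = walk_cost c u (xs @ [u])"
  unfolding cycle_cost_def walk_cost_eq_sum
proof (rule sum.cong)
  fix i assume "i \<in> {..<length (xs @ [u])}"
  then show "c ((u # xs) ! i) ((u # xs) ! (Suc i mod length (u # xs))) = c ((u # xs @ [u]) ! i) ((xs @ [u]) ! i)"
    by (cases "i = length xs") (auto simp: nth_Cons' nth_append)
qed simp

lemma tour_cost_eq_path: "tour_cost c us = walk_cost c 0 (us @ [0])"
  by (simp add: tour_cost_def cycle_cost_eq_path)

lemma cycle_cost_rotate: "cycle_cost c (xs @ u # ys) = walk_cost c u (ys @ xs @ [u])"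
proof (cases xs)
  case (Cons x xs')
  then show ?thesis by (simp add: cycle_cost_eq_path walk_cost_append)
qed (simp add: cycle_cost_eq_path)

lemma tour_cost_Nil: "c 0 0 = 0 \<Longrightarrow> tour_cost c [] = 0"
  by (simp add: tour_cost_eq_path)

locale cvrp =
  fixes n :: nat and c :: "nat \<Rightarrow> nat \<Rightarrow> real" and k :: nat and d :: "nat \<Rightarrow> nat"
  assumes cvrp_instance: "cvrp_instance n c k d"
begin

lemma k_pos: "0 < k" and n_pos: "0 < n"
  and demand: "v \<in> customers n \<Longrightarrow> 0 < d v \<and> d v \<le> k"
  and cost_nonneg: "u \<in> vertices n \<Longrightarrow> v \<in> vertices n \<Longrightarrow> 0 \<le> c u v"
  and cost_sym: "u \<in> vertices n \<Longrightarrow> v \<in> vertices n \<Longrightarrow> c u v = c v u"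
  and cost_refl: "u \<in> vertices n \<Longrightarrow> c u u = 0"
  and triangle: "u \<in> vertices n \<Longrightarrow> v \<in> vertices n \<Longrightarrow> w \<in> vertices n \<Longrightarrow> c u w \<le> c u v + c v w"
  using cvrp_instance by (auto simp: cvrp_instance_def metric_cost_def Suc_le_eq)

lemma depot_vertex [simp]: "0 \<in> vertices n"
  by (simp add: vertices_def)

lemma depot_not_customer [simp]: "0 \<notin> customers n"
  by (simp add: customers_def)

lemma customer_vertex: "v \<in> customers n \<Longrightarrow> v \<in> vertices n"
  by (simp add: vertices_def customers_def)

lemma finite_customers [simp]: "finite (customers n)"
  by (simp add: customers_def)

lemma cost_depot [simp]: "c 0 0 = 0"
  by (simp add: cost_refl)

lemma walk_cost_nonneg:
  "u \<in> vertices n \<Longrightarrow> set xs \<subseteq> vertices n \<Longrightarrow> 0 \<le> walk_cost c u xs"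
  by (induction xs arbitrary: u) (auto intro!: add_nonneg_nonneg cost_nonneg)

lemma tour_cost_nonneg: "set us \<subseteq> vertices n \<Longrightarrow> 0 \<le> tour_cost c us"
  by (simp add: tour_cost_eq_path walk_cost_nonneg)

lemma walk_cost_shortcut_first:
  assumes "u \<in> vertices n" "x \<in> vertices n" "set ys \<subseteq> vertices n" "ys \<noteq> []"
  shows "walk_cost c u ys \<le> c u x + walk_cost c x ys"
  using assms triangle[of u x] by (cases ys) auto

lemma subseq_set: "subseq xs ys \<Longrightarrow> set xs \<subseteq> set ys"
  by (induction rule: list_emb.induct) auto

text \<open>Shortcutting by the triangle inequality. The common end vertex \<open>z\<close> makes
  the deletion of a final stretch, or of the whole list, a shortcut as well.\<close>

lemma walk_cost_subseq:
  assumes "subseq ys xs" "u \<in> vertices n" "z \<in> vertices n" "set xs \<subseteq> vertices n"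
  shows "walk_cost c u (ys @ [z]) \<le> walk_cost c u (xs @ [z])"
  using assms
proof (induction arbitrary: u rule: list_emb.induct)
  case (list_emb_Nil ys)
  then show ?case
  proof (induction ys arbitrary: u)
    case (Cons y ys)
    then show ?case using triangle[of u y z] Cons.IH[of y] by force
  qed simp
next
  case (list_emb_Cons xs ys y)
  have "set xs \<subseteq> vertices n"
    using subseq_set[OF list_emb_Cons.hyps] list_emb_Cons.prems by auto
  then have "walk_cost c u (xs @ [z]) \<le> c u y + walk_cost c y (xs @ [z])"
    using list_emb_Cons.prems by (intro walk_cost_shortcut_first) auto
  then show ?case using list_emb_Cons.IH[of y] list_emb_Cons.prems by simp
next
  case (list_emb_Cons2 x y xs ys)
  then show ?case by simp
qed

lemma tour_cost_subseq:
  "subseq ys xs \<Longrightarrow> set xs \<subseteq> vertices n \<Longrightarrow> tour_cost c ys \<le> tour_cost c xs"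
  by (simp add: tour_cost_eq_path walk_cost_subseq)

lemma tour_cost_single: "v \<in> customers n \<Longrightarrow> tour_cost c [v] = 2 * c 0 v"
  using cost_sym[of v 0] by (simp add: tour_cost_eq_path customer_vertex)

lemma radius_le_tour_cost:
  assumes "v \<in> set us" "set us \<subseteq> customers n"
  shows "2 * c 0 v \<le> tour_cost c us"
proof -
  have "subseq [v] us" using assms(1) by (simp add: subseq_singleton_left)
  then show ?thesis
    using tour_cost_subseq[of "[v]" us] tour_cost_single[of v] assms customer_vertex by force
qed

text \<open>The share of customer \<open>v\<close> in the radial lower bound on \<open>OPT\<close>.\<close>

definition radial :: "nat \<Rightarrow> real" where
  "radial v = 2 * c 0 v * real (d v) / real k"

lemma radial_nonneg: "v \<in> customers n \<Longrightarrow> 0 \<le> radial v"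
  by (simp add: radial_def cost_nonneg customer_vertex)

text \<open>The tours of a feasible solution, shortcut to \<open>U\<close>, cover \<open>U\<close>.\<close>

lemma covering_bound:
  assumes feas: "feasible n k d S a" and U: "U \<subseteq> customers n"
    and r: "0 \<le> r"
    and w: "\<And>ys. distinct ys \<Longrightarrow> set ys \<subseteq> U \<Longrightarrow> sum d (set ys) \<le> k \<Longrightarrow> sum w (set ys) \<le> r * tour_cost c ys"
  shows "sum w U \<le> r * solution_cost c S"
proof -
  have "finite S" and tours: "\<And>t. t \<in> S \<Longrightarrow> distinct t \<and> set t \<subseteq> customers n"
    and asg: "\<And>v. v \<in> customers n \<Longrightarrow> a v \<in> S \<and> v \<in> set (a v)"
    and cap: "\<And>t. t \<in> S \<Longrightarrow> (\<Sum>v | v \<in> customers n \<and> a v = t. d v) \<le> k"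
    using feas by (auto simp: feasible_def is_tour_def)
  have finU: "finite U" by (rule finite_subset[OF U]) simp
  have "sum w U = (\<Sum>t\<in>S. sum w {v \<in> U. a v = t})"
    using finU \<open>finite S\<close> asg U by (intro sum.group[symmetric]) auto
  also have "\<dots> \<le> (\<Sum>t\<in>S. r * tour_cost c t)"
  proof (rule sum_mono)
    fix t assume t: "t \<in> S"
    \<comment> \<open>Tours may overlap, so \<open>t\<close> is shortcut to those customers of
      \<open>U\<close> that are assigned to it. These lists partition \<open>U\<close>, and each
      respects the capacity.\<close>
    define ys where "ys = filter (\<lambda>v. v \<in> U \<and> a v = t) t"
    have set: "set ys = {v \<in> U. a v = t}" using asg U by (auto simp: ys_def)
    have "sum d (set ys) \<le> (\<Sum>v | v \<in> customers n \<and> a v = t. d v)"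
      unfolding set using U by (intro sum_mono2) auto
    then have "sum w (set ys) \<le> r * tour_cost c ys"
      using cap[OF t] tours[OF t] by (intro w) (auto simp: ys_def)
    also have "\<dots> \<le> r * tour_cost c t"
      using r tours[OF t] customer_vertex by (intro mult_left_mono tour_cost_subseq) (auto simp: ys_def)
    finally show "sum w {v \<in> U. a v = t} \<le> r * tour_cost c t" unfolding set .
  qed
  finally show ?thesis by (simp add: solution_cost_def sum_distrib_left)
qed

text \<open>A tour costs at least 2 c(0,v) for each of its customers, so \<open>radial v\<close> is
  at most the fraction d_v / k of the tour cost, and these fractions sum to at most 1 over the
  customers it serves.\<close>

lemma sum_radial_le:
  assumes "feasible n k d S a"
  shows "sum radial (customers n) \<le> solution_cost c S"
proof -
  have "sum radial (set ys) \<le> 1 * tour_cost c ys"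
    if ys: "distinct ys" "set ys \<subseteq> customers n" "sum d (set ys) \<le> k" for ys
  proof -
    have nn: "0 \<le> tour_cost c ys" using ys customer_vertex by (intro tour_cost_nonneg) auto
    have "sum radial (set ys) \<le> (\<Sum>v\<in>set ys. tour_cost c ys * (real (d v) / real k))"
    proof (rule sum_mono)
      fix v assume "v \<in> set ys"
      then have "2 * c 0 v * (real (d v) / real k) \<le> tour_cost c ys * (real (d v) / real k)"
        using radius_le_tour_cost ys by (intro mult_right_mono) auto
      then show "radial v \<le> tour_cost c ys * (real (d v) / real k)" by (simp add: radial_def)
    qed
    also have "\<dots> = tour_cost c ys * (real (sum d (set ys)) / real k)"
      by (simp add: sum_distrib_left sum_divide_distrib)
    also have "\<dots> \<le> tour_cost c ys * 1"
      using ys(3) k_pos nn by (intro mult_left_mono) (simp_all flip: of_nat_sum)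
    finally show ?thesis by simp
  qed
  from covering_bound[OF assms subset_refl _ this] show ?thesis by simp
qed

lemma tour_cost_append_le:
  assumes "set xs \<subseteq> vertices n" "set ys \<subseteq> vertices n"
  shows "tour_cost c (xs @ ys) \<le> tour_cost c xs + tour_cost c ys"
proof -
  have "subseq (xs @ ys) (xs @ [0] @ ys)" by (intro list_emb_append_mono subseq_order.order_refl) (simp add: list_emb_Cons)
  then have "tour_cost c (xs @ ys) \<le> tour_cost c (xs @ [0] @ ys)"
    using assms by (intro tour_cost_subseq) auto
  then show ?thesis by (simp add: tour_cost_eq_path walk_cost_append)
qed

lemma tour_cost_concat_le:
  assumes "\<And>t. t \<in> set ts \<Longrightarrow> set t \<subseteq> vertices n"
  shows "tour_cost c (concat ts) \<le> (\<Sum>t\<leftarrow>ts. tour_cost c t)"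
  using assms
proof (induction ts)
  case (Cons t ts)
  have "tour_cost c (t @ concat ts) \<le> tour_cost c t + tour_cost c (concat ts)"
    using Cons.prems by (intro tour_cost_append_le) auto
  then show ?case using Cons by fastforce
qed (simp add: tour_cost_Nil)

lemma subseq_remdups: "subseq (remdups xs) xs"
  by (induction xs) auto

text \<open>Traverse all tours of the solution one after the other, keep one occurrence of each
  customer and drop the intermediate visits of the depot. This makes an \<alpha>-approximate tour
  cost at most \<alpha> OPT.\<close>

lemma tsp_le:
  assumes "feasible n k d S a"
  shows "Min {cycle_cost c B |B. tsp_tour n B} \<le> solution_cost c S"
proof -
  have S: "finite S" "\<And>t. t \<in> S \<Longrightarrow> set t \<subseteq> customers n"
    "\<And>v. v \<in> customers n \<Longrightarrow> a v \<in> S \<and> v \<in> set (a v)"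
    using assms by (auto simp: feasible_def is_tour_def)
  obtain ts where ts: "set ts = S" "distinct ts" using finite_distinct_list[OF S(1)] by blast
  define B where "B = 0 # remdups (concat ts)"
  have "set (concat ts) = customers n" using S ts by fastforce
  then have "tsp_tour n B" by (auto simp: B_def tsp_tour_def vertices_def customers_def)
  then have "Min {cycle_cost c B |B. tsp_tour n B} \<le> cycle_cost c B"
    by (intro Min_le finite_tsp_costs) blast
  also have "\<dots> = tour_cost c (remdups (concat ts))" by (simp add: B_def tour_cost_def)
  also have "\<dots> \<le> tour_cost c (concat ts)"
    using S ts customer_vertex by (intro tour_cost_subseq subseq_remdups) fastforce
  also have "\<dots> \<le> (\<Sum>t\<leftarrow>ts. tour_cost c t)"
    using S ts customer_vertex by (intro tour_cost_concat_le) fastforce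
  also have "\<dots> = solution_cost c S"
    using ts by (simp add: solution_cost_def sum_list_distinct_conv_sum_set)
  finally show ?thesis .
qed

lemma OPT_attained: obtains S a where "feasible n k d S a" "solution_cost c S = OPT n c k d"
proof -
  have "OPT n c k d \<in> {solution_cost c S |S a. feasible n k d S a}"
    unfolding OPT_def by (intro Min_in finite_solution_costs solution_costs_nonempty cvrp_instance)
  then show ?thesis using that by auto
qed

end

subsection \<open>Iterated tour partitioning\<close>

text \<open>Derandomizes the offset: an expected cost over uniformly random offsets is attained or
  undercut by one of them.\<close>

lemma exists_le_average:
  fixes f :: "nat \<Rightarrow> real"
  assumes "0 < s"
  obtains i where "i < s" "f i \<le> (\<Sum>j<s. f j) / real s"
proof (rule ccontr)
  assume "\<not> thesis"
  then have "\<And>i. i < s \<Longrightarrow> (\<Sum>j<s. f j) / real s < f i" using that by (meson not_le)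
  then have "(\<Sum>i<s. (\<Sum>j<s. f j) / real s) < (\<Sum>i<s. f i)"
    using assms by (intro sum_strict_mono) auto
  then show False using assms by simp
qed

lemma residue_in_block:
  fixes s :: nat
  assumes "\<theta> < s" "a + s \<le> b"
  obtains x where "a \<le> x" "x < b" "x mod s = \<theta>"
proof -
  define x where "x = a + (\<theta> + s - a mod s) mod s"
  have "x mod s = \<theta>"
  proof -
    have "x mod s = (a mod s + (\<theta> + s - a mod s)) mod s" unfolding x_def by (simp add: mod_simps)
    also have "a mod s + (\<theta> + s - a mod s) = \<theta> + s"
      using assms(1) mod_less_divisor[of s a] by linarith
    finally show ?thesis using assms(1) by simp
  qed
  moreover have "x < a + s" using assms(1) by (simp add: x_def)
  moreover have "a \<le> x" by (simp add: x_def)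
  ultimately show ?thesis using that[of x] assms by linarith
qed

context cvrp
begin

definition detour :: "(nat \<Rightarrow> nat) \<Rightarrow> nat \<Rightarrow> real" where
  "detour U l = c (U l) 0 + c 0 (U (Suc l)) - c (U l) (U (Suc l))"

text \<open>A visit of the depot can be charged to either neighbour: a break behind a cut customer
  to that customer, a break in front of a customer served alone to the latter.\<close>

lemma detour_le:
  assumes "U l \<in> vertices n" "U (Suc l) \<in> vertices n"
  shows "0 \<le> detour U l" "detour U l \<le> 2 * c 0 (U l)" "detour U l \<le> 2 * c 0 (U (Suc l))"
  using triangle[of "U l" 0 "U (Suc l)"] triangle[of 0 "U l" "U (Suc l)"]
    triangle[of "U l" "U (Suc l)" 0] cost_sym[of "U l" 0] cost_sym[of "U (Suc l)" 0] assms
  by (auto simp: detour_def)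

text \<open>Scale the demands by \<open>q\<close> and cut the sequence at the unit cells congruent to \<open>\<theta>\<close> modulo
  \<open>s = (q - p) k\<close>. A customer containing a cut is appended to the segment before it if at most
  \<open>p k\<close> of its cells lie behind the cut, and is served alone otherwise.\<close>

lemma tour_partition:
  assumes U: "\<And>i. 1 \<le> i \<Longrightarrow> i \<le> m \<Longrightarrow> U i \<in> customers n \<and> 2 * d (U i) \<le> k"
    and q: "0 < q" "2 * p \<le> q"
  obtains brk where
    "\<And>i j. i < j \<Longrightarrow> j \<le> m \<Longrightarrow> i = 0 \<or> brk i \<Longrightarrow> (\<And>l. i < l \<Longrightarrow> l < j \<Longrightarrow> \<not> brk l) \<Longrightarrow>
       (\<Sum>l\<in>{i<..j}. d (U l)) \<le> k"
    "(\<Sum>l\<in>{1..<m}. if brk l then detour U l else 0) \<le>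
       (\<Sum>l\<in>{1..m}. 2 * c 0 (U l) * (real (q * d (U l)) + real (q * d (U l) - p * k))) / real ((q - p) * k)"
proof -
  \<comment> \<open>A segment may hold one period of s cells and the at most p k cells behind the
    cut in its last customer, together q k cells, which is capacity k before scaling.\<close>
  define s where "s = (q - p) * k"
  have s: "0 < s" "q * k = s + p * k" using q k_pos by (auto simp: s_def algebra_simps diff_mult_distrib)
  define P where "P l = (\<Sum>i\<in>{0<..l}. q * d (U i))" for l
  have P_Suc: "P (Suc l) = P l + q * d (U (Suc l))" for l
  proof -
    have "{0<..Suc l} = insert (Suc l) {0<..l}" by auto
    then show ?thesis by (simp add: P_def)
  qed
  have P_diff: "i \<le> j \<Longrightarrow> P j = P i + q * (\<Sum>l\<in>{i<..j}. d (U l))" for i j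
  proof (induction j)
    case (Suc j)
    show ?case
    proof (cases "i = Suc j")
      case False
      then have "i \<le> j" using Suc.prems by simp
      moreover then have "{i<..Suc j} = insert (Suc j) {i<..j}" by auto
      ultimately show ?thesis using Suc.IH by (simp add: P_Suc algebra_simps)
    qed simp
  qed simp
  define cut where "cut \<theta> l \<longleftrightarrow> (\<exists>x. P (l - 1) \<le> x \<and> x < P l \<and> x mod s = \<theta>)" for \<theta> l
  define solo where "solo \<theta> l \<longleftrightarrow> (\<exists>x. P (l - 1) \<le> x \<and> x + 1 + p * k < P l \<and> x mod s = \<theta>)" for \<theta> l
  \<comment> \<open>A solo customer is also cut, so it gets a break on either side and forms a
    segment of its own.\<close>
  define brk where "brk \<theta> l \<longleftrightarrow> cut \<theta> l \<or> solo \<theta> (Suc l)" for \<theta> l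
  define rad where "rad l = 2 * c 0 (U l)" for l
  have rad: "0 \<le> rad l" if "1 \<le> l" "l \<le> m" for l
    using U[OF that] by (simp add: rad_def cost_nonneg customer_vertex)
  have seg: "(\<Sum>l\<in>{i<..j}. d (U l)) \<le> k"
    if \<theta>: "\<theta> < s" and ij: "i < j" "j \<le> m" and no: "\<And>l. i < l \<Longrightarrow> l < j \<Longrightarrow> \<not> brk \<theta> l" for \<theta> i j
  proof (cases "j = Suc i")
    case True
    then have "{i<..j} = {j}" by auto
    then show ?thesis using U[of j] ij by simp
  next
    case False
    have uncut: "x mod s \<noteq> \<theta>" if "P i \<le> x" "x < P (j - 1)" for x
    proof
      assume x: "x mod s = \<theta>"
      define l where "l = (LEAST l. x < P l)"
      have l: "x < P l" unfolding l_def by (rule LeastI) (rule that(2))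
      have "l \<le> j - 1" unfolding l_def by (rule Least_le) (rule that(2))
      moreover have "i < l"
      proof (rule ccontr)
        assume "\<not> i < l"
        then have "P l \<le> P i" using P_diff[of l i] by simp
        then show False using l that(1) by simp
      qed
      moreover from this have "\<not> x < P (l - 1)" unfolding l_def
        by (intro not_less_Least) (simp flip: l_def)
      ultimately have "brk \<theta> l" using x l not_less unfolding brk_def cut_def by blast
      then show False using no \<open>i < l\<close> \<open>l \<le> j - 1\<close> ij by simp
    qed
    have "\<not> brk \<theta> (j - 1)" using False ij by (intro no) auto
    then have nosolo: "\<not> solo \<theta> j" using ij by (simp add: brk_def)
    have "P j \<le> P i + q * k"
    proof (rule ccontr)
      assume *: "\<not> P j \<le> P i + q * k"
      \<comment> \<open>An overloaded segment spans a whole period and so contains a cut cell. This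
        cell cannot lie before the last customer, and it has more than p k cells behind it, so the
        last customer would be solo and separated by a break.\<close>
      then obtain x where x: "P i \<le> x" "x < P i + s" "x mod s = \<theta>"
        using residue_in_block[of \<theta> s "P i" "P i + s"] \<theta> by auto
      have "P (j - 1) \<le> x" using uncut[of x] x by (cases "x < P (j - 1)") auto
      moreover have "x + 1 + p * k < P j" using x * s by simp
      ultimately have "solo \<theta> j" using x by (auto simp: solo_def)
      then show False using nosolo by simp
    qed
    then have "q * (\<Sum>l\<in>{i<..j}. d (U l)) \<le> q * k" using P_diff[of i j] ij by simp
    then show ?thesis using q by simp
  qed
  define X where "X \<theta> = (\<Sum>l\<in>{1..<m}. if brk \<theta> l then detour U l else 0)" for \<theta>
  have X: "X \<theta> \<le> (\<Sum>l\<in>{1..m}. (of_bool (cut \<theta> l) + of_bool (solo \<theta> l)) * rad l)" for \<theta>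
  proof -
    have "X \<theta> \<le> (\<Sum>l\<in>{1..<m}. of_bool (cut \<theta> l) * rad l + of_bool (solo \<theta> (Suc l)) * rad (Suc l))"
      unfolding X_def
    proof (rule sum_mono)
      fix l assume l: "l \<in> {1..<m}"
      then have "U l \<in> vertices n" "U (Suc l) \<in> vertices n"
        using U[of l] U[of "Suc l"] customer_vertex by auto
      from detour_le[OF this] show "(if brk \<theta> l then detour U l else 0)
        \<le> of_bool (cut \<theta> l) * rad l + of_bool (solo \<theta> (Suc l)) * rad (Suc l)"
        using rad[of l] rad[of "Suc l"] l by (auto simp: brk_def rad_def)
    qed
    also have "\<dots> = (\<Sum>l\<in>{1..<m}. of_bool (cut \<theta> l) * rad l) + (\<Sum>l\<in>{Suc 1..<Suc m}. of_bool (solo \<theta> l) * rad l)"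
      unfolding sum.distrib by (simp only: sum.shift_bounds_Suc_ivl)
    also have "\<dots> \<le> (\<Sum>l\<in>{1..m}. of_bool (cut \<theta> l) * rad l) + (\<Sum>l\<in>{1..m}. of_bool (solo \<theta> l) * rad l)"
      using rad by (intro add_mono sum_mono2) auto
    finally show ?thesis by (simp add: sum.distrib algebra_simps)
  qed
  have cut_card: "(\<Sum>\<theta><s. of_bool (cut \<theta> l)) \<le> real (q * d (U l))" if "1 \<le> l" for l
  proof -
    have "(\<Sum>\<theta><s. of_bool (cut \<theta> l)) = real (card {\<theta>. \<theta> < s \<and> cut \<theta> l})"
      by (simp add: sum.If_cases of_bool_def Int_def lessThan_def)
    also have "card {\<theta>. \<theta> < s \<and> cut \<theta> l} \<le> card ((\<lambda>x. x mod s) ` {P (l - 1)..<P l})"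
      by (intro card_mono) (auto simp: cut_def)
    also have "\<dots> \<le> card {P (l - 1)..<P l}" by (intro card_image_le) simp
    also have "\<dots> = q * d (U l)" using P_Suc[of "l - 1"] that by simp
    finally show ?thesis by simp
  qed
  have solo_card: "(\<Sum>\<theta><s. of_bool (solo \<theta> l)) \<le> real (q * d (U l) - p * k)" if "1 \<le> l" for l
  proof -
    have "(\<Sum>\<theta><s. of_bool (solo \<theta> l)) = real (card {\<theta>. \<theta> < s \<and> solo \<theta> l})"
      by (simp add: sum.If_cases of_bool_def Int_def lessThan_def)
    also have "card {\<theta>. \<theta> < s \<and> solo \<theta> l} \<le> card ((\<lambda>x. x mod s) ` {P (l - 1)..<P l - p * k})"
      by (intro card_mono) (auto simp: solo_def)
    also have "\<dots> \<le> card {P (l - 1)..<P l - p * k}" by (intro card_image_le) simp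
    also have "\<dots> = q * d (U l) - p * k" using P_Suc[of "l - 1"] that by simp
    finally show ?thesis by simp
  qed
  obtain \<theta> where \<theta>: "\<theta> < s" "X \<theta> \<le> (\<Sum>\<theta><s. X \<theta>) / real s"
    using exists_le_average[OF s(1)] by blast
  have "(\<Sum>\<theta><s. X \<theta>) \<le> (\<Sum>\<theta><s. \<Sum>l\<in>{1..m}. (of_bool (cut \<theta> l) + of_bool (solo \<theta> l)) * rad l)"
    by (intro sum_mono X)
  also have "\<dots> = (\<Sum>l\<in>{1..m}. \<Sum>\<theta><s. (of_bool (cut \<theta> l) + of_bool (solo \<theta> l)) * rad l)"
    by (rule sum.swap)
  also have "\<dots> = (\<Sum>l\<in>{1..m}. rad l * ((\<Sum>\<theta><s. of_bool (cut \<theta> l)) + (\<Sum>\<theta><s. of_bool (solo \<theta> l))))"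
    by (simp add: sum_distrib_left sum_distrib_right sum.distrib algebra_simps)
  also have "\<dots> \<le> (\<Sum>l\<in>{1..m}. rad l * (real (q * d (U l)) + real (q * d (U l) - p * k)))"
    using rad cut_card solo_card by (intro sum_mono mult_left_mono add_mono) auto
  finally have "X \<theta> \<le> (\<Sum>l\<in>{1..m}. rad l * (real (q * d (U l)) + real (q * d (U l) - p * k))) / real s"
    using \<theta>(2) s(1) by (smt (verit) divide_right_mono of_nat_0_le_iff)
  then show ?thesis
    using that[of "brk \<theta>"] seg[OF \<theta>(1)] unfolding X_def s_def rad_def by blast
qed

definition segment_cost :: "(nat \<Rightarrow> nat) \<Rightarrow> nat \<Rightarrow> nat \<Rightarrow> real" where
  "segment_cost U i j = c 0 (U (Suc i)) + (\<Sum>l\<in>{Suc i..<j}. c (U l) (U (Suc l))) + c (U j) 0"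

text \<open>A function satisfying the Bellman inequality lies below the cost of every feasible
  segmentation, so neither offset nor breaks ever have to be computed. The induction splits a prefix
  at its last break; the load condition allows any end \<open>j\<close>, since a prefix need not end
  at a break.\<close>

lemma segmentation_bound:
  assumes best: "best 0 \<le> 0"
      "\<And>i j. i < j \<Longrightarrow> j \<le> m \<Longrightarrow> (\<Sum>l\<in>{i<..j}. d (U l)) \<le> k \<Longrightarrow> best j \<le> best i + segment_cost U i j"
    and brk: "\<And>i j. i < j \<Longrightarrow> j \<le> m \<Longrightarrow> i = 0 \<or> brk i \<Longrightarrow> (\<And>l. i < l \<Longrightarrow> l < j \<Longrightarrow> \<not> brk l) \<Longrightarrow>
       (\<Sum>l\<in>{i<..j}. d (U l)) \<le> k"
    and m: "1 \<le> m"
  shows "best m \<le> segment_cost U 0 m + (\<Sum>l\<in>{1..<m}. if brk l then detour U l else 0)"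
proof -
  define h where "h j = segment_cost U 0 j + (\<Sum>l\<in>{1..<j}. if brk l then detour U l else 0)" for j
  have "best j \<le> h j" if "1 \<le> j" "j \<le> m" for j
    using that
  proof (induction j rule: less_induct)
    case (less j)
    define I where "I = {i. i < j \<and> (i = 0 \<or> brk i)}"
    have "0 \<in> I" using less.prems by (simp add: I_def)
    then have I: "finite I" "I \<noteq> {}" by (auto simp: I_def)
    define i where "i = Max I"
    have "i \<in> I" unfolding i_def using I by (rule Max_in)
    then have i: "i < j" "i = 0 \<or> brk i" by (auto simp: I_def)
    have no: "\<not> brk l" if "i < l" "l < j" for l
    proof
      assume "brk l"
      then have "l \<in> I" using that by (simp add: I_def)
      then show False using Max_ge[OF I(1), of l] that by (simp flip: i_def)
    qed
    have step: "best j \<le> best i + segment_cost U i j"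
      using less.prems i no by (intro best(2) brk) auto
    show ?case
    proof (cases "i = 0")
      case True
      then have "(\<Sum>l\<in>{1..<j}. if brk l then detour U l else 0) = 0"
        using no by (intro sum.neutral) auto
      then show ?thesis using step best(1) True by (simp add: h_def)
    next
      case False
      then have "best i \<le> h i" using less.IH[of i] i less.prems by simp
      moreover have "h j = h i + segment_cost U i j"
      proof -
        have split: "{1..<j} = {1..<i} \<union> ({i} \<union> {Suc i..<j})" using i False by auto
        have s1: "(\<Sum>l\<in>{1..<j}. f l) = (\<Sum>l\<in>{1..<i}. f l) + f i + (\<Sum>l\<in>{Suc i..<j}. f l)" for f :: "nat \<Rightarrow> real"
          unfolding split by (subst sum.union_disjoint; simp add: ac_simps)+
        have "(\<Sum>l\<in>{Suc i..<j}. if brk l then detour U l else 0) = 0"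
          using no by (intro sum.neutral) auto
        then show ?thesis
          using i False unfolding h_def segment_cost_def One_nat_def[symmetric] s1
          by (simp add: detour_def)
      qed
      ultimately show ?thesis using step by simp
    qed
  qed
  from this[OF m] show ?thesis by (simp add: h_def)
qed

end

subsection \<open>Greedy covering\<close>

text \<open>\<open>greedy_bound\<close> rescaled from optimum 1 to the scale
  \<open>M\<close>.\<close>

definition greedy_potential :: "real \<Rightarrow> real \<Rightarrow> real" where
  "greedy_potential M W = M * greedy_bound (W / M)"

text \<open>The integrand min 1 (1/w) decreases, so on the interval from x' to x it is at least min
  1 (1/x), hence at least \<open>s\<close>.\<close>

lemma greedy_bound_diff:
  fixes x x' s :: real
  assumes "0 \<le> x'" "x' \<le> x" "0 \<le> s" "s \<le> 1" "s * x \<le> 1"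
  shows "s * (x - x') \<le> greedy_bound x - greedy_bound x'"
proof (cases "x \<le> 1")
  case True
  then show ?thesis
    using assms mult_right_mono[of s 1 "x - x'"] by (simp add: greedy_bound_def)
next
  case False
  then have x: "1 < x" by simp
  have s: "s \<le> 1 / x" using assms(5) x by (simp add: field_simps)
  show ?thesis
  proof (cases "x' \<le> 1")
    case True
    have "s * (x - 1) \<le> (1 / x) * (x - 1)" using s x by (intro mult_right_mono) auto
    also have "\<dots> = 1 - 1 / x" using x by (simp add: field_simps)
    also have "\<dots> \<le> ln x" using ln_le_minus_one[of "1 / x"] x by (simp add: ln_div)
    finally have "s * (x - 1) \<le> ln x" .
    moreover have "s * (1 - x') \<le> 1 - x'"
      using assms True mult_right_mono[of s 1 "1 - x'"] by simp
    ultimately show ?thesis using x True by (simp add: greedy_bound_def algebra_simps)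
  next
    case False
    have "s * (x - x') \<le> (1 / x) * (x - x')" using s assms by (intro mult_right_mono) auto
    also have "\<dots> = 1 - x' / x" using x by (simp add: field_simps)
    also have "\<dots> \<le> - ln (x' / x)" using ln_le_minus_one[of "x' / x"] x False by simp
    also have "\<dots> = ln x - ln x'" using x False by (simp add: ln_div)
    finally show ?thesis using x False by (simp add: greedy_bound_def)
  qed
qed

text \<open>A tour of cost \<open>x\<close> and ratio \<open>r\<close> is paid by the drop of the
  potential. The premise \<open>W <= r * M\<close> says that the ratio is at least the remaining
  penalty in units of \<open>M\<close>.\<close>

lemma greedy_step:
  assumes "0 < M" "0 \<le> W'" "W' \<le> W" "1 \<le> r" "W \<le> r * M" "W - W' = r * x"
  shows "x + greedy_potential M W' \<le> greedy_potential M W"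
proof -
  have "(1 / r) * (W / M - W' / M) \<le> greedy_bound (W / M) - greedy_bound (W' / M)"
    using assms by (intro greedy_bound_diff) (auto simp: field_simps)
  also have "(1 / r) * (W / M - W' / M) = x / M"
  proof -
    have "W / M - W' / M = r * x / M" using assms(6) by (simp flip: diff_divide_distrib)
    then show ?thesis using assms by simp
  qed
  finally have "M * (x / M) \<le> M * (greedy_bound (W / M) - greedy_bound (W' / M))"
    using assms by (intro mult_left_mono) auto
  then show ?thesis using assms by (simp add: greedy_potential_def algebra_simps)
qed

subsection \<open>Local search for matchings\<close>

context cvrp
begin

definition large :: "nat \<Rightarrow> bool" where
  "large v \<longleftrightarrow> v \<in> customers n \<and> k < 3 * d v"

text \<open>A customer served alone is its own partner.\<close>

definition pairing :: "(nat \<Rightarrow> nat) \<Rightarrow> bool" where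
  "pairing \<pi> \<longleftrightarrow> (\<forall>v. large v \<longrightarrow> large (\<pi> v) \<and> \<pi> (\<pi> v) = v \<and> (\<pi> v \<noteq> v \<longrightarrow> d v + d (\<pi> v) \<le> k))"

definition saving :: "nat \<Rightarrow> nat \<Rightarrow> real" where
  "saving u v = (if u = v then 0 else c 0 u + c 0 v - c u v)"

text \<open>Every pair is counted from both ends, hence the division by 2 in
  \<open>pairing_cost\<close>.\<close>

definition total_saving :: "(nat \<Rightarrow> nat) \<Rightarrow> real" where
  "total_saving \<pi> = (\<Sum>v | large v. saving v (\<pi> v))"

text \<open>The former partners of u and v become single. Pairs that may not share a tour change
  nothing, so every list of pairs is a legal move and (0, 0) pads shorter moves to a fixed
  length.\<close>

definition link :: "(nat \<Rightarrow> nat) \<Rightarrow> nat \<times> nat \<Rightarrow> nat \<Rightarrow> nat" where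
  "link \<pi> = (\<lambda>(u, v).
     if large u \<and> large v \<and> u \<noteq> v \<and> d u + d v \<le> k
     then (let \<pi>' = \<pi>(\<pi> u := \<pi> u) in \<pi>'(\<pi>' v := \<pi>' v, u := v, v := u)) else \<pi>)"

lemma finite_large [simp]: "finite {v. large v}"
  by (rule finite_subset[OF _ finite_customers]) (auto simp: large_def)

lemma card_large: "card {v. large v} \<le> n"
proof -
  have "card {v. large v} \<le> card (customers n)" by (intro card_mono) (auto simp: large_def)
  then show ?thesis by (simp add: customers_def)
qed

lemma not_large_depot [simp]: "\<not> large 0"
  by (simp add: large_def)

lemma large_vertex: "large v \<Longrightarrow> v \<in> vertices n"
  by (simp add: large_def customer_vertex)

lemma link_depot [simp]: "link \<pi> (0, v) = \<pi>"
  by (simp add: link_def)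

lemma link_apply:
  assumes "pairing \<pi>" "large u" "large v" "u \<noteq> v" "d u + d v \<le> k"
  shows "link \<pi> (u, v) x =
    (if x = u then v else if x = v then u else if x = \<pi> u \<or> x = \<pi> v then x else \<pi> x)"
  using assms by (auto simp: link_def Let_def pairing_def)

lemma pairing_id: "pairing (\<lambda>v. v)"
  by (simp add: pairing_def)

lemma pairing_link:
  assumes "pairing \<pi>"
  shows "pairing (link \<pi> (u, v))"
proof (cases "large u \<and> large v \<and> u \<noteq> v \<and> d u + d v \<le> k")
  case True
  then have eq: "link \<pi> (u, v) x =
    (if x = u then v else if x = v then u else if x = \<pi> u \<or> x = \<pi> v then x else \<pi> x)" for x
    using link_apply[OF assms] by blast
  show ?thesis
    unfolding pairing_def
  proof (intro allI impI)
    fix x assume x: "large x"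
    have \<pi>: "large (\<pi> y)" "\<pi> (\<pi> y) = y" "\<pi> y \<noteq> y \<Longrightarrow> d y + d (\<pi> y) \<le> k" if "large y" for y
      using assms that by (auto simp: pairing_def)
    consider "x = u" | "x = v" | "x \<noteq> u" "x \<noteq> v" "x = \<pi> u \<or> x = \<pi> v"
      | "x \<noteq> u" "x \<noteq> v" "x \<noteq> \<pi> u" "x \<noteq> \<pi> v" by blast
    then show "large (link \<pi> (u, v) x) \<and> link \<pi> (u, v) (link \<pi> (u, v) x) = x \<and>
      (link \<pi> (u, v) x \<noteq> x \<longrightarrow> d x + d (link \<pi> (u, v) x) \<le> k)"
    proof cases
      case 4
      then have "link \<pi> (u, v) x = \<pi> x" by (simp add: eq)
      moreover have "\<pi> x \<noteq> u" "\<pi> x \<noteq> v" using \<pi>(2)[OF x] 4 by auto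
      moreover have "\<pi> x = \<pi> u \<Longrightarrow> x = u" "\<pi> x = \<pi> v \<Longrightarrow> x = v"
        using \<pi>(2)[OF x] \<pi>(2) True by metis+
      ultimately show ?thesis using \<pi>[OF x] 4 by (auto simp: eq)
    qed (use True x in \<open>auto simp: eq add.commute\<close>)
  qed
qed (use assms in \<open>auto simp: link_def\<close>)

lemma pairing_foldl_link: "pairing \<pi> \<Longrightarrow> pairing (foldl link \<pi> ps)"
  by (induction ps arbitrary: \<pi>) (auto intro: pairing_link)

text \<open>Each link realizes one pair of \<sigma> inside \<open>Z\<close>. In the induction the
  pair {u, \<sigma> u} is linked last: the smaller move has left u and v with their partners under
  \<pi>, or single if these partners lie in the smaller set.\<close>

lemma exists_links:
  assumes \<pi>: "pairing \<pi>" and \<sigma>: "pairing \<sigma>"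
    and Z: "Z \<subseteq> {v. large v}" "\<And>x. x \<in> Z \<Longrightarrow> \<sigma> x \<in> Z \<and> \<sigma> x \<noteq> x"
    and p: "card Z \<le> 2 * p"
  shows "\<exists>ps. length ps = p \<and> (\<forall>(u, v)\<in>set ps. u \<le> n \<and> v \<le> n) \<and>
    (\<forall>x. large x \<longrightarrow> foldl link \<pi> ps x = (if x \<in> Z then \<sigma> x else if \<pi> x \<in> Z then x else \<pi> x))"
  using Z p
proof (induction p arbitrary: Z)
  case 0
  have "finite Z" by (rule finite_subset[OF 0(1)]) simp
  then show ?case using 0 by (intro exI[of _ "[]"]) auto
next
  case (Suc p)
  have finZ: "finite Z" by (rule finite_subset[OF Suc.prems(1)]) simp
  show ?case
  proof (cases "Z = {}")
    case True
    then obtain ps where "length ps = p" "\<forall>(u, v)\<in>set ps. u \<le> n \<and> v \<le> n"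
      "\<forall>x. large x \<longrightarrow> foldl link \<pi> ps x = \<pi> x"
      using Suc.IH[of "{}"] by auto
    then show ?thesis using True by (intro exI[of _ "(0, 0) # ps"]) auto
  next
    case False
    then obtain u where u: "u \<in> Z" by blast
    define v where "v = \<sigma> u"
    have v: "v \<in> Z" "v \<noteq> u" using Suc.prems(2)[OF u] by (simp_all add: v_def)
    have inv: "\<sigma> (\<sigma> x) = x" if "large x" for x using \<sigma> that by (auto simp: pairing_def)
    have inv\<pi>: "\<pi> (\<pi> x) = x" if "large x" for x using \<pi> that by (auto simp: pairing_def)
    have uv: "large u" "large v" "d u + d v \<le> k" "\<sigma> v = u"
      using Suc.prems(1) u v \<sigma> by (auto simp: pairing_def v_def)
    define Z' where "Z' = Z - {u, v}"
    have "card Z' = card Z - 2" unfolding Z'_def using u v finZ by (subst card_Diff_subset) auto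
    then have "card Z' \<le> 2 * p" using Suc.prems(3) by simp
    moreover have "\<sigma> x \<in> Z' \<and> \<sigma> x \<noteq> x" if "x \<in> Z'" for x
    proof -
      have "\<sigma> x \<noteq> u" using inv[of x] that Suc.prems(1) by (auto simp: Z'_def v_def)
      moreover have "\<sigma> x \<noteq> v" using inv[of x] uv that Suc.prems(1) by (auto simp: Z'_def)
      ultimately show ?thesis using Suc.prems(2)[of x] that by (auto simp: Z'_def)
    qed
    ultimately obtain ps where ps: "length ps = p" "\<forall>(u, v)\<in>set ps. u \<le> n \<and> v \<le> n"
      "\<And>x. large x \<Longrightarrow> foldl link \<pi> ps x = (if x \<in> Z' then \<sigma> x else if \<pi> x \<in> Z' then x else \<pi> x)"
      using Suc.IH[of Z'] Suc.prems(1) by (auto simp: Z'_def)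
    define \<rho> where "\<rho> = foldl link \<pi> ps"
    have \<rho>: "pairing \<rho>" unfolding \<rho>_def by (rule pairing_foldl_link[OF \<pi>])
    have notin: "u \<notin> Z'" "v \<notin> Z'" by (auto simp: Z'_def)
    have \<rho>eq: "\<rho> x = (if x \<in> Z' then \<sigma> x else if \<pi> x \<in> Z' then x else \<pi> x)" if "large x" for x
      using ps(3)[OF that] by (simp add: \<rho>_def)
    have "link \<rho> (u, v) x = (if x \<in> Z then \<sigma> x else if \<pi> x \<in> Z then x else \<pi> x)" if x: "large x" for x
    proof -
      have eq: "link \<rho> (u, v) x =
        (if x = u then v else if x = v then u else if x = \<rho> u \<or> x = \<rho> v then x else \<rho> x)"
        using uv v by (intro link_apply[OF \<rho>]) auto
      consider "x = u" | "x = v" | "x \<in> Z'" | "x \<notin> Z" by (auto simp: Z'_def)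
      then show ?thesis
      proof cases
        case 3
        then have "x \<noteq> \<rho> u" "x \<noteq> \<rho> v" using notin uv by (auto simp: \<rho>eq)
        then show ?thesis using 3 x eq by (auto simp: Z'_def \<rho>eq)
      next
        case 4
        then have "x \<notin> Z'" "x \<noteq> u" "x \<noteq> v" using u v by (auto simp: Z'_def)
        moreover have "x = \<rho> u \<longleftrightarrow> \<pi> x = u"
          using 4 uv x inv\<pi>[of x] inv\<pi>[of u] notin \<open>x \<noteq> u\<close> \<open>x \<notin> Z'\<close> by (auto simp: \<rho>eq)
        moreover have "x = \<rho> v \<longleftrightarrow> \<pi> x = v"
          using 4 uv x inv\<pi>[of x] inv\<pi>[of v] notin \<open>x \<noteq> v\<close> \<open>x \<notin> Z'\<close> by (auto simp: \<rho>eq)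
        moreover have "\<pi> x \<in> Z \<longleftrightarrow> \<pi> x = u \<or> \<pi> x = v \<or> \<pi> x \<in> Z'" using u v by (auto simp: Z'_def)
        ultimately show ?thesis using 4 x eq by (auto simp: \<rho>eq)
      qed (use eq u v uv v_def in auto)
    qed
    then show ?thesis
      using ps(1,2) uv by (intro exI[of _ "ps @ [(u, v)]"])
        (auto simp flip: \<rho>_def simp: large_def customers_def)
  qed
qed

lemma saving_nonneg:
  assumes "large u" "large v"
  shows "0 \<le> saving u v"
  using triangle[of u 0 v] cost_sym[of u 0] assms by (simp add: saving_def large_vertex)

text \<open>Imposing \<sigma> on \<open>Z\<close> gains its savings there and loses exactly the
  \<pi>-pairs that touch \<open>Z\<close>; the balance is at most the best gain \<open>G\<close> of
  a move.\<close>

lemma total_saving_link: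
  assumes \<pi>: "pairing \<pi>" and \<sigma>: "pairing \<sigma>"
    and Z: "Z \<subseteq> {v. large v}" "\<And>x. x \<in> Z \<Longrightarrow> \<sigma> x \<in> Z \<and> \<sigma> x \<noteq> x"
    and p: "card Z \<le> 2 * p"
    and G: "\<And>ps. length ps = p \<Longrightarrow> \<forall>(u, v)\<in>set ps. u \<le> n \<and> v \<le> n \<Longrightarrow>
       total_saving (foldl link \<pi> ps) \<le> total_saving \<pi> + G"
  shows "(\<Sum>x\<in>Z. saving x (\<sigma> x)) \<le> (\<Sum>x | large x \<and> (x \<in> Z \<or> \<pi> x \<in> Z). saving x (\<pi> x)) + G"
proof -
  obtain ps where ps: "length ps = p" "\<forall>(u, v)\<in>set ps. u \<le> n \<and> v \<le> n"
    "\<And>x. large x \<Longrightarrow> foldl link \<pi> ps x = (if x \<in> Z then \<sigma> x else if \<pi> x \<in> Z then x else \<pi> x)"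
    using exists_links[OF assms(1-5)] by blast
  define f where "f x = (if x \<in> Z then saving x (\<sigma> x) else 0)" for x
  define g where "g x = (if x \<in> Z \<or> \<pi> x \<in> Z then saving x (\<pi> x) else 0)" for x
  have "total_saving (foldl link \<pi> ps) = (\<Sum>x | large x. f x + saving x (\<pi> x) - g x)"
    unfolding total_saving_def
    by (rule sum.cong) (auto simp: ps(3) f_def g_def saving_def[of x x for x])
  also have "\<dots> = (\<Sum>x | large x. f x) + total_saving \<pi> - (\<Sum>x | large x. g x)"
    by (simp add: sum.distrib sum_subtractf total_saving_def)
  also have "(\<Sum>x | large x. f x) = (\<Sum>x\<in>Z. saving x (\<sigma> x))"
    unfolding f_def using Z(1) by (simp add: sum.If_cases Int_absorb1)
  also have "(\<Sum>x | large x. g x) = (\<Sum>x | large x \<and> (x \<in> Z \<or> \<pi> x \<in> Z). saving x (\<pi> x))"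
    unfolding g_def by (simp add: sum.If_cases Collect_conj_eq)
  finally show ?thesis using G[OF ps(1,2)] by simp
qed

text \<open>With \<open>\<tau> = \<pi> \<circ> \<sigma>\<close>, the alternating walk from \<open>v\<close> visits the edges \<open>{\<tau>\<^sup>i v, \<sigma> (\<tau>\<^sup>i v)}\<close>. It may
  return to an edge, so it is not itself a move; its multiplicity function is a sum of indicator
  functions of level sets, and each level set is a move.\<close>

lemma local_search_bound:
  fixes G :: real
  assumes \<pi>: "pairing \<pi>" and \<sigma>: "pairing \<sigma>"
    and G: "\<And>ps. length ps = p \<Longrightarrow> \<forall>(u, v)\<in>set ps. u \<le> n \<and> v \<le> n \<Longrightarrow>
       total_saving (foldl link \<pi> ps) \<le> total_saving \<pi> + G"
  shows "p * total_saving \<sigma> \<le> (p + 1) * total_saving \<pi> + card {v. large v} * p * G"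
proof -
  define L where "L = {v. large v}"
  have finL: "finite L" by (simp add: L_def)
  define \<tau> where "\<tau> = \<pi> \<circ> \<sigma>"
  have \<sigma>L: "\<sigma> x \<in> L" "\<sigma> (\<sigma> x) = x" and \<pi>L: "\<pi> x \<in> L" "\<pi> (\<pi> x) = x" if "x \<in> L" for x
    using \<pi> \<sigma> that by (auto simp: pairing_def L_def)
  have \<tau>: "bij_betw (\<tau> ^^ i) L L" for i
  proof (induction i)
    case (Suc i)
    have "bij_betw \<sigma> L L" "bij_betw \<pi> L L"
      using \<sigma>L \<pi>L by (auto intro!: bij_betw_byWitness[of L \<sigma> \<sigma> L] bij_betw_byWitness[of L \<pi> \<pi> L])
    then have "bij_betw \<tau> L L" unfolding \<tau>_def by (rule bij_betw_trans)
    then show ?case using bij_betw_trans[OF Suc, of \<tau> L] by (simp add: comp_def)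
  qed (simp add: bij_betw_def)
  define cnt where "cnt r v y = card {i. i < r \<and> (\<tau> ^^ i) v = y}" for r v y
  have cnt_sum: "(\<Sum>v\<in>L. cnt r v y) = r" if y: "y \<in> L" for r y
  proof -
    have "(\<Sum>v\<in>L. cnt r v y) = (\<Sum>v\<in>L. \<Sum>i<r. of_bool ((\<tau> ^^ i) v = y))"
      by (simp add: cnt_def sum.If_cases of_bool_def Int_def lessThan_def)
    also have "\<dots> = (\<Sum>i<r. \<Sum>v\<in>L. of_bool ((\<tau> ^^ i) v = y))" by (rule sum.swap)
    also have "\<dots> = (\<Sum>i<r. 1)"
    proof (rule sum.cong)
      fix i
      have "y \<in> (\<tau> ^^ i) ` L" using \<tau>[of i] y by (simp add: bij_betw_def)
      then obtain v where v: "v \<in> L" "(\<tau> ^^ i) v = y" by (elim imageE) simp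
      have "(\<Sum>v\<in>L. of_bool ((\<tau> ^^ i) v = y)) = (\<Sum>x\<in>L. if x = v then 1 else 0 :: nat)"
        using v \<tau>[of i] by (intro sum.cong) (auto simp: bij_betw_def inj_on_def)
      then show "(\<Sum>v\<in>L. of_bool ((\<tau> ^^ i) v = y)) = (1::nat)" using v finL by simp
    qed simp
    finally show ?thesis by simp
  qed
  \<comment> \<open>One further step of the walk leads from \<sigma> x across its edge to x and
    along the \<pi>-edge to \<pi> x.\<close>
  have cnt_shift: "cnt p v (\<sigma> x) \<le> cnt (Suc p) v (\<pi> x)" if "x \<in> L" for v x
  proof -
    have "Suc ` {i. i < p \<and> (\<tau> ^^ i) v = \<sigma> x} \<subseteq> {i. i < Suc p \<and> (\<tau> ^^ i) v = \<pi> x}"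
      using \<sigma>L[OF that] by (auto simp: \<tau>_def)
    from card_mono[OF _ this] show ?thesis by (simp add: cnt_def card_image)
  qed
  have cnt_mono: "cnt p v x \<le> cnt (Suc p) v x" for v x
    unfolding cnt_def by (intro card_mono) auto
  have cnt_le: "cnt p v x \<le> p" for v x
    using card_mono[of "{..<p}" "{i. i < p \<and> (\<tau> ^^ i) v = x}"] by (auto simp: cnt_def)
  \<comment> \<open>\<open>m v x\<close> is the multiplicity of the \<sigma>-edge at x among the
    first p steps, \<open>M v x\<close> counts visits to the ends of the \<pi>-edge at x among p + 1
    steps. A level destroys this \<pi>-edge only if one of its ends has multiplicity at least that
    level, and both multiplicities are at most \<open>M v x\<close>.\<close>
  define m where "m v x = cnt p v x + cnt p v (\<sigma> x)" for v x
  define M where "M v x = cnt (Suc p) v x + cnt (Suc p) v (\<pi> x)" for v x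
  have mM: "m v x \<le> M v x" "m v (\<pi> x) \<le> M v x" if "x \<in> L" for v x
    using cnt_shift[OF that, of v] cnt_shift[OF \<pi>L(1)[OF that], of v] \<pi>L(2)[OF that]
      cnt_mono[of v x] cnt_mono[of v "\<pi> x"] by (simp_all add: m_def M_def)
  have m_le: "m v x \<le> 2 * p" for v x using cnt_le[of v x] cnt_le[of v "\<sigma> x"] by (simp add: m_def)
  have walk: "(\<Sum>x\<in>L. m v x * saving x (\<sigma> x)) \<le> (\<Sum>x\<in>L. M v x * saving x (\<pi> x)) + 2 * p * G"
    if v: "v \<in> L" for v
  proof -
    define Z where "Z j = {x \<in> L. \<sigma> x \<noteq> x \<and> j \<le> m v x}" for j
    have layer: "(\<Sum>x\<in>Z j. saving x (\<sigma> x)) \<le> (\<Sum>x\<in>{x \<in> L. x \<in> Z j \<or> \<pi> x \<in> Z j}. saving x (\<pi> x)) + G"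
      if j: "j \<in> {1..2 * p}" for j
    proof -
      have Z1: "Z j \<subseteq> {v. large v}" by (auto simp: Z_def L_def)
      have Z2: "\<sigma> x \<in> Z j \<and> \<sigma> x \<noteq> x" if "x \<in> Z j" for x
      proof -
        have x: "x \<in> L" "\<sigma> x \<noteq> x" "j \<le> m v x" using that by (auto simp: Z_def)
        then have "m v (\<sigma> x) = m v x" using \<sigma>L(2)[of x] by (simp add: m_def)
        then show ?thesis using x \<sigma>L[of x] by (auto simp: Z_def)
      qed
      have Z3: "card (Z j) \<le> 2 * p"
      proof -
        define A where "A = (\<lambda>i. (\<tau> ^^ i) v) ` {..<p}"
        have A: "finite A" "card A \<le> p" using card_image_le[of "{..<p}" "\<lambda>i. (\<tau> ^^ i) v"] by (auto simp: A_def)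
        have cntA: "y \<in> A" if "0 < cnt p v y" for y
          using that by (auto simp: cnt_def card_gt_0_iff A_def)
        have "Z j \<subseteq> A \<union> \<sigma> ` A"
        proof
          fix x assume x: "x \<in> Z j"
          then have "0 < cnt p v x \<or> 0 < cnt p v (\<sigma> x)" using j by (auto simp: Z_def m_def)
          moreover have "x = \<sigma> (\<sigma> x)" using \<sigma>L(2)[of x] x by (simp add: Z_def)
          ultimately show "x \<in> A \<union> \<sigma> ` A" using cntA by blast
        qed
        then have "card (Z j) \<le> card (A \<union> \<sigma> ` A)" using A by (intro card_mono) auto
        also have "\<dots> \<le> card A + card (\<sigma> ` A)" by (rule card_Un_le)
        also have "\<dots> \<le> 2 * p" using A card_image_le[of A \<sigma>] by simp
        finally show ?thesis .
      qed
      have "{x \<in> L. x \<in> Z j \<or> \<pi> x \<in> Z j} = {x. large x \<and> (x \<in> Z j \<or> \<pi> x \<in> Z j)}"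
        by (simp add: L_def)
      then show ?thesis using total_saving_link[OF \<pi> \<sigma> Z1 Z2 Z3 G] by simp
    qed
    \<comment> \<open>A multiplicity up to 2 p is the number of levels 1, ..., 2 p that it reaches;
      this resolves weighted sums into sums over level sets.\<close>
    have count: "(\<Sum>j=1..2 * p. of_bool (j \<le> a)) = real a" if "a \<le> 2 * p" for a
    proof -
      have "{1..2 * p} \<inter> {j. j \<le> a} = {1..a}" using that by auto
      then show ?thesis by (simp add: of_bool_def sum.If_cases)
    qed
    have "(\<Sum>x\<in>L. m v x * saving x (\<sigma> x)) = (\<Sum>x\<in>L. \<Sum>j=1..2*p. of_bool (j \<le> m v x) * saving x (\<sigma> x))"
      unfolding sum_distrib_right[symmetric] count[OF m_le] ..
    also have "\<dots> = (\<Sum>j=1..2*p. \<Sum>x\<in>L. of_bool (j \<le> m v x) * saving x (\<sigma> x))" by (rule sum.swap)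
    also have "\<dots> = (\<Sum>j=1..2*p. \<Sum>x\<in>Z j. saving x (\<sigma> x))"
    proof (rule sum.cong)
      fix j
      have "(\<Sum>x\<in>Z j. saving x (\<sigma> x)) = (\<Sum>x\<in>Z j. of_bool (j \<le> m v x) * saving x (\<sigma> x))"
        by (rule sum.cong) (auto simp: Z_def)
      also have "\<dots> = (\<Sum>x\<in>L. of_bool (j \<le> m v x) * saving x (\<sigma> x))"
        using finL by (intro sum.mono_neutral_left) (auto simp: Z_def saving_def)
      finally show "(\<Sum>x\<in>L. of_bool (j \<le> m v x) * saving x (\<sigma> x)) = (\<Sum>x\<in>Z j. saving x (\<sigma> x))" by simp
    qed simp
    also have "\<dots> \<le> (\<Sum>j=1..2*p. (\<Sum>x\<in>{x \<in> L. x \<in> Z j \<or> \<pi> x \<in> Z j}. saving x (\<pi> x)) + G)"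
      by (intro sum_mono layer)
    also have "\<dots> = (\<Sum>j=1..2*p. \<Sum>x\<in>L. of_bool (x \<in> Z j \<or> \<pi> x \<in> Z j) * saving x (\<pi> x)) + 2 * p * G"
    proof -
      have "(\<Sum>x\<in>{x \<in> L. Q x}. f x) = (\<Sum>x\<in>L. of_bool (Q x) * f x)" for Q and f :: "nat \<Rightarrow> real"
        unfolding sum.inter_filter[OF finL, of f Q] by (auto intro!: sum.cong)
      then show ?thesis unfolding sum.distrib by simp
    qed
    also have "(\<Sum>j=1..2*p. \<Sum>x\<in>L. of_bool (x \<in> Z j \<or> \<pi> x \<in> Z j) * saving x (\<pi> x)) =
        (\<Sum>x\<in>L. \<Sum>j=1..2*p. of_bool (x \<in> Z j \<or> \<pi> x \<in> Z j) * saving x (\<pi> x))" by (rule sum.swap)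
    also have "\<dots> \<le> (\<Sum>x\<in>L. M v x * saving x (\<pi> x))"
    proof (rule sum_mono)
      fix x assume x: "x \<in> L"
      have "(\<Sum>j=1..2*p. of_bool (x \<in> Z j \<or> \<pi> x \<in> Z j)) \<le> (\<Sum>j=1..2*p. of_bool (j \<le> max (m v x) (m v (\<pi> x))) :: real)"
        by (intro sum_mono) (auto simp: Z_def of_bool_def)
      also have "\<dots> = max (m v x) (m v (\<pi> x))" using m_le by (intro count) simp
      also have "\<dots> \<le> M v x" using mM[OF x] by simp
      finally show "(\<Sum>j=1..2*p. of_bool (x \<in> Z j \<or> \<pi> x \<in> Z j) * saving x (\<pi> x)) \<le> M v x * saving x (\<pi> x)"
        unfolding sum_distrib_right[symmetric]
        using saving_nonneg[of x "\<pi> x"] x \<pi>L(1)[OF x] by (intro mult_right_mono) (auto simp: L_def)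
    qed
    finally show ?thesis by simp
  qed
  \<comment> \<open>Sum over all starts v. Every power of \<tau> permutes the large customers, so
    each \<sigma>-edge collects multiplicity 2 p and each \<pi>-edge 2 (p + 1), independently of the
    edge.\<close>
  have "(\<Sum>v\<in>L. \<Sum>x\<in>L. m v x * saving x (\<sigma> x)) = (\<Sum>x\<in>L. (\<Sum>v\<in>L. m v x) * saving x (\<sigma> x))"
    by (subst sum.swap) (simp add: sum_distrib_right[symmetric])
  also have "\<dots> = (\<Sum>x\<in>L. (2 * p) * saving x (\<sigma> x))"
  proof (rule sum.cong)
    fix x assume "x \<in> L"
    then have "(\<Sum>v\<in>L. m v x) = 2 * p" using \<sigma>L by (simp add: m_def sum.distrib cnt_sum)
    then show "real (\<Sum>v\<in>L. m v x) * saving x (\<sigma> x) = real (2 * p) * saving x (\<sigma> x)" by simp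
  qed simp
  finally have lhs: "(\<Sum>v\<in>L. \<Sum>x\<in>L. m v x * saving x (\<sigma> x)) = 2 * p * total_saving \<sigma>"
    by (simp add: total_saving_def L_def sum_distrib_left)
  have "(\<Sum>v\<in>L. \<Sum>x\<in>L. M v x * saving x (\<pi> x)) = (\<Sum>x\<in>L. (\<Sum>v\<in>L. M v x) * saving x (\<pi> x))"
    by (subst sum.swap) (simp add: sum_distrib_right[symmetric])
  also have "\<dots> = (\<Sum>x\<in>L. (2 * Suc p) * saving x (\<pi> x))"
  proof (rule sum.cong)
    fix x assume "x \<in> L"
    then have "(\<Sum>v\<in>L. M v x) = 2 * Suc p" using \<pi>L by (simp add: M_def sum.distrib cnt_sum)
    then show "real (\<Sum>v\<in>L. M v x) * saving x (\<pi> x) = real (2 * Suc p) * saving x (\<pi> x)" by simp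
  qed simp
  finally have rhs: "(\<Sum>v\<in>L. \<Sum>x\<in>L. M v x * saving x (\<pi> x)) = 2 * (p + 1) * total_saving \<pi>"
    by (simp add: total_saving_def L_def sum_distrib_left)
  have "(\<Sum>v\<in>L. \<Sum>x\<in>L. m v x * saving x (\<sigma> x)) \<le>
      (\<Sum>v\<in>L. (\<Sum>x\<in>L. M v x * saving x (\<pi> x)) + 2 * p * G)"
    by (intro sum_mono walk)
  then have "2 * (p * total_saving \<sigma>) \<le> 2 * ((p + 1) * total_saving \<pi> + card L * p * G)"
    unfolding lhs sum.distrib rhs by (simp add: algebra_simps)
  then have "p * total_saving \<sigma> \<le> (p + 1) * total_saving \<pi> + card L * p * G"
    by (subst (asm) mult_le_cancel_left_pos) simp_all
  then show ?thesis by (simp add: L_def add.commute)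
qed

text \<open>A round that reaches the best move gains \<open>G = T - total_saving \<pi>\<close>. By
  \<open>local_search_bound\<close> the gap before it is at most n p G, while the round lowers the
  gap by (p + 1) G, hence by at least one n-th. Truncation at 0 keeps the contraction valid once the
  gap is closed.\<close>

lemma local_search_gap:
  assumes \<pi>: "pairing \<pi>" and \<sigma>: "pairing \<sigma>" and p: "0 < p" and "total_saving \<pi> \<le> T"
    and T: "\<And>ps. length ps = p \<Longrightarrow> \<forall>(u, v)\<in>set ps. u \<le> n \<and> v \<le> n \<Longrightarrow>
       total_saving (foldl link \<pi> ps) \<le> T"
  shows "max 0 (p * total_saving \<sigma> - (p + 1) * T) \<le>
    (1 - 1 / n) * max 0 (p * total_saving \<sigma> - (p + 1) * total_saving \<pi>)"
proof -
  define G where "G = T - total_saving \<pi>"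
  define g where "g = p * total_saving \<sigma> - (p + 1) * total_saving \<pi>"
  have G: "0 \<le> G" using assms(4) by (simp add: G_def)
  have "g \<le> card {v. large v} * p * G"
  proof -
    have prem: "total_saving (foldl link \<pi> ps) \<le> total_saving \<pi> + G"
      if "length ps = p" "\<forall>(u, v)\<in>set ps. u \<le> n \<and> v \<le> n" for ps
      using T[OF that] by (simp add: G_def)
    note b = local_search_bound[OF \<pi> \<sigma> prem]
    show ?thesis using b unfolding g_def by (simp add: add.commute diff_le_eq)
  qed
  also have "\<dots> \<le> n * p * G"
    using mult_right_mono[of "real (card {v. large v})" n "p * G"] card_large G by (simp add: mult.assoc)
  also have "\<dots> \<le> n * ((p + 1) * G)" using G by (simp add: algebra_simps)
  finally have "g / n \<le> (p + 1) * G" using n_pos by (simp add: field_simps)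
  moreover have "p * total_saving \<sigma> - (p + 1) * T = g - (p + 1) * G"
    by (simp add: g_def G_def algebra_simps)
  moreover have "(1 - 1 / n) * max 0 g = max 0 (g - g / n)"
  proof -
    have n: "0 \<le> 1 - 1 / real n" using n_pos by simp
    have "g - g / n = (1 - 1 / n) * g" by (simp add: algebra_simps)
    then show ?thesis
      using mult_nonneg_nonneg[OF n, of g] mult_nonneg_nonpos[OF n, of g]
      by (cases "0 \<le> g") (simp_all add: max_def)
  qed
  moreover have "max 0 (g - (p + 1) * G) \<le> max 0 (g - g / n)" if "g / n \<le> (p + 1) * G"
    using that by (auto simp: max_def)
  ultimately have "max 0 (p * total_saving \<sigma> - (p + 1) * T) \<le> (1 - 1 / n) * max 0 g" by metis
  then show ?thesis by (simp add: g_def add.commute)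
qed

text \<open>After n p rounds the contraction factor is at most exp (-p) <= 1 / (p + 1), so the
  remaining gap is at most \<open>total_saving \<sigma>\<close>. It costs a second fraction 1 / (p +
  1) besides the one lost by a p-local optimum.\<close>

lemma local_search_final:
  assumes \<sigma>: "pairing \<sigma>" and N: "n * p \<le> N" and p: "0 < p"
    and gap: "max 0 (p * total_saving \<sigma> - (p + 1) * T) \<le> (1 - 1 / n) ^ N * (p * total_saving \<sigma>)"
  shows "total_saving \<sigma> - 2 / (p + 1) * total_saving \<sigma> \<le> T"
proof -
  have n: "0 \<le> 1 - 1 / real n" using n_pos by simp
  have T0: "0 \<le> total_saving \<sigma>"
    using \<sigma> unfolding total_saving_def by (intro sum_nonneg saving_nonneg) (auto simp: pairing_def)
  have "(1 - 1 / n) ^ N \<le> (1 - 1 / n) ^ (n * p)" using n N by (intro power_decreasing) auto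
  also have "\<dots> \<le> exp (- 1 / n) ^ (n * p)"
    using n exp_ge_add_one_self[of "- 1 / real n"] by (intro power_mono) auto
  also have "\<dots> = exp (- p)" using n_pos by (simp flip: exp_of_nat_mult)
  also have "\<dots> \<le> 1 / (p + 1)"
    using exp_ge_add_one_self[of "real p"] by (simp add: exp_minus field_simps)
  finally have "(1 - 1 / n) ^ N * (p * total_saving \<sigma>) \<le> 1 / (p + 1) * (p * total_saving \<sigma>)"
    using T0 by (intro mult_right_mono) auto
  also have "\<dots> \<le> total_saving \<sigma>" using T0 by (simp add: field_simps)
  finally have "(1 - 1 / n) ^ N * (p * total_saving \<sigma>) \<le> total_saving \<sigma>" .
  moreover have "p * total_saving \<sigma> - (real p + 1) * T \<le> (1 - 1 / n) ^ N * (p * total_saving \<sigma>)"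
    using gap by (simp add: add.commute)
  ultimately have "p * total_saving \<sigma> - (real p + 1) * T \<le> total_saving \<sigma>" by (rule order_trans[rotated])
  moreover have "(real p + 1) * (2 / (p + 1) * total_saving \<sigma>) = 2 * total_saving \<sigma>"
    by (simp add: add.commute)
  ultimately have "(real p + 1) * (total_saving \<sigma> - 2 / (p + 1) * total_saving \<sigma>) \<le> (real p + 1) * T"
    unfolding right_diff_distrib by (simp add: distrib_right)
  then show ?thesis by (subst (asm) mult_le_cancel_left_pos) (simp_all add: add.commute)
qed

section \<open>Pairings against feasible solutions\<close>

definition pairing_cost :: "(nat \<Rightarrow> nat) \<Rightarrow> real" where
  "pairing_cost \<pi> = (\<Sum>v | large v. 2 * c 0 v) - total_saving \<pi> / 2"

text \<open>Three large customers exceed the capacity, so a tour serves at most two of them. Pair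
  those assigned to the same tour and shortcut the tour to them.\<close>

lemma pairing_exists:
  assumes feas: "feasible n k d S a"
  obtains \<sigma> where "pairing \<sigma>" "pairing_cost \<sigma> \<le> solution_cost c S"
proof -
  define P where "P v u \<longleftrightarrow> large u \<and> u \<noteq> v \<and> a u = a v" for v u
  define \<sigma> where "\<sigma> v = (if \<exists>u. P v u then SOME u. P v u else v)" for v
  have cap: "sum d W \<le> k" if "W \<subseteq> customers n" "v \<in> customers n" "\<And>w. w \<in> W \<Longrightarrow> a w = a v" for W v
  proof -
    have "sum d W \<le> (\<Sum>w | w \<in> customers n \<and> a w = a v. d w)"
      using that by (intro sum_mono2) auto
    also have "\<dots> \<le> k" using feas that by (auto simp: feasible_def)
    finally show ?thesis .
  qed
  have unique: "u = w" if "large v" "P v u" "P v w" for u v w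
  proof (rule ccontr)
    assume "u \<noteq> w"
    then have "sum d {u, v, w} = d u + d v + d w" using that by (auto simp: P_def)
    then show False using cap[of "{u, v, w}" v] that by (auto simp: P_def large_def)
  qed
  have \<sigma>P: "\<sigma> v = u" if "large v" "P v u" for v u
  proof -
    have "P v (SOME u. P v u)" using that(2) by (rule someI)
    then have "(SOME u. P v u) = u" using unique[OF that(1) _ that(2)] by blast
    then show ?thesis using that(2) by (auto simp: \<sigma>_def)
  qed
  have \<sigma>: "P v (\<sigma> v) \<or> \<sigma> v = v" for v
    unfolding \<sigma>_def using someI_ex[of "P v"] by presburger
  have pair: "pairing \<sigma>"
    unfolding pairing_def
  proof (intro allI impI)
    fix v assume v: "large v"
    show "large (\<sigma> v) \<and> \<sigma> (\<sigma> v) = v \<and> (\<sigma> v \<noteq> v \<longrightarrow> d v + d (\<sigma> v) \<le> k)"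
    proof (cases "\<sigma> v = v")
      case False
      then have P: "P v (\<sigma> v)" using \<sigma>[of v] by blast
      then have "\<sigma> (\<sigma> v) = v" using v by (intro \<sigma>P) (auto simp: P_def)
      moreover have "sum d {v, \<sigma> v} \<le> k"
        using P v by (intro cap[of _ v]) (auto simp: P_def large_def)
      ultimately show ?thesis using P False by (auto simp: P_def)
    qed (use v in simp)
  qed
  have "(\<Sum>v | large v. 2 * c 0 v - saving v (\<sigma> v) / 2) \<le> 1 * solution_cost c S"
  proof -
    have finS: "finite S" and tours: "\<And>t. t \<in> S \<Longrightarrow> distinct t \<and> set t \<subseteq> customers n"
      and asg: "\<And>v. v \<in> customers n \<Longrightarrow> a v \<in> S \<and> v \<in> set (a v)"
      using feas by (auto simp: feasible_def is_tour_def)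
    \<comment> \<open>The summands of a pair add up to c 0 u + c 0 v + c u v, the cost of its tour,
      and that of a single customer to 2 c 0 v.\<close>
    have "(\<Sum>v | large v. 2 * c 0 v - saving v (\<sigma> v) / 2) =
        (\<Sum>t\<in>S. \<Sum>v | v \<in> {v. large v} \<and> a v = t. 2 * c 0 v - saving v (\<sigma> v) / 2)"
      using finS asg by (intro sum.group[symmetric]) (auto simp: large_def)
    also have "\<dots> \<le> (\<Sum>t\<in>S. tour_cost c t)"
    proof (rule sum_mono)
      fix t assume t: "t \<in> S"
      have tv: "set t \<subseteq> vertices n" using tours[OF t] customer_vertex by auto
      show "(\<Sum>v | v \<in> {v. large v} \<and> a v = t. 2 * c 0 v - saving v (\<sigma> v) / 2) \<le> tour_cost c t"
      proof (cases "\<exists>v. large v \<and> a v = t")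
        case False
        then have "{v. v \<in> {v. large v} \<and> a v = t} = {}" by blast
        then show ?thesis using tour_cost_nonneg[OF tv] by (simp only: sum.empty)
      next
        case True
        then obtain v where v: "large v" "a v = t" by blast
        then have vt: "v \<in> set t" using asg by (auto simp: large_def)
        show ?thesis
        proof (cases "\<sigma> v = v")
          case True
          have "u = v" if "large u" "a u = t" for u
            using \<sigma>P[OF v(1), of u] True that v by (auto simp: P_def)
          then have "u \<in> {v. large v} \<and> a u = t \<longleftrightarrow> u \<in> {v}" for u using v by (metis mem_Collect_eq singleton_iff)
          then have "{u. u \<in> {v. large v} \<and> a u = t} = {u. u \<in> {v}}" by (rule Collect_cong)
          then have "{u. u \<in> {v. large v} \<and> a u = t} = {v}" unfolding Collect_mem_eq .
          then show ?thesis
            using True radius_le_tour_cost[OF vt] tours[OF t] by (simp add: saving_def)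
        next
          case False
          define u where "u = \<sigma> v"
          have Pu: "P v u" using False \<sigma>[of v] by (auto simp: u_def)
          then have u: "large u" "u \<noteq> v" "a u = t" using v by (auto simp: P_def)
          have \<sigma>u: "\<sigma> u = v" using pair v(1) by (auto simp: pairing_def u_def)
          have "{w. w \<in> {v. large v} \<and> a w = t} = {u, v}"
          proof -
            have "w = u" if "large w" "a w = t" "w \<noteq> v" for w
              using that v by (intro unique[OF v(1) _ Pu]) (simp add: P_def)
            then show ?thesis using u v by blast
          qed
          then have "(\<Sum>v | v \<in> {v. large v} \<and> a v = t. 2 * c 0 v - saving v (\<sigma> v) / 2) =
              c 0 u + c 0 v + c u v"
            using u \<sigma>u v cost_sym[of u v] large_vertex by (simp add: saving_def u_def[symmetric] field_simps)
          also have "\<dots> \<le> tour_cost c t"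
          proof -
            have ut: "u \<in> set t" using u asg by (auto simp: large_def)
            define ys where "ys = filter (\<lambda>w. w = u \<or> w = v) t"
            have "set ys = {u, v}" "distinct ys" using ut vt tours[OF t] by (auto simp: ys_def)
            then have "length ys = 2" using distinct_card[of ys] u(2) by simp
            then obtain y1 y2 where "ys = [y1, y2]"
              by (auto simp: numeral_2_eq_2 length_Suc_conv)
            then have "ys = [u, v] \<or> ys = [v, u]"
              using \<open>set ys = {u, v}\<close> \<open>distinct ys\<close> by auto
            then have "tour_cost c ys = c 0 u + c 0 v + c u v"
              using cost_sym[of u 0] cost_sym[of v 0] cost_sym[of v u] u v large_vertex
              by (auto simp: tour_cost_eq_path)
            moreover have "tour_cost c ys \<le> tour_cost c t"
              unfolding ys_def by (rule tour_cost_subseq[OF _ tv]) simp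
            ultimately show ?thesis by simp
          qed
          finally show ?thesis .
        qed
      qed
    qed
    finally show ?thesis by (simp add: solution_cost_def)
  qed
  then have "pairing_cost \<sigma> \<le> solution_cost c S"
    by (simp add: pairing_cost_def total_saving_def sum_subtractf sum_divide_distrib)
  then show ?thesis using that pair by blast
qed

text \<open>Converts the loss of the local search, a fraction of the savings, into a fraction of the
  radial bound: \<open>k < 3 * d v\<close> gives 2 c(0,v) <= 3 \<open>radial v\<close>.\<close>

lemma total_saving_le:
  assumes "pairing \<sigma>"
  shows "total_saving \<sigma> \<le> 3 * sum radial {v. large v}"
proof -
  define L where "L = {v. large v}"
  have \<sigma>: "\<sigma> x \<in> L" "\<sigma> (\<sigma> x) = x" if "x \<in> L" for x
    using assms that by (auto simp: pairing_def L_def)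
  have "saving v (\<sigma> v) \<le> c 0 v + c 0 (\<sigma> v)" if "v \<in> L" for v
    using that \<sigma>[OF that] cost_nonneg[of 0 v] cost_nonneg[of v "\<sigma> v"] large_vertex
    by (auto simp: saving_def L_def)
  then have "total_saving \<sigma> \<le> (\<Sum>v\<in>L. c 0 v + c 0 (\<sigma> v))"
    unfolding total_saving_def L_def[symmetric] by (intro sum_mono) auto
  also have "\<dots> = (\<Sum>v\<in>L. c 0 v) + (\<Sum>v\<in>L. c 0 (\<sigma> v))" by (rule sum.distrib)
  also have "(\<Sum>v\<in>L. c 0 (\<sigma> v)) = (\<Sum>v\<in>L. c 0 v)"
    using \<sigma> by (intro sum.reindex_bij_witness[of _ \<sigma> \<sigma>]) auto
  also have "(\<Sum>v\<in>L. c 0 v) + (\<Sum>v\<in>L. c 0 v) = (\<Sum>v\<in>L. 2 * c 0 v)" by (simp add: sum_distrib_left)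
  also have "\<dots> \<le> (\<Sum>v\<in>L. 3 * radial v)"
  proof (rule sum_mono)
    fix v assume "v \<in> L"
    then have v: "v \<in> customers n" "k < 3 * d v" by (auto simp: L_def large_def)
    have "2 * c 0 v * (real k) \<le> 2 * c 0 v * (3 * real (d v))"
      using v cost_nonneg[of 0 v] customer_vertex by (intro mult_left_mono) auto
    then show "2 * c 0 v \<le> 3 * radial v" using k_pos by (simp add: radial_def field_simps)
  qed
  finally show ?thesis by (simp add: sum_distrib_left L_def)
qed

end

section \<open>Bounded loop programs\<close>

text \<open>Every loop has its number of rounds fixed on entry, so the meaning is a total function
  on states and the running time is visible in the syntax. There are no coin flips.\<close>

datatype prog =
    Noop
  | NSet nat nexp nexp nexp
  | RSet nat nexp nexp rexp
  | Then prog prog (infixr ";;" 60)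
  | Ite bexp prog prog
  | For nat "nat option" prog

text \<open>\<open>For a b p\<close> uses the cell \<open>a[0, 0]\<close> as its counter, which runs from \<open>0\<close> to \<open>n\<close> if \<open>b = None\<close>
  and from \<open>0\<close> to \<open>m - 1\<close> if \<open>b = Some m\<close>.\<close>

abbreviation NV :: "nat \<Rightarrow> nexp" where
  "NV a \<equiv> NAt a (Lit 0) (Lit 0)"

fun loop_bound :: "nat option \<Rightarrow> nexp" where
  "loop_bound None = NPlus (NV 0) (Lit 1)"
| "loop_bound (Some m) = Lit m"

primrec compile :: "prog \<Rightarrow> com" where
  "compile Noop = Skip"
| "compile (NSet a e f g) = NAssign a e f g"
| "compile (RSet a e f g) = RAssign a e f g"
| "compile (p ;; q) = Seq (compile p) (compile q)"
| "compile (Ite b p q) = Cond b (compile p) (compile q)"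
| "compile (For a b p) = Seq (NAssign a (Lit 0) (Lit 0) (Lit 0))
     (While (NLess (NV a) (loop_bound b))
        (Seq (compile p) (NAssign a (Lit 0) (Lit 0) (NPlus (NV a) (Lit 1)))))"

primrec loop :: "(state \<Rightarrow> state) \<Rightarrow> nat \<Rightarrow> nat \<Rightarrow> state \<Rightarrow> state" where
  "loop f a 0 s = nset a 0 0 0 s"
| "loop f a (Suc m) s = nset a 0 0 (Suc m) (f (loop f a m s))"

primrec den :: "prog \<Rightarrow> state \<Rightarrow> state" where
  "den Noop s = s"
| "den (NSet a e f g) s = nset a (nval e s) (nval f s) (nval g s) s"
| "den (RSet a e f g) s = rset a (nval e s) (nval f s) (rval g s) s"
| "den (p ;; q) s = den q (den p s)"
| "den (Ite b p q) s = (if bval b s then den p s else den q s)"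
| "den (For a b p) s = loop (den p) a (nval (loop_bound b) s) s"

primrec nwrites :: "prog \<Rightarrow> nat set" where
  "nwrites Noop = {}"
| "nwrites (NSet a e f g) = {a}"
| "nwrites (RSet a e f g) = {}"
| "nwrites (p ;; q) = nwrites p \<union> nwrites q"
| "nwrites (Ite b p q) = nwrites p \<union> nwrites q"
| "nwrites (For a b p) = insert a (nwrites p)"

primrec rwrites :: "prog \<Rightarrow> nat set" where
  "rwrites Noop = {}"
| "rwrites (NSet a e f g) = {}"
| "rwrites (RSet a e f g) = {a}"
| "rwrites (p ;; q) = rwrites p \<union> rwrites q"
| "rwrites (Ite b p q) = rwrites p \<union> rwrites q"
| "rwrites (For a b p) = rwrites p"

text \<open>The compiled loop increments its counter and rereads n in every test, while
  \<open>loop\<close> prescribes the counter. Both agree if the body leaves the counter alone and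
  nothing overwrites array 0.\<close>

primrec wf_prog :: "prog \<Rightarrow> bool" where
  "wf_prog Noop = True"
| "wf_prog (NSet a e f g) \<longleftrightarrow> a \<noteq> 0"
| "wf_prog (RSet a e f g) = True"
| "wf_prog (p ;; q) \<longleftrightarrow> wf_prog p \<and> wf_prog q"
| "wf_prog (Ite b p q) \<longleftrightarrow> wf_prog p \<and> wf_prog q"
| "wf_prog (For a b p) \<longleftrightarrow> a \<noteq> 0 \<and> a \<notin> nwrites p \<and> wf_prog p"

lemma nmem_nset: "nmem (nset a i j x s) b i' j' = (if b = a \<and> i' = i \<and> j' = j then x else nmem s b i' j')"
  by (simp add: nset_def upd_def)

lemma rmem_rset: "rmem (rset a i j x s) b i' j' = (if b = a \<and> i' = i \<and> j' = j then x else rmem s b i' j')"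
  by (simp add: rset_def upd_def)

lemma rmem_nset [simp]: "rmem (nset a i j x s) = rmem s"
  by (simp add: nset_def)

lemma nmem_rset [simp]: "nmem (rset a i j x s) = nmem s"
  by (simp add: rset_def)

lemma nmem_nset_other: "b \<noteq> a \<Longrightarrow> nmem (nset a i j x s) b = nmem s b"
  by (simp add: nset_def upd_def)

lemma rmem_rset_other: "b \<noteq> a \<Longrightarrow> rmem (rset a i j x s) b = rmem s b"
  by (simp add: rset_def upd_def)

lemma loop_counter: "nmem (loop f a m s) a 0 0 = m"
  by (cases m) (simp_all add: nmem_nset)

lemma loop_rule:
  assumes "I 0 (nset a 0 0 0 s)"
    and "\<And>i s. i < m \<Longrightarrow> nmem s a 0 0 = i \<Longrightarrow> I i s \<Longrightarrow> I (Suc i) (nset a 0 0 (Suc i) (f s))"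
  shows "I m (loop f a m s)"
  using assms(2)
proof (induction m)
  case (Suc m)
  have "I m (loop f a m s)" using Suc.prems by (intro Suc.IH) simp
  then show ?case using Suc.prems[of m "loop f a m s"] by (simp add: loop_counter)
qed (simp add: assms(1))

lemma nmem_den: "a \<notin> nwrites p \<Longrightarrow> nmem (den p s) a = nmem s a"
proof (induction p arbitrary: s)
  case (For x b p)
  have "nmem (loop (den p) x m s) a = nmem s a" for m
    using For by (induction m) (simp_all add: nmem_nset_other)
  then show ?case by simp
qed (simp_all add: nmem_nset_other)

lemma rmem_den: "a \<notin> rwrites p \<Longrightarrow> rmem (den p s) a = rmem s a"
proof (induction p arbitrary: s)
  case (For x b p)
  have "rmem (loop (den p) x m s) a = rmem s a" for m
    using For by (induction m) simp_all
  then show ?case by simp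
qed (simp_all add: rmem_rset_other)

subsection \<open>Correctness and running time of compilation\<close>

text \<open>Executions in which every step is a point distribution; they collapse \<open>run\<close>
  to \<open>return_pmf\<close>.\<close>

inductive steps :: "com \<Rightarrow> state \<Rightarrow> nat \<Rightarrow> com \<Rightarrow> state \<Rightarrow> bool" where
  steps_refl: "steps P s 0 P s"
| steps_step: "P \<noteq> Skip \<Longrightarrow> step P s = return_pmf (P', s') \<Longrightarrow> steps P' s' t Q s'' \<Longrightarrow> steps P s (Suc t) Q s''"

lemma steps_single: "P \<noteq> Skip \<Longrightarrow> step P s = return_pmf (P', s') \<Longrightarrow> steps P s 1 P' s'"
  using steps_step[OF _ _ steps_refl] by fastforce

lemma steps_trans: "steps P s t Q s' \<Longrightarrow> steps Q s' u R s'' \<Longrightarrow> steps P s (t + u) R s''"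
  by (induction rule: steps.induct) (auto intro: steps_step)

lemma steps_Seq: "steps P s t P' s' \<Longrightarrow> steps (Seq P Q) s t (Seq P' Q) s'"
proof (induction rule: steps.induct)
  case (steps_step P s P' s' t R s'')
  then show ?case by (intro steps.steps_step[of _ _ "Seq P' Q" s']) simp_all
qed (rule steps_refl)

lemma steps_Seq_Skip: "steps P s t Skip s' \<Longrightarrow> steps (Seq P Q) s (Suc t) Q s'"
  using steps_trans[OF steps_Seq steps_single, of P s t Skip s' Q Q s'] by simp

lemma run_Suc_front: "run (Suc t) P s = bind_pmf (step P s) (\<lambda>(Q, s'). run t Q s')"
proof (induction t arbitrary: P s)
  case 0
  show ?case by (simp add: bind_return_pmf bind_return_pmf' case_prod_unfold)
next
  case (Suc t)
  have "run (Suc (Suc t)) P s = bind_pmf (run (Suc t) P s) (\<lambda>(Q, s'). step Q s')" by simp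
  also have "\<dots> = bind_pmf (step P s) (\<lambda>(Q, s'). run (Suc t) Q s')"
    by (subst Suc) (simp add: bind_assoc_pmf case_prod_unfold)
  finally show ?case .
qed

lemma run_Skip: "run t Skip s = return_pmf (Skip, s)"
  by (induction t) (simp_all add: bind_return_pmf)

lemma steps_run: "steps P s t Skip s' \<Longrightarrow> t \<le> u \<Longrightarrow> run u P s = return_pmf (Skip, s')"
proof (induction P s t "Skip :: com" s' arbitrary: u rule: steps.induct)
  case (steps_refl s)
  then show ?case by (simp add: run_Skip)
next
  case (steps_step P s P' s' t s'')
  then obtain v where "u = Suc v" "t \<le> v" by (cases u) auto
  then show ?case using steps_step by (simp add: run_Suc_front bind_return_pmf del: run.simps)
qed

section \<open>Running time from the syntax\<close>

text \<open>\<open>B\<close> bounds n + 1. A round of a loop adds the test, the increment and two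
  unwindings of \<open>Seq\<close>; entering and leaving the loop add three steps.\<close>

primrec time :: "nat \<Rightarrow> prog \<Rightarrow> nat" where
  "time B Noop = 0"
| "time B (NSet a e f g) = 1"
| "time B (RSet a e f g) = 1"
| "time B (p ;; q) = time B p + time B q + 1"
| "time B (Ite b p q) = time B p + time B q + 1"
| "time B (For a b p) = (case b of None \<Rightarrow> B | Some m \<Rightarrow> m) * (time B p + 4) + 3"

lemma steps_compile:
  assumes "wf_prog p" "Suc (nmem s 0 0 0) \<le> B"
  shows "\<exists>t \<le> time B p. steps (compile p) s t Skip (den p s)"
  using assms
proof (induction p arbitrary: s)
  case Noop
  then show ?case using steps_refl by auto
next
  case (NSet a e f g)
  then show ?case using steps_single[of "NAssign a e f g" s] by fastforce
next
  case (RSet a e f g)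
  then show ?case using steps_single[of "RAssign a e f g" s] by fastforce
next
  case (Then p q)
  have "0 \<notin> nwrites p" using Then.prems(1) by (induction p) auto
  then have B: "Suc (nmem (den p s) 0 0 0) \<le> B" using Then.prems(2) by (simp add: nmem_den)
  obtain t u where "t \<le> time B p" "steps (compile p) s t Skip (den p s)"
    "u \<le> time B q" "steps (compile q) (den p s) u Skip (den q (den p s))"
    using Then.IH(1)[OF _ Then.prems(2)] Then.IH(2)[OF _ B] Then.prems(1) by auto
  then show ?case
    using steps_trans[OF steps_Seq_Skip, of "compile p" s t "den p s" "compile q" u]
    by (intro exI[of _ "Suc t + u"]) simp
next
  case (Ite b p q)
  define r where "r = (if bval b s then p else q)"
  have "\<exists>t \<le> time B r. steps (compile r) s t Skip (den r s)"
    using Ite unfolding r_def by (cases "bval b s") auto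
  then obtain t where t: "t \<le> time B r" "steps (compile r) s t Skip (den r s)" by blast
  have "steps (compile (Ite b p q)) s 1 (compile r) s"
    by (intro steps_single) (simp_all add: r_def)
  from steps_trans[OF this t(2)] show ?case
    using t(1) by (intro exI[of _ "1 + t"]) (auto simp: r_def)
next
  case (For a b p)
  define W where "W = While (NLess (NV a) (loop_bound b))
        (Seq (compile p) (NAssign a (Lit 0) (Lit 0) (NPlus (NV a) (Lit 1))))"
  define M where "M = nval (loop_bound b) s"
  have wf: "a \<noteq> 0" "a \<notin> nwrites p" "wf_prog p" using For.prems(1) by auto
  have "0 \<notin> nwrites p" using wf(3) by (induction p) auto
  then have zero: "nmem (loop (den p) a m s) 0 = nmem s 0" for m
    using wf(1) by (induction m) (simp_all add: nmem_nset_other nmem_den)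
  have bnd: "nval (loop_bound b) (loop (den p) a m s) = M" for m
    by (cases b) (simp_all add: zero M_def)
  have iter: "\<exists>t \<le> m * (time B p + 4). steps W (loop (den p) a 0 s) t W (loop (den p) a m s)" if "m \<le> M" for m
    using that
  proof (induction m)
    case 0
    show ?case using steps_refl by auto
  next
    case (Suc m)
    define s' where "s' = loop (den p) a m s"
    obtain t where t: "t \<le> m * (time B p + 4)" "steps W (loop (den p) a 0 s) t W s'"
      using Suc by (auto simp: s'_def)
    have B: "Suc (nmem s' 0 0 0) \<le> B" using For.prems(2) zero[of m] by (simp add: s'_def)
    obtain u where u: "u \<le> time B p" "steps (compile p) s' u Skip (den p s')"
      using For.IH[OF wf(3) B] by blast
    define inc where "inc = NAssign a (Lit 0) (Lit 0) (NPlus (NV a) (Lit 1))"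
    have "bval (NLess (NV a) (loop_bound b)) s'"
      using Suc.prems bnd[of m] by (simp add: s'_def loop_counter)
    then have 1: "steps W s' 1 (Seq (Seq (compile p) inc) W) s'"
      unfolding W_def inc_def by (intro steps_single) simp_all
    have 2: "steps inc (den p s') 1 Skip (loop (den p) a (Suc m) s)"
      using wf(2) by (intro steps_single) (simp_all add: inc_def s'_def nmem_den loop_counter)
    have "steps (Seq (compile p) inc) s' (Suc u + 1) Skip (loop (den p) a (Suc m) s)"
      by (rule steps_trans[OF steps_Seq_Skip[OF u(2)] 2])
    from steps_trans[OF t(2) steps_trans[OF 1 steps_Seq_Skip[OF this]]]
    show ?case using t(1) u(1) by (intro exI[of _ "t + (1 + Suc (Suc u + 1))"]) simp
  qed
  then obtain t where t: "t \<le> M * (time B p + 4)" "steps W (loop (den p) a 0 s) t W (loop (den p) a M s)" by blast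
  have init: "steps (compile (For a b p)) s (Suc 1) W (loop (den p) a 0 s)"
    unfolding compile.simps W_def[symmetric] by (intro steps_Seq_Skip steps_single) simp_all
  have "\<not> bval (NLess (NV a) (loop_bound b)) (loop (den p) a M s)"
    using bnd[of M] by (simp add: loop_counter)
  then have last: "steps W (loop (den p) a M s) 1 Skip (loop (den p) a M s)"
    unfolding W_def by (intro steps_single) simp_all
  have "M \<le> (case b of None \<Rightarrow> B | Some m \<Rightarrow> m)" using For.prems(2) by (cases b) (simp_all add: M_def)
  then have "M * (time B p + 4) \<le> (case b of None \<Rightarrow> B | Some m \<Rightarrow> m) * (time B p + 4)" by (rule mult_right_mono) simp
  with t(1) have "t \<le> (case b of None \<Rightarrow> B | Some m \<Rightarrow> m) * (time B p + 4)" by (rule order_trans)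
  then show ?case
    using steps_trans[OF init steps_trans[OF t(2) last]]
    by (intro exI[of _ "Suc 1 + (t + 1)"]) (simp add: M_def)
qed

text \<open>An exponent of \<open>B >= 2\<close>. A loop over a constant m weighs m because m <= 2^m
  <= B^m, crude but linear in q. The summands 2 and 3 absorb constant factors up to 4 and 8.\<close>

primrec weight :: "prog \<Rightarrow> nat" where
  "weight Noop = 0"
| "weight (NSet a e f g) = 0"
| "weight (RSet a e f g) = 0"
| "weight (p ;; q) = weight p + weight q + 2"
| "weight (Ite b p q) = weight p + weight q + 2"
| "weight (For a b p) = (case b of None \<Rightarrow> 1 | Some m \<Rightarrow> m) + weight p + 3"

lemma time_le_power:
  assumes "2 \<le> B"
  shows "time B p \<le> B ^ weight p"
proof (induction p)
  case (Then p q)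
  have "4 \<le> B\<^sup>2" using power_mono[OF assms, of 2] by simp
  have "time B p + time B q + 1 \<le> B ^ weight p + B ^ weight q + 1" using Then by simp
  also have "\<dots> \<le> B ^ (weight p + weight q) + B ^ (weight p + weight q) + B ^ (weight p + weight q)"
    using assms by (intro add_mono power_increasing one_le_power) auto
  also have "\<dots> \<le> B ^ (weight p + weight q) * B\<^sup>2"
    using mult_le_mono2[of 3 "B\<^sup>2" "B ^ (weight p + weight q)"] \<open>4 \<le> B\<^sup>2\<close> by linarith
  finally show ?case by (simp add: power_add power2_eq_square ac_simps)
next
  case (Ite b p q)
  have "4 \<le> B\<^sup>2" using power_mono[OF assms, of 2] by simp
  have "time B p + time B q + 1 \<le> B ^ weight p + B ^ weight q + 1" using Ite by simp
  also have "\<dots> \<le> B ^ (weight p + weight q) + B ^ (weight p + weight q) + B ^ (weight p + weight q)"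
    using assms by (intro add_mono power_increasing one_le_power) auto
  also have "\<dots> \<le> B ^ (weight p + weight q) * B\<^sup>2"
    using mult_le_mono2[of 3 "B\<^sup>2" "B ^ (weight p + weight q)"] \<open>4 \<le> B\<^sup>2\<close> by linarith
  finally show ?case by (simp add: power_add power2_eq_square ac_simps)
next
  case (For a b p)
  define e where "e = (case b of None \<Rightarrow> 1 | Some m \<Rightarrow> m)"
  define X where "X = B ^ (e + weight p)"
  have "8 \<le> B ^ 3" using power_mono[OF assms, of 3] by simp
  have "m \<le> B ^ m" for m
    using less_exp[of m] power_mono[OF assms, of m] by linarith
  then have e: "(case b of None \<Rightarrow> B | Some m \<Rightarrow> m) \<le> B ^ e" by (cases b) (simp_all add: e_def)
  have p: "B ^ weight p \<ge> 1" "B ^ e \<ge> 1" using assms by (auto intro: one_le_power)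
  have "time B (For a b p) \<le> B ^ e * (B ^ weight p + 4) + 3"
    using e For by (simp add: mult_mono)
  also have "\<dots> \<le> B ^ e * (5 * B ^ weight p) + 3 * X"
    using p unfolding X_def power_add by (intro add_mono mult_left_mono) (simp_all add: Suc_le_eq)
  also have "\<dots> = 8 * X" by (simp add: X_def power_add)
  also have "\<dots> \<le> B ^ 3 * X" using \<open>8 \<le> B ^ 3\<close> by simp
  finally show ?case by (simp add: X_def e_def power_add algebra_simps)
qed (use assms in auto)

section \<open>The program\<close>

abbreviation (input) cell :: "nat \<Rightarrow> nexp \<Rightarrow> nexp" where
  "cell a e \<equiv> NAt a e (Lit 0)"

abbreviation (input) RV :: "nat \<Rightarrow> rexp" where
  "RV a \<equiv> RAt a (Lit 0) (Lit 0)"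

abbreviation (input) setv :: "nat \<Rightarrow> nexp \<Rightarrow> prog" where
  "setv a e \<equiv> NSet a (Lit 0) (Lit 0) e"

abbreviation (input) rsetv :: "nat \<Rightarrow> rexp \<Rightarrow> prog" where
  "rsetv a e \<equiv> RSet a (Lit 0) (Lit 0) e"

abbreviation (input) cap :: nexp where
  "cap \<equiv> NAt 0 (Lit 0) (Lit 1)"

lemmas mem_simps = nmem_nset rmem_rset

definition holds_list :: "(nat \<Rightarrow> nat) \<Rightarrow> nat list \<Rightarrow> bool" where
  "holds_list m ys \<longleftrightarrow> m 0 = length ys \<and> (\<forall>i<length ys. m (Suc i) = ys ! i)"

text \<open>Appends the vertex in \<open>N20\<close> to the current tour; the depot closes the tour. \<open>N13\<close> counts
  the closed tours, \<open>N14\<close> and \<open>N15\<close> hold tours and assignment, \<open>N6\<close> marks the served customers,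
  \<open>N7\<close> is the last vertex visited and \<open>R1\<close> the cost so far.\<close>

definition push :: prog where
  "push =
     rsetv 1 (RPlus (RV 1) (RAt 0 (NV 7) (NV 20))) ;;
     Ite (NLess (Lit 0) (NV 20))
       (NSet 14 (NV 13) (Lit 0) (NPlus (NAt 14 (NV 13) (Lit 0)) (Lit 1)) ;;
        NSet 14 (NV 13) (NAt 14 (NV 13) (Lit 0)) (NV 20) ;;
        NSet 15 (NV 20) (Lit 0) (NV 13) ;;
        NSet 6 (NV 20) (Lit 0) (Lit 1))
       (Ite (NLess (Lit 0) (NV 7))
         (setv 13 (NPlus (NV 13) (Lit 1)) ;; NSet 14 (NV 13) (Lit 0) (Lit 0))
         Noop) ;;
     setv 7 (NV 20)"

definition reset :: prog where
  "reset = setv 13 (Lit 0) ;; NSet 14 (Lit 0) (Lit 0) (Lit 0) ;; setv 7 (Lit 0) ;;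
     rsetv 1 (OfNat (Lit 0)) ;; For 21 None (NSet 6 (NV 21) (Lit 0) (Lit 0))"

definition single_push :: prog where
  "single_push = push ;; setv 20 (Lit 0) ;; push"

section \<open>Tours under construction in memory\<close>

locale cvrp_tsp = cvrp +
  fixes A :: "nat list"
  assumes tsp_tour: "tsp_tour n A"
begin

definition inputs :: "state \<Rightarrow> bool" where
  "inputs s \<longleftrightarrow> nmem s 0 0 0 = n \<and> nmem s 0 0 1 = k \<and> (\<forall>v\<in>customers n. nmem s 1 v 0 = d v) \<and>
     (\<forall>i\<le>n. nmem s 2 i 0 = A ! i) \<and> (\<forall>u\<in>vertices n. \<forall>v\<in>vertices n. rmem s 0 u v = c u v)"

lemma inputsD:
  assumes "inputs s"
  shows "nmem s 0 0 0 = n" "nmem s 0 0 (Suc 0) = k" "v \<in> customers n \<Longrightarrow> nmem s (Suc 0) v 0 = d v"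
    "i \<le> n \<Longrightarrow> nmem s 2 i 0 = A ! i" "u \<in> vertices n \<Longrightarrow> v \<in> vertices n \<Longrightarrow> rmem s 0 u v = c u v"
  using assms by (auto simp: inputs_def)

lemma inputs_den:
  assumes "inputs s" "0 \<notin> nwrites p" "1 \<notin> nwrites p" "2 \<notin> nwrites p" "0 \<notin> rwrites p"
  shows "inputs (den p s)"
  using assms unfolding inputs_def by (simp add: nmem_den rmem_den)

lemma inputs_nset: "inputs s \<Longrightarrow> 2 < a \<Longrightarrow> inputs (nset a i j x s)"
  unfolding inputs_def by (simp add: nmem_nset)

lemma inputs_rset: "inputs s \<Longrightarrow> 0 < a \<Longrightarrow> inputs (rset a i j x s)"
  unfolding inputs_def by (simp add: rmem_rset)

lemma vertices_iff: "v \<in> vertices n \<longleftrightarrow> v \<le> n" and customers_iff: "v \<in> customers n \<longleftrightarrow> 0 < v \<and> v \<le> n"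
  by (auto simp: vertices_def customers_def)

lemma loop_count: "inputs s \<Longrightarrow> nval (loop_bound None) s = Suc n"
  by (simp add: inputsD)

abbreviation served :: "nat list list \<Rightarrow> nat set" where
  "served D \<equiv> set (concat D)"

definition tours_cost :: "nat list list \<Rightarrow> real" where
  "tours_cost D = (\<Sum>t\<leftarrow>D. tour_cost c t)"

definition valid_tours :: "nat list list \<Rightarrow> bool" where
  "valid_tours D \<longleftrightarrow> distinct (concat D) \<and> served D \<subseteq> customers n \<and>
     (\<forall>t\<in>set D. t \<noteq> [] \<and> sum_list (map d t) \<le> k)"

text \<open>\<open>D\<close> lists the closed tours and \<open>ys\<close> is the open one, in the
  row behind them. Disjointness is part of the invariant, whereas the capacity is left to
  \<open>valid_tours\<close>, which speaks of closed tours only.\<close>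

definition buffer :: "state \<Rightarrow> nat list list \<Rightarrow> nat list \<Rightarrow> bool" where
  "buffer s D ys \<longleftrightarrow>
     nmem s 13 0 0 = length D \<and>
     (\<forall>j<length D. holds_list (nmem s 14 j) (D ! j)) \<and> holds_list (nmem s 14 (length D)) ys \<and>
     (\<forall>j<length D. \<forall>v\<in>set (D ! j). nmem s 15 v 0 = j) \<and> (\<forall>v\<in>set ys. nmem s 15 v 0 = length D) \<and>
     nmem s 7 0 0 = last (0 # ys) \<and>
     (\<forall>v\<le>n. nmem s 6 v 0 = of_bool (v \<in> served D \<union> set ys)) \<and>
     distinct (concat D @ ys) \<and> served D \<union> set ys \<subseteq> customers n \<and>
     rmem s 1 0 0 = tours_cost D + walk_cost c 0 ys"

lemma buffer_cong:
  assumes "buffer s D ys"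
    "nmem s' 13 = nmem s 13" "nmem s' 14 = nmem s 14" "nmem s' 15 = nmem s 15" "nmem s' 7 = nmem s 7"
    "nmem s' 6 = nmem s 6" "rmem s' 1 = rmem s 1"
  shows "buffer s' D ys"
  using assms unfolding buffer_def by metis

lemma buffer_den:
  assumes "buffer s D ys" "nwrites p \<inter> {6, 7, 13, 14, 15} = {}" "1 \<notin> rwrites p"
  shows "buffer (den p s) D ys"
proof -
  have "6 \<notin> nwrites p" "7 \<notin> nwrites p" "13 \<notin> nwrites p" "14 \<notin> nwrites p" "15 \<notin> nwrites p"
    using assms(2) by auto
  then show ?thesis using assms by (intro buffer_cong[OF assms(1)] nmem_den rmem_den) auto
qed

lemma buffer_nset:
  assumes "buffer s D ys" "a \<notin> {6, 7, 13, 14, 15}"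
  shows "buffer (nset a i j x s) D ys"
  using assms by (intro buffer_cong[OF assms(1)]) (auto simp: nmem_nset_other)

lemma buffer_rset:
  assumes "buffer s D ys" "a \<noteq> 1"
  shows "buffer (rset a i j x s) D ys"
  using assms by (intro buffer_cong[OF assms(1)]) (auto simp: rmem_rset_other)

lemma buffer_last_vertex: "buffer s D ys \<Longrightarrow> last (0 # ys) \<in> vertices n"
  unfolding buffer_def using last_in_set[of "0 # ys"] customer_vertex by auto

lemma push_customer:
  assumes s: "inputs s" "buffer s D ys" and v: "nmem s 20 0 0 = v" "v \<in> customers n" "v \<notin> served D \<union> set ys"
  shows "buffer (den push s) D (ys @ [v])"
proof -
  have v0: "0 < v" using v(2) by (simp add: customers_def)
  have R: "rmem s 0 (last (0 # ys)) v = c (last (0 # ys)) v"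
    using s(1) buffer_last_vertex[OF s(2)] customer_vertex[OF v(2)] by (rule inputsD)
  have m: "rmem (den push s) = rmem (rset 1 0 0 (rmem s 1 0 0 + rmem s 0 (nmem s 7 0 0) v) s)"
    "nmem (den push s) 13 = nmem s 13"
    "nmem (den push s) 15 v' 0 = (if v' = v then nmem s 13 0 0 else nmem s 15 v' 0)"
    "nmem (den push s) 6 v' 0 = (if v' = v then 1 else nmem s 6 v' 0)"
    "nmem (den push s) 7 0 0 = v"
    "nmem (den push s) 14 j i = (if j = nmem s 13 0 0 \<and> i = 0 then Suc (nmem s 14 j 0)
       else if j = nmem s 13 0 0 \<and> i = Suc (nmem s 14 j 0) then v else nmem s 14 j i)" for v' j i
    using v0 v(1) by (simp_all add: push_def mem_simps nmem_nset_other)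
  have b: "nmem s 13 0 0 = length D" "nmem s 7 0 0 = last (0 # ys)" "nmem s 14 (length D) 0 = length ys"
    "rmem s 1 0 0 = tours_cost D + walk_cost c 0 ys"
    using s(2) by (auto simp: buffer_def holds_list_def)
  have lists: "holds_list (nmem (den push s) 14 j) (D ! j)" if "j < length D" for j
    using s(2) that unfolding buffer_def holds_list_def m by simp
  have cur: "holds_list (nmem (den push s) 14 (length D)) (ys @ [v])"
    using s(2) unfolding buffer_def holds_list_def m by (auto simp: nth_append less_Suc_eq)
  have asg: "nmem (den push s) 15 v' 0 = j" if "j < length D" "v' \<in> set (D ! j)" for v' j
  proof -
    have "D ! j \<in> set D" using that(1) by simp
    then have "v' \<in> served D" using that(2) by auto
    then have "v' \<noteq> v" using v(3) by auto
    then show ?thesis using s(2) that unfolding buffer_def m by simp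
  qed
  show ?thesis
    unfolding buffer_def
    using s(2) lists cur asg v v0 R b unfolding buffer_def
    by (auto simp: m rmem_rset walk_cost_snoc)
qed

text \<open>Without an open tour the push only adds \<open>c 0 0 = 0\<close>, so no empty tour ever
  enters the list.\<close>

lemma push_depot:
  assumes s: "inputs s" "buffer s D ys" and v: "nmem s 20 0 0 = 0"
  shows "buffer (den push s) (if ys = [] then D else D @ [ys]) []"
proof -
  have R: "rmem s 0 (last (0 # ys)) 0 = c (last (0 # ys)) 0"
    using s(1) buffer_last_vertex[OF s(2)] depot_vertex by (rule inputsD)
  have b: "nmem s 13 0 0 = length D" "nmem s 7 0 0 = last (0 # ys)" "nmem s 14 (length D) 0 = length ys"
    "rmem s 1 0 0 = tours_cost D + walk_cost c 0 ys"
    using s(2) by (auto simp: buffer_def holds_list_def)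
  have m: "rmem (den push s) 1 0 0 = tours_cost D + walk_cost c 0 ys + c (last (0 # ys)) 0"
    "nmem (den push s) 15 = nmem s 15" "nmem (den push s) 6 = nmem s 6" "nmem (den push s) 7 0 0 = 0"
    using v R b by (simp_all add: push_def mem_simps nmem_nset_other rmem_rset_other)
  show ?thesis
  proof (cases "ys = []")
    case True
    have "nmem (den push s) 13 = nmem s 13" "nmem (den push s) 14 = nmem s 14"
      using v b True by (simp_all add: push_def nmem_nset_other)
    then show ?thesis using s(2) m True unfolding buffer_def by (auto simp: cost_refl)
  next
    case False
    have pos: "0 < last (0 # ys)"
    proof -
      have "last ys \<in> customers n" using False s(2) by (auto simp: buffer_def)
      then show ?thesis using False by (simp add: customers_def)
    qed
    have m': "nmem (den push s) 13 0 0 = Suc (length D)"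
      "nmem (den push s) 14 j i = (if j = Suc (length D) \<and> i = 0 then 0 else nmem s 14 j i)" for j i
      using v b pos by (simp_all add: push_def mem_simps)
    have lists: "holds_list (nmem (den push s) 14 j) ((D @ [ys]) ! j)" if "j < Suc (length D)" for j
      using s(2) that unfolding buffer_def holds_list_def m' by (auto simp: nth_append less_Suc_eq)
    have asg: "nmem (den push s) 15 v' 0 = j" if "j < Suc (length D)" "v' \<in> set ((D @ [ys]) ! j)" for v' j
      using s(2) that unfolding buffer_def m by (auto simp: nth_append less_Suc_eq)
    have new: "holds_list (nmem (den push s) 14 (Suc (length D))) []" by (simp add: holds_list_def m')
    have "rmem (den push s) 1 0 0 = tours_cost (D @ [ys])"
      using m(1) by (simp add: tours_cost_def tour_cost_eq_path walk_cost_snoc)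
    then have "buffer (den push s) (D @ [ys]) []"
      unfolding buffer_def using s(2) lists asg new m' m unfolding buffer_def by auto
    then show ?thesis using False by simp
  qed
qed

lemma nwrites_push: "nwrites push = {6, 7, 13, 14, 15}" and rwrites_push: "rwrites push = {1}"
  by (auto simp: push_def)

lemma inputs_push: "inputs s \<Longrightarrow> inputs (den push s)"
  by (intro inputs_den) (simp_all add: nwrites_push rwrites_push)

lemma buffer_reset:
  assumes "inputs s"
  shows "buffer (den reset s) [] []"
proof -
  define s1 where "s1 = den (setv 13 (Lit 0) ;; NSet 14 (Lit 0) (Lit 0) (Lit 0) ;; setv 7 (Lit 0) ;; rsetv 1 (OfNat (Lit 0))) s"
  define f where "f = den (NSet 6 (NV 21) (Lit 0) (Lit 0))"
  have s1: "inputs s1" using assms by (simp add: s1_def inputs_nset inputs_rset)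
  have "den reset s = loop f 21 (nval (loop_bound None) s1) s1" by (simp add: reset_def s1_def f_def)
  then have reset: "den reset s = loop f 21 (Suc n) s1" using loop_count[OF s1] by simp
  have "(\<forall>v<Suc n. nmem (loop f 21 (Suc n) s1) 6 v 0 = 0) \<and>
      (\<forall>a\<in>{7, 13, 14}. nmem (loop f 21 (Suc n) s1) a = nmem s1 a) \<and> rmem (loop f 21 (Suc n) s1) = rmem s1"
    by (rule loop_rule[where I = "\<lambda>i s. (\<forall>v<i. nmem s 6 v 0 = 0) \<and>
         (\<forall>a\<in>{7, 13, 14}. nmem s a = nmem s1 a) \<and> rmem s = rmem s1"])
      (auto simp: f_def nmem_nset nmem_nset_other less_Suc_eq)
  then show ?thesis
    unfolding reset buffer_def
    by (auto simp: s1_def nmem_nset rmem_rset holds_list_def tours_cost_def)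
qed

lemma buffer_served: "buffer s D ys \<Longrightarrow> v \<le> n \<Longrightarrow> nmem s 6 v 0 = of_bool (v \<in> served D \<union> set ys)"
  by (simp add: buffer_def)

lemma valid_tours_snoc:
  assumes "buffer s D ys" "ys \<noteq> []" "sum_list (map d ys) \<le> k" "valid_tours D"
  shows "valid_tours (D @ [ys])"
  using assms unfolding buffer_def valid_tours_def by auto

lemma tours_cost_snoc: "tours_cost (D @ [ys]) = tours_cost D + tour_cost c ys"
  by (simp add: tours_cost_def)

lemma push_single:
  assumes s: "inputs s" "buffer s D []" and v: "nmem s 20 0 0 = v" "v \<in> customers n" "v \<notin> served D"
  shows "buffer (den single_push s) (D @ [[v]]) []"
proof -
  define s1 where "s1 = nset 20 0 0 0 (den push s)"
  have "buffer (den push s) D [v]" using push_customer[OF s v(1,2)] v(3) by simp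
  then have 1: "buffer s1 D [v]" unfolding s1_def by (intro buffer_nset) auto
  have 2: "inputs s1" using s by (simp add: s1_def inputs_push inputs_nset)
  have "nmem s1 20 0 0 = 0" by (simp add: s1_def nmem_nset)
  from push_depot[OF 2 1 this] show ?thesis by (simp add: single_push_def s1_def)
qed

end

subsection \<open>Exhaustive search over tuples\<close>

text \<open>The loop counters live in arrays from 100 on, apart from all other variables of the
  program.\<close>

primrec nest :: "nat \<Rightarrow> prog \<Rightarrow> prog" where
  "nest 0 p = p"
| "nest (Suc j) p = For (100 + j) None (NSet 8 (Lit j) (Lit 0) (NV (100 + j)) ;; nest j p)"

definition tuple :: "nat \<Rightarrow> (nat \<Rightarrow> nat \<Rightarrow> nat) \<Rightarrow> nat list" where
  "tuple K m = map (\<lambda>i. m i 0) [0..<K]"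

lemma length_tuple [simp]: "length (tuple K m) = K"
  and nth_tuple [simp]: "i < K \<Longrightarrow> tuple K m ! i = m i 0"
  by (simp_all add: tuple_def)

lemma tuple_eq: "length x = K \<Longrightarrow> (\<And>i. i < K \<Longrightarrow> x ! i = m i 0) \<Longrightarrow> x = tuple K m"
  by (intro nth_equalityI) simp_all

lemma set_tuple_le: "(\<And>i. i < K \<Longrightarrow> m i 0 \<le> n) \<Longrightarrow> set (tuple K m) \<subseteq> {..n}"
  by (auto simp: tuple_def)

lemma nwrites_nest: "nwrites (nest K p) = nwrites p \<union> (if K = 0 then {} else {8}) \<union> {100..<100 + K}"
  by (induction K) auto

lemma rwrites_nest: "rwrites (nest K p) = rwrites p"
  by (induction K) auto

lemma wf_nest: "wf_prog p \<Longrightarrow> nwrites p \<inter> {100..} = {} \<Longrightarrow> wf_prog (nest K p)"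
  by (induction K) (auto simp: nwrites_nest)

lemma weight_nest: "weight (nest K p) = weight p + 6 * K"
  by (induction K) auto

context cvrp
begin

text \<open>Read \<open>Q x s\<close> as: the tuple x has been accounted for. It must survive the
  body as well as changes of \<open>N8\<close> and of the counters. In the induction on the depth
  the coordinates from j on are fixed by the enclosing loops and all values of the lower ones get
  tried.\<close>

lemma nest_spec:
  assumes J: "\<And>s s'. J s \<Longrightarrow> rmem s' = rmem s \<Longrightarrow>
        (\<And>a. a \<noteq> 8 \<Longrightarrow> a \<notin> {100..<100 + K} \<Longrightarrow> nmem s' a = nmem s a) \<Longrightarrow> J s'"
    and Q: "\<And>x s s'. Q x s \<Longrightarrow> rmem s' = rmem s \<Longrightarrow>
        (\<And>a. a \<noteq> 8 \<Longrightarrow> a \<notin> {100..<100 + K} \<Longrightarrow> nmem s' a = nmem s a) \<Longrightarrow> Q x s'"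
    and zero: "\<And>s. J s \<Longrightarrow> nmem s 0 0 0 = n"
    and body: "\<And>s. J s \<Longrightarrow> (\<And>i. i < K \<Longrightarrow> nmem s 8 i 0 \<le> n) \<Longrightarrow>
        J (den p s) \<and> Q (tuple K (nmem s 8)) (den p s) \<and> (\<forall>x. Q x s \<longrightarrow> Q x (den p s))"
    and p: "8 \<notin> nwrites p"
  shows "j \<le> K \<Longrightarrow> J s \<Longrightarrow> (\<And>i. j \<le> i \<Longrightarrow> i < K \<Longrightarrow> nmem s 8 i 0 \<le> n) \<Longrightarrow>
    J (den (nest j p) s) \<and> (\<forall>x. Q x s \<longrightarrow> Q x (den (nest j p) s)) \<and>
    (\<forall>i\<ge>j. nmem (den (nest j p) s) 8 i 0 = nmem s 8 i 0) \<and>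
    (\<forall>x. length x = K \<and> (\<forall>i<j. x ! i \<le> n) \<and> (\<forall>i. j \<le> i \<and> i < K \<longrightarrow> x ! i = nmem s 8 i 0) \<longrightarrow>
       Q x (den (nest j p) s))"
proof (induction j arbitrary: s)
  case 0
  have "x = tuple K (nmem s 8)" if "length x = K" "\<forall>i. 0 \<le> i \<and> i < K \<longrightarrow> x ! i = nmem s 8 i 0" for x
    using that by (intro tuple_eq) auto
  then show ?case using body[OF 0(2) 0(3)] p by (auto simp: nmem_den)
next
  case (Suc j)
  define f where "f = den (NSet 8 (Lit j) (Lit 0) (NV (100 + j)) ;; nest j p)"
  define I where "I m t \<longleftrightarrow> J t \<and> (\<forall>x. Q x s \<longrightarrow> Q x t) \<and>
      (\<forall>i\<ge>Suc j. nmem t 8 i 0 = nmem s 8 i 0) \<and>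
      (\<forall>x. length x = K \<and> (\<forall>i<j. x ! i \<le> n) \<and> x ! j < m \<and>
         (\<forall>i. Suc j \<le> i \<and> i < K \<longrightarrow> x ! i = nmem s 8 i 0) \<longrightarrow> Q x t)" for m t
  have j: "j < K" using Suc.prems(1) by simp
  have "I (Suc n) (loop f (100 + j) (Suc n) s)"
  proof (rule loop_rule)
    have "J (nset (100 + j) 0 0 0 s)" "\<And>x. Q x s \<Longrightarrow> Q x (nset (100 + j) 0 0 0 s)"
      using j by (auto intro!: J[OF Suc.prems(2)] elim!: Q simp: nmem_nset_other)
    then show "I 0 (nset (100 + j) 0 0 0 s)" by (simp add: I_def nmem_nset_other)
  next
    fix m t assume m: "m < Suc n" "nmem t (100 + j) 0 0 = m" and I: "I m t"
    define u where "u = nset 8 j 0 m t"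
    define v where "v = den (nest j p) u"
    define w where "w = nset (100 + j) 0 0 (Suc m) v"
    have ft: "nset (100 + j) 0 0 (Suc m) (f t) = w" by (simp add: f_def w_def v_def u_def m(2))
    have Ju: "J u" and Qu: "\<And>x. Q x t \<Longrightarrow> Q x u"
      using I by (auto simp: u_def I_def nmem_nset_other intro: J elim!: Q)
    have u8: "nmem u 8 i 0 \<le> n" if "j \<le> i" "i < K" for i
      using that I m Suc.prems(3)[of i] by (cases "i = j") (auto simp: u_def nmem_nset I_def)
    have IH: "J v \<and> (\<forall>x. Q x u \<longrightarrow> Q x v) \<and> (\<forall>i\<ge>j. nmem v 8 i 0 = nmem u 8 i 0) \<and>
      (\<forall>x. length x = K \<and> (\<forall>i<j. x ! i \<le> n) \<and> (\<forall>i. j \<le> i \<and> i < K \<longrightarrow> x ! i = nmem u 8 i 0) \<longrightarrow> Q x v)"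
      unfolding v_def using j by (intro Suc.IH Ju u8) auto
    have "J v" using IH by blast
    then have Jw: "J w"
      unfolding w_def by (rule J) (use j in \<open>auto simp: nmem_nset_other\<close>)
    have Qw: "Q x w" if "Q x v" for x
      unfolding w_def using that j by (auto simp: nmem_nset_other elim!: Q)
    have w8: "nmem w 8 i 0 = nmem s 8 i 0" if "Suc j \<le> i" for i
      using IH I that by (simp add: w_def nmem_nset_other u_def I_def nmem_nset)
    have "Q x w" if x: "length x = K" "\<forall>i<j. x ! i \<le> n" "x ! j < Suc m"
         "\<forall>i. Suc j \<le> i \<and> i < K \<longrightarrow> x ! i = nmem s 8 i 0" for x
    proof (cases "x ! j = m")
      case True
      have "x ! i = nmem u 8 i 0" if "j \<le> i" "i < K" for i
        using that x(4) I True by (cases "i = j") (auto simp: u_def nmem_nset I_def)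
      then show ?thesis using IH x Qw by blast
    next
      case False
      then have "Q x t" using x I by (auto simp: I_def)
      then show ?thesis using Qu IH Qw by blast
    qed
    moreover have "Q x w" if "Q x s" for x
      using that I Qu IH Qw unfolding I_def by blast
    ultimately show "I (Suc m) (nset (100 + j) 0 0 (Suc m) (f t))"
      unfolding ft I_def using Jw w8 by simp
  qed
  moreover have "den (nest (Suc j) p) s = loop f (100 + j) (Suc n) s"
    using zero[OF Suc.prems(2)] by (simp add: f_def)
  ultimately show ?case by (simp add: I_def less_Suc_eq_le all_conj_distrib less_Suc_eq)
qed

end

text \<open>The program \<open>pr\<close> computes in \<open>R5\<close> the score of the tuple in \<open>N8\<close>. The best score and tuple are
  recorded in \<open>R6\<close> and \<open>N28\<close>, provided that the score exceeds the initial value of \<open>R6\<close>.\<close>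

definition record_best :: "nat \<Rightarrow> prog" where
  "record_best K = Ite (RLess (RV 6) (RV 5))
     (rsetv 6 (RV 5) ;; For 22 (Some K) (NSet 28 (NV 22) (Lit 0) (cell 8 (NV 22)))) Noop"

definition search :: "nat \<Rightarrow> rexp \<Rightarrow> prog \<Rightarrow> prog" where
  "search K init pr = rsetv 6 init ;; For 22 (Some K) (NSet 28 (NV 22) (Lit 0) (Lit 0)) ;;
     nest K (pr ;; record_best K)"

lemma copy_tuple:
  assumes "a \<noteq> b" "a \<noteq> 22" "b \<noteq> 22"
  shows "tuple K (nmem (den (For 22 (Some K) (NSet b (NV 22) (Lit 0) (cell a (NV 22)))) s) b) = tuple K (nmem s a)"
proof -
  define f where "f = den (NSet b (NV 22) (Lit 0) (cell a (NV 22)))"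
  have "(\<forall>j<K. nmem (loop f 22 K s) b j 0 = nmem s a j 0) \<and> nmem (loop f 22 K s) a = nmem s a"
    by (rule loop_rule[where I = "\<lambda>i t. (\<forall>j<i. nmem t b j 0 = nmem s a j 0) \<and> nmem t a = nmem s a"])
      (use assms in \<open>auto simp: f_def nmem_nset nmem_nset_other less_Suc_eq\<close>)
  then show ?thesis by (auto simp: tuple_def f_def)
qed

lemma zero_tuple:
  assumes "b \<noteq> 22"
  shows "tuple K (nmem (den (For 22 (Some K) (NSet b (NV 22) (Lit 0) (Lit 0))) s) b) = replicate K 0"
proof -
  define f where "f = den (NSet b (NV 22) (Lit 0) (Lit 0))"
  have "(\<forall>j<K. nmem (loop f 22 K s) b j 0 = 0)"
    by (rule loop_rule[where I = "\<lambda>i t. (\<forall>j<i. nmem t b j 0 = 0)"])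
      (use assms in \<open>auto simp: f_def nmem_nset less_Suc_eq\<close>)
  then show ?thesis by (auto simp: f_def intro!: nth_equalityI)
qed

context cvrp
begin

text \<open>The score is required in every state agreeing with \<open>s0\<close> outside the written
  arrays, since earlier tuples leave scratch values behind. The all-zero tuple goes with the case
  that no score exceeded \<open>init\<close>.\<close>

lemma search_spec:
  assumes K: "0 < K" and s0: "nmem s0 0 0 0 = n"
    and pr: "nwrites pr \<inter> {0, 8, 28} = {}" "6 \<notin> rwrites pr"
    and score: "\<And>s. (\<And>a. a \<notin> nwrites (search K init pr) \<Longrightarrow> nmem s a = nmem s0 a) \<Longrightarrow>
       (\<And>a. a \<notin> rwrites (search K init pr) \<Longrightarrow> rmem s a = rmem s0 a) \<Longrightarrow>
       (\<And>i. i < K \<Longrightarrow> nmem s 8 i 0 \<le> n) \<Longrightarrow> rmem (den pr s) 5 0 0 = f (tuple K (nmem s 8))"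
  defines "s' \<equiv> den (search K init pr) s0"
  defines "best \<equiv> rmem s' 6 0 0" and "bx \<equiv> tuple K (nmem s' 28)"
  shows "set bx \<subseteq> {..n}" "\<And>x. length x = K \<Longrightarrow> set x \<subseteq> {..n} \<Longrightarrow> f x \<le> best"
    "best = rval init s0 \<and> bx = replicate K 0 \<or> best = f bx \<and> rval init s0 < best"
proof -
  define P where "P = search K init pr"
  have writes: "8 \<in> nwrites P" "28 \<in> nwrites P" "22 \<in> nwrites P" "6 \<in> rwrites P"
    "{100..<100 + K} \<subseteq> nwrites P" "nwrites pr \<subseteq> nwrites P" "rwrites pr \<subseteq> rwrites P"
    "nwrites (record_best K) \<subseteq> nwrites P" "rwrites (record_best K) \<subseteq> rwrites P" "0 \<notin> nwrites P"
    using K pr by (auto simp: P_def search_def nwrites_nest rwrites_nest record_best_def)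
  define fr where "fr s \<longleftrightarrow> (\<forall>a. a \<notin> nwrites P \<longrightarrow> nmem s a = nmem s0 a) \<and> (\<forall>a. a \<notin> rwrites P \<longrightarrow> rmem s a = rmem s0 a)" for s :: state
  define good where "good x b \<longleftrightarrow> set x \<subseteq> {..n} \<and>
      (b = rval init s0 \<and> x = replicate K 0 \<or> b = f x \<and> rval init s0 < b)" for x b
  define J where "J s \<longleftrightarrow> fr s \<and> good (tuple K (nmem s 28)) (rmem s 6 0 0) \<and> rval init s0 \<le> rmem s 6 0 0" for s :: state
  define Q where "Q x s \<longleftrightarrow> f x \<le> rmem s 6 0 0" for x and s :: state
  define s1 where "s1 = den (rsetv 6 init ;; For 22 (Some K) (NSet 28 (NV 22) (Lit 0) (Lit 0))) s0"
  have s1: "nmem s1 a = nmem s0 a" if "a \<notin> {22, 28}" for a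
    unfolding s1_def using that by (intro nmem_den) auto
  have "rmem s1 = rmem (rset 6 0 0 (rval init s0) s0)"
    unfolding s1_def den.simps(4) by (rule ext) (subst rmem_den; simp)
  then have r1: "rmem s1 6 0 0 = rval init s0" "\<And>a. a \<noteq> 6 \<Longrightarrow> rmem s1 a = rmem s0 a"
    by (simp_all add: rmem_rset rmem_rset_other)
  have t1: "tuple K (nmem s1 28) = replicate K 0"
    unfolding s1_def den.simps(4) by (rule zero_tuple) simp
  have "fr s1"
    unfolding fr_def
  proof (intro conjI allI impI)
    show "nmem s1 a = nmem s0 a" if "a \<notin> nwrites P" for a using that writes by (intro s1) auto
    show "rmem s1 a = rmem s0 a" if "a \<notin> rwrites P" for a using that writes by (intro r1(2)) auto
  qed
  then have J1: "J s1" using t1 r1 by (auto simp: J_def good_def)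
  have body: "J (den (pr ;; record_best K) s) \<and> Q (tuple K (nmem s 8)) (den (pr ;; record_best K) s) \<and>
      (\<forall>x. Q x s \<longrightarrow> Q x (den (pr ;; record_best K) s))"
    if J: "J s" and x: "\<And>i. i < K \<Longrightarrow> nmem s 8 i 0 \<le> n" for s
  proof -
    define t where "t = den pr s"
    have fr_s: "fr s" using J by (simp add: J_def)
    have frt: "fr t" using fr_s writes unfolding fr_def t_def by (metis nmem_den rmem_den subsetD)
    have sc: "rmem t 5 0 0 = f (tuple K (nmem s 8))"
      unfolding t_def using fr_s x by (intro score) (auto simp: fr_def P_def)
    have keep: "nmem t 28 = nmem s 28" "nmem t 8 = nmem s 8" "rmem t 6 = rmem s 6"
      using pr by (auto simp: t_def nmem_den rmem_den)
    have Jt: "J t" using J frt by (simp add: J_def keep)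
    show ?thesis
    proof (cases "rmem t 6 0 0 < rmem t 5 0 0")
      case False
      then have "den (pr ;; record_best K) s = t" by (simp add: record_best_def t_def)
      then show ?thesis using Jt False sc keep by (simp add: Q_def)
    next
      case True
      define u where "u = den (record_best K) t"
      have u_def': "u = den (For 22 (Some K) (NSet 28 (NV 22) (Lit 0) (cell 8 (NV 22)))) (rset 6 0 0 (rmem t 5 0 0) t)"
        using True by (simp add: u_def record_best_def)
      have fru: "fr u" using frt writes unfolding fr_def u_def by (metis nmem_den rmem_den subsetD)
      have "tuple K (nmem u 28) = tuple K (nmem (rset 6 0 0 (rmem t 5 0 0) t) 8)"
        unfolding u_def' by (rule copy_tuple) simp_all
      then have tu: "tuple K (nmem u 28) = tuple K (nmem s 8)" by (simp add: keep)
      have "rmem u = rmem (rset 6 0 0 (rmem t 5 0 0) t)"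
        unfolding u_def' by (rule ext) (subst rmem_den; simp)
      then have ru: "rmem u 6 0 0 = f (tuple K (nmem s 8))" by (simp add: rmem_rset sc)
      have lt: "rmem s 6 0 0 < rmem u 6 0 0" using True sc keep ru by simp
      have "set (tuple K (nmem s 8)) \<subseteq> {..n}" by (rule set_tuple_le) (rule x)
      then have "J u" using fru tu ru lt J by (simp add: J_def good_def)
      then show ?thesis using ru lt by (auto simp: Q_def u_def t_def)
    qed
  qed
  have nest: "J (den (nest K (pr ;; record_best K)) s1) \<and> (\<forall>x. Q x s1 \<longrightarrow> Q x (den (nest K (pr ;; record_best K)) s1)) \<and>
    (\<forall>i\<ge>K. nmem (den (nest K (pr ;; record_best K)) s1) 8 i 0 = nmem s1 8 i 0) \<and>
    (\<forall>x. length x = K \<and> (\<forall>i<K. x ! i \<le> n) \<and> (\<forall>i. K \<le> i \<and> i < K \<longrightarrow> x ! i = nmem s1 8 i 0) \<longrightarrow>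
       Q x (den (nest K (pr ;; record_best K)) s1))"
  proof (rule nest_spec)
    fix s t :: state assume J: "J s" and st: "rmem t = rmem s"
      "\<And>a. a \<noteq> 8 \<Longrightarrow> a \<notin> {100..<100 + K} \<Longrightarrow> nmem t a = nmem s a"
    have "nmem t 28 = nmem s 28" by (rule st(2)) auto
    moreover have "fr t" using J st writes unfolding J_def fr_def by (metis subsetD)
    ultimately show "J t" using J st(1) by (simp add: J_def)
  next
    show "nmem s 0 0 0 = n" if "J s" for s using that s0 writes by (auto simp: J_def fr_def)
  next
    show "8 \<notin> nwrites (pr ;; record_best K)" using pr by (auto simp: record_best_def)
  qed (use body J1 in \<open>auto simp: Q_def\<close>)
  have s': "s' = den (nest K (pr ;; record_best K)) s1" by (simp add: s'_def search_def s1_def)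
  have J': "J s'" using nest by (simp add: s')
  then show "set bx \<subseteq> {..n}" "best = rval init s0 \<and> bx = replicate K 0 \<or> best = f bx \<and> rval init s0 < best"
    by (auto simp: J_def good_def best_def bx_def)
  show "f x \<le> best" if "length x = K" "set x \<subseteq> {..n}" for x
  proof -
    have "\<forall>i<K. x ! i \<le> n" using that nth_mem by fastforce
    then have "Q x s'" using nest that(1) by (simp add: s')
    then show ?thesis by (simp add: Q_def best_def)
  qed
qed

end

subsection \<open>The greedy program\<close>

abbreviation (input) lit :: "nat \<Rightarrow> rexp" where
  "lit m \<equiv> OfNat (Lit m)"

text \<open>Customer \<open>v\<close> can join a tour of load \<open>N23\<close>, where \<open>N[m]\<close> marks the excluded customers and
  only demands above \<open>k / q\<close> are admitted.\<close>

abbreviation (input) can_join :: "nat \<Rightarrow> nat \<Rightarrow> nexp \<Rightarrow> bexp" where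
  "can_join q m v \<equiv>
     Conj (Conj (NLess (Lit 0) v) (NLess (cell m v) (Lit 1)))
       (Conj (RLess (OfNat cap) (RTimes (lit q) (OfNat (cell 1 v))))
         (Neg (NLess cap (NPlus (NV 23) (cell 1 v)))))"

definition greedy_body :: "nat \<Rightarrow> prog" where
  "greedy_body q = setv 27 (cell 8 (NV 22)) ;;
     Ite (can_join q 26 (NV 27))
       (setv 23 (NPlus (NV 23) (cell 1 (NV 27))) ;;
        rsetv 3 (RPlus (RV 3) (RAt 0 (NV 24) (NV 27))) ;;
        rsetv 4 (RPlus (RV 4) (RAt 2 (NV 27) (Lit 0))) ;;
        setv 24 (NV 27) ;; NSet 26 (NV 27) (Lit 0) (Lit 1))
       Noop"

definition greedy_score :: "nat \<Rightarrow> nat \<Rightarrow> prog" where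
  "greedy_score q K = setv 23 (Lit 0) ;; setv 24 (Lit 0) ;; rsetv 3 (lit 0) ;; rsetv 4 (lit 0) ;;
     For 25 None (NSet 26 (NV 25) (Lit 0) (cell 6 (NV 25))) ;;
     For 22 (Some K) (greedy_body q) ;;
     rsetv 5 (RDivide (RV 4) (RPlus (RV 3) (RAt 0 (NV 24) (Lit 0))))"

definition greedy_apply_body :: "nat \<Rightarrow> prog" where
  "greedy_apply_body q = setv 20 (cell 28 (NV 22)) ;;
     Ite (can_join q 6 (NV 20)) (setv 23 (NPlus (NV 23) (cell 1 (NV 20))) ;; push) Noop"

definition greedy_apply :: "nat \<Rightarrow> nat \<Rightarrow> prog" where
  "greedy_apply q K = setv 23 (Lit 0) ;; For 22 (Some K) (greedy_apply_body q) ;; setv 20 (Lit 0) ;; push"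

text \<open>4 c d / k is twice \<open>radial\<close>, and 3 c d / k is 3/2 times
  \<open>radial\<close>.\<close>

definition greedy_weight_body :: prog where
  "greedy_weight_body =
     RSet 2 (NV 21) (Lit 0)
       (RDivide (RTimes (RTimes (lit 4) (RAt 0 (Lit 0) (NV 21))) (OfNat (cell 1 (NV 21)))) (OfNat cap)) ;;
     Ite (Conj (NLess (Lit 0) (NV 42)) (Neg (RLess (OfNat cap) (RTimes (lit 3) (OfNat (cell 1 (NV 21)))))))
       (RSet 2 (NV 21) (Lit 0)
         (RDivide (RTimes (RTimes (lit 3) (RAt 0 (Lit 0) (NV 21))) (OfNat (cell 1 (NV 21)))) (OfNat cap)))
       Noop"

definition greedy_weights :: prog where
  "greedy_weights = For 21 None greedy_weight_body"

text \<open>The search starts at score 1. If no tour has a larger ratio, the all-zero tuple is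
  applied, which admits nobody, so the remaining rounds are idle.\<close>

definition greedy :: "nat \<Rightarrow> nat \<Rightarrow> prog" where
  "greedy q K = greedy_weights ;; For 29 None (search K (lit 1) (greedy_score q K) ;; greedy_apply q K)"

context cvrp
begin

text \<open>Entries that cannot be served are skipped. Thus every tuple yields a tour within
  capacity, and every such tour of admissible customers arises from its own list padded with
  depots.\<close>

definition join :: "nat \<Rightarrow> nat set \<Rightarrow> nat list \<Rightarrow> nat \<Rightarrow> nat list" where
  "join q C ys v = (if 0 < v \<and> v \<notin> C \<and> v \<notin> set ys \<and> k < q * d v \<and> sum_list (map d ys) + d v \<le> k then ys @ [v] else ys)"

definition admitted :: "nat \<Rightarrow> nat set \<Rightarrow> nat list \<Rightarrow> nat list" where
  "admitted q C x = foldl (join q C) [] x"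

lemma admitted_snoc: "i < length x \<Longrightarrow> admitted q C (take (Suc i) x) = join q C (admitted q C (take i x)) (x ! i)"
  by (simp add: admitted_def take_Suc_conv_app_nth)

lemma admitted_props:
  assumes "set x \<subseteq> {..n}"
  shows "distinct (admitted q C x) \<and> set (admitted q C x) \<subseteq> {v \<in> customers n. v \<notin> C \<and> k < q * d v} \<and>
    sum_list (map d (admitted q C x)) \<le> k"
  using assms
proof (induction x rule: rev_induct)
  case (snoc v x)
  have "admitted q C (x @ [v]) = join q C (admitted q C x) v" by (simp add: admitted_def)
  then show ?case using snoc by (auto simp: join_def customers_def)
qed (simp add: admitted_def)

lemma admitted_all:
  assumes "distinct ys" "set ys \<subseteq> {v \<in> customers n. v \<notin> C \<and> k < q * d v}" "sum_list (map d ys) \<le> k"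
  shows "admitted q C (ys @ replicate m 0) = ys"
proof -
  have "admitted q C ys = ys"
    using assms
  proof (induction ys rule: rev_induct)
    case (snoc v ys)
    have "admitted q C (ys @ [v]) = join q C (admitted q C ys) v" by (simp add: admitted_def)
    then show ?case using snoc by (auto simp: join_def customers_def)
  qed (simp add: admitted_def)
  moreover have "foldl (join q C) ys (replicate m 0) = ys" by (induction m) (simp_all add: join_def)
  ultimately show ?thesis by (simp add: admitted_def)
qed

definition ratio :: "(nat \<Rightarrow> real) \<Rightarrow> nat list \<Rightarrow> real" where
  "ratio w ys = sum w (set ys) / tour_cost c ys"

end

context cvrp_tsp
begin

lemma greedy_score_value:
  assumes s: "inputs s" and C: "\<And>v. v \<le> n \<Longrightarrow> nmem s 6 v 0 = of_bool (v \<in> C)"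
    and w: "\<And>v. v \<in> customers n \<Longrightarrow> rmem s 2 v 0 = w v"
    and x: "\<And>i. i < K \<Longrightarrow> nmem s 8 i 0 \<le> n"
  shows "rmem (den (greedy_score q K) s) 5 0 0 = ratio w (admitted q C (tuple K (nmem s 8)))"
proof -
  define X where "X = tuple K (nmem s 8)"
  have X: "set X \<subseteq> {..n}" "length X = K" unfolding X_def using set_tuple_le[of K "nmem s 8" n] x by auto
  define s1 where "s1 = den (setv 23 (Lit 0) ;; setv 24 (Lit 0) ;; rsetv 3 (lit 0) ;; rsetv 4 (lit 0)) s"
  have s1: "inputs s1" using s by (simp add: s1_def inputs_nset inputs_rset)
  define f where "f = den (NSet 26 (NV 25) (Lit 0) (cell 6 (NV 25)))"
  define s2 where "s2 = loop f 25 (Suc n) s1"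
  have s2: "s2 = den (For 25 None (NSet 26 (NV 25) (Lit 0) (cell 6 (NV 25)))) s1"
    using loop_count[OF s1] by (simp add: s2_def f_def)
  have seen: "(\<forall>v<Suc n. nmem s2 26 v 0 = nmem s1 6 v 0) \<and> nmem s2 6 = nmem s1 6"
    unfolding s2_def
    by (rule loop_rule[where I = "\<lambda>i t. (\<forall>v<i. nmem t 26 v 0 = nmem s1 6 v 0) \<and> nmem t 6 = nmem s1 6"])
      (auto simp: f_def nmem_nset nmem_nset_other less_Suc_eq)
  have s2_in: "inputs s2" unfolding s2 by (intro inputs_den s1) auto
  have s2_mem: "nmem s2 23 0 0 = 0" "nmem s2 24 0 0 = 0" "rmem s2 3 0 0 = 0" "rmem s2 4 0 0 = 0"
    "nmem s2 8 = nmem s 8" "rmem s2 2 = rmem s 2"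
    unfolding s2 by (simp_all add: nmem_den rmem_den del: den.simps(6))
      (simp_all add: s1_def nmem_nset rmem_rset nmem_nset_other rmem_rset_other)
  have seen': "nmem s2 26 v 0 = of_bool (v \<in> C)" if "v \<le> n" for v
    using seen that C[OF that] by (simp add: s1_def nmem_nset_other)
  define g where "g = den (greedy_body q)"
  define I where "I i t \<longleftrightarrow> (let ys = admitted q C (take i X) in inputs t \<and>
      nmem t 23 0 0 = sum_list (map d ys) \<and> nmem t 24 0 0 = last (0 # ys) \<and>
      rmem t 3 0 0 = walk_cost c 0 ys \<and> rmem t 4 0 0 = sum w (set ys) \<and>
      (\<forall>v\<le>n. nmem t 26 v 0 = of_bool (v \<in> C \<union> set ys)) \<and> nmem t 8 = nmem s 8 \<and> rmem t 2 = rmem s 2)" for i t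
  have "I K (loop g 22 K s2)"
  proof (rule loop_rule)
    show "I 0 (nset 22 0 0 0 s2)"
      using s2_in s2_mem seen' by (simp add: I_def admitted_def Let_def inputs_nset nmem_nset nmem_nset_other)
  next
    fix i t assume i: "i < K" "nmem t 22 0 0 = i" and I: "I i t"
    define ys where "ys = admitted q C (take i X)"
    have t: "inputs t" "nmem t 23 0 0 = sum_list (map d ys)" "nmem t 24 0 0 = last (0 # ys)"
      "rmem t 3 0 0 = walk_cost c 0 ys" "rmem t 4 0 0 = sum w (set ys)"
      "\<And>v. v \<le> n \<Longrightarrow> nmem t 26 v 0 = of_bool (v \<in> C \<union> set ys)" "nmem t 8 = nmem s 8" "rmem t 2 = rmem s 2"
      using I by (simp_all add: I_def ys_def Let_def)
    have ys: "distinct ys" "set ys \<subseteq> customers n"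
      using admitted_props[of "take i X" q C] X set_take_subset[of i X] by (auto simp: ys_def)
    have last: "last (0 # ys) \<in> vertices n"
      using ys last_in_set[of "0 # ys"] customer_vertex by auto
    define v where "v = X ! i"
    have v: "v \<le> n" "nmem t 8 i 0 = v" using x[OF i(1)] i by (simp_all add: v_def X_def t)
    define t1 where "t1 = nset 27 0 0 v t"
    have t1: "inputs t1" using t by (simp add: t1_def inputs_nset)
    have join: "admitted q C (take (Suc i) X) = join q C ys v"
      using i X by (simp add: admitted_snoc ys_def v_def)
    have g: "g t = (if bval (can_join q 26 (NV 27)) t1 then
       nset 26 v 0 1 (nset 24 0 0 v (rset 4 0 0 (rmem t 4 0 0 + rmem t 2 v 0)
         (rset 3 0 0 (rmem t 3 0 0 + rmem t 0 (nmem t 24 0 0) v) (nset 23 0 0 (nmem t 23 0 0 + nmem t 1 v 0) t1)))) else t1)"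
      by (simp add: g_def greedy_body_def t1_def v i nmem_nset rmem_rset)
    have cond: "bval (can_join q 26 (NV 27)) t1 \<longleftrightarrow> 0 < v \<and> v \<notin> C \<and> v \<notin> set ys \<and> k < q * d v \<and> sum_list (map d ys) + d v \<le> k"
    proof (cases "0 < v")
      case True
      then have "nmem t 1 v 0 = d v" using v inputsD(3)[OF t(1), of v] by (simp add: customers_iff)
      moreover have "real k < real q * real (d v) \<longleftrightarrow> k < q * d v" by (simp flip: of_nat_mult)
      ultimately show ?thesis
        using True v t(6)[of v] inputsD(1,2)[OF t(1)] t(2) by (auto simp: t1_def nmem_nset)
    qed (simp add: t1_def nmem_nset)
    have gF: "g t = t1" if "\<not> bval (can_join q 26 (NV 27)) t1" using g that by (simp only: if_False)
    show "I (Suc i) (nset 22 0 0 (Suc i) (g t))"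
    proof (cases "bval (can_join q 26 (NV 27)) t1")
      case False
      then have "join q C ys v = ys" using cond by (auto simp: join_def)
      then show ?thesis
        using t t1 unfolding I_def join gF[OF False]
        by (simp add: Let_def inputs_nset nmem_nset nmem_nset_other t1_def)
    next
      case True
      then have v': "join q C ys v = ys @ [v]" "v \<in> customers n" "v \<notin> set ys"
        using cond v by (auto simp: join_def customers_iff)
      have gT: "g t = nset 26 v 0 1 (nset 24 0 0 v (rset 4 0 0 (rmem t 4 0 0 + rmem t 2 v 0)
         (rset 3 0 0 (rmem t 3 0 0 + rmem t 0 (nmem t 24 0 0) v) (nset 23 0 0 (nmem t 23 0 0 + nmem t 1 v 0) t1))))"
        using g True by (simp only: if_True)
      have "rmem t 0 (last (0 # ys)) v = c (last (0 # ys)) v" "nmem t 1 v 0 = d v" "rmem t 2 v 0 = w v"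
        using inputsD(5)[OF t(1) last customer_vertex[OF v'(2)]] inputsD(3)[OF t(1) v'(2)] w[OF v'(2)] t(8) by simp_all
      then show ?thesis
        using t t1 v' unfolding I_def join gT v'(1)
        by (auto simp: Let_def inputs_nset inputs_rset nmem_nset nmem_nset_other rmem_rset rmem_rset_other walk_cost_snoc t1_def)
    qed
  qed
  then have fin: "rmem (loop g 22 K s2) 3 0 0 = walk_cost c 0 (admitted q C X)"
    "rmem (loop g 22 K s2) 4 0 0 = sum w (set (admitted q C X))"
    "nmem (loop g 22 K s2) 24 0 0 = last (0 # admitted q C X)" "inputs (loop g 22 K s2)"
    using X(2) by (simp_all add: I_def Let_def)
  have "last (0 # admitted q C X) \<in> vertices n"
    using admitted_props[OF X(1), of q C] last_in_set[of "0 # admitted q C X"] customer_vertex by auto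
  then have "rmem (loop g 22 K s2) 0 (last (0 # admitted q C X)) 0 = c (last (0 # admitted q C X)) 0"
    using inputsD(5)[OF fin(4)] by simp
  moreover have "den (greedy_score q K) s = den (rsetv 5 (RDivide (RV 4) (RPlus (RV 3) (RAt 0 (NV 24) (Lit 0))))) (loop g 22 K s2)"
    by (simp add: greedy_score_def s2 g_def s1_def)
  ultimately show ?thesis
    using fin by (simp add: rmem_rset ratio_def tour_cost_eq_path walk_cost_snoc X_def)
qed

lemma greedy_apply_buffer:
  fixes q K :: nat
  assumes s: "inputs s" "buffer s D []" and x: "set (tuple K (nmem s 28)) \<subseteq> {..n}"
  defines "ys \<equiv> admitted q (served D) (tuple K (nmem s 28))"
  shows "buffer (den (greedy_apply q K) s) (if ys = [] then D else D @ [ys]) []"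
proof -
  define X where "X = tuple K (nmem s 28)"
  have X: "set X \<subseteq> {..n}" "length X = K" using x by (simp_all add: X_def)
  define s1 where "s1 = nset 23 0 0 0 s"
  have s1: "inputs s1" "buffer s1 D []" "nmem s1 28 = nmem s 28"
    using s by (simp_all add: s1_def inputs_nset buffer_nset nmem_nset_other)
  define g where "g = den (greedy_apply_body q)"
  define I where "I i t \<longleftrightarrow> (let ys = admitted q (served D) (take i X) in inputs t \<and>
      buffer t D ys \<and> nmem t 23 0 0 = sum_list (map d ys) \<and> nmem t 28 = nmem s 28)" for i t
  have fin: "I K (loop g 22 K s1)"
  proof (rule loop_rule)
    show "I 0 (nset 22 0 0 0 s1)"
      using s1 by (simp add: I_def admitted_def Let_def inputs_nset buffer_nset nmem_nset nmem_nset_other s1_def)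
  next
    fix i t assume i: "i < K" "nmem t 22 0 0 = i" and I: "I i t"
    define ys where "ys = admitted q (served D) (take i X)"
    have t: "inputs t" "buffer t D ys" "nmem t 23 0 0 = sum_list (map d ys)" "nmem t 28 = nmem s 28"
      using I by (simp_all add: I_def ys_def Let_def)
    define v where "v = X ! i"
    have "X ! i \<in> set X" using i X by simp
    then have v: "v \<le> n" "nmem t 28 i 0 = v" using X i by (auto simp: v_def X_def t)
    define t1 where "t1 = nset 20 0 0 v t"
    have t1: "inputs t1" "buffer t1 D ys" using t by (simp_all add: t1_def inputs_nset buffer_nset)
    have join: "admitted q (served D) (take (Suc i) X) = join q (served D) ys v"
      using i X by (simp add: admitted_snoc ys_def v_def)
    define t2 where "t2 = nset 23 0 0 (nmem t 23 0 0 + nmem t 1 v 0) t1"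
    have g: "g t = (if bval (can_join q 6 (NV 20)) t1 then den push t2 else t1)"
      by (simp add: g_def greedy_apply_body_def t1_def t2_def v i nmem_nset)
    have cond: "bval (can_join q 6 (NV 20)) t1 \<longleftrightarrow>
      0 < v \<and> v \<notin> served D \<and> v \<notin> set ys \<and> k < q * d v \<and> sum_list (map d ys) + d v \<le> k"
    proof (cases "0 < v")
      case True
      then have "nmem t 1 v 0 = d v" using v inputsD(3)[OF t(1), of v] by (simp add: customers_iff)
      moreover have "real k < real q * real (d v) \<longleftrightarrow> k < q * d v" by (simp flip: of_nat_mult)
      ultimately show ?thesis
        using True v buffer_served[OF t(2) v(1)] inputsD(1,2)[OF t(1)] t(3) by (auto simp: t1_def nmem_nset)
    qed (simp add: t1_def nmem_nset)
    have gF: "g t = t1" if "\<not> bval (can_join q 6 (NV 20)) t1" using g that by (simp only: if_False)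
    show "I (Suc i) (nset 22 0 0 (Suc i) (g t))"
    proof (cases "bval (can_join q 6 (NV 20)) t1")
      case False
      then have "join q (served D) ys v = ys" using cond by (auto simp: join_def)
      then show ?thesis
        using t t1 unfolding I_def join gF[OF False]
        by (simp add: Let_def inputs_nset buffer_nset nmem_nset nmem_nset_other t1_def)
    next
      case True
      then have v': "join q (served D) ys v = ys @ [v]" "v \<in> customers n" "v \<notin> served D \<union> set ys"
        using cond v by (auto simp: join_def customers_iff)
      have gT: "g t = den push t2" using g True by (simp only: if_True)
      have t2: "inputs t2" "buffer t2 D ys" "nmem t2 20 0 0 = v"
        using t1 by (simp_all add: t2_def inputs_nset buffer_nset nmem_nset t1_def)
      have "buffer (den push t2) D (ys @ [v])" by (rule push_customer[OF t2 v'(2,3)])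
      moreover have "nmem (den push t2) 23 = nmem t2 23" "nmem (den push t2) 28 = nmem t2 28"
        by (simp_all add: nmem_den nwrites_push)
      moreover have "nmem t2 23 0 0 = sum_list (map d (ys @ [v]))"
        using t(3) inputsD(3)[OF t(1) v'(2)] by (simp add: t2_def nmem_nset)
      moreover have "nmem t2 28 = nmem s 28" using t by (simp add: t2_def t1_def nmem_nset_other)
      ultimately show ?thesis
        using inputs_push[OF t2(1)] unfolding I_def join gT v'(1)
        by (simp add: Let_def inputs_nset buffer_nset nmem_nset_other del: map_append)
    qed
  qed
  define s3 where "s3 = nset 20 0 0 0 (loop g 22 K s1)"
  have s3: "inputs s3" "buffer s3 D ys" "nmem s3 20 0 0 = 0"
    using fin X by (simp_all add: I_def Let_def s3_def inputs_nset buffer_nset nmem_nset ys_def X_def)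
  have "den (greedy_apply q K) s = den push s3"
    by (simp add: greedy_apply_def s3_def g_def s1_def)
  then show ?thesis using push_depot[OF s3] by simp
qed

end

lemma nwrites_greedy_score: "nwrites (greedy_score q K) = {22, 23, 24, 25, 26, 27}"
  and rwrites_greedy_score: "rwrites (greedy_score q K) = {3, 4, 5}"
  by (auto simp: greedy_score_def greedy_body_def)

lemma nwrites_search: "0 < K \<Longrightarrow> nwrites (search K i p) = nwrites p \<union> {8, 22, 28} \<union> {100..<100 + K}"
  and rwrites_search: "rwrites (search K i p) = insert 6 (rwrites p)"
  by (auto simp: search_def record_best_def nwrites_nest rwrites_nest)

lemma nwrites_greedy_apply: "nwrites (greedy_apply q K) = {6, 7, 13, 14, 15, 20, 22, 23}"
  and rwrites_greedy_apply: "rwrites (greedy_apply q K) = {1}"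
  by (auto simp: greedy_apply_def greedy_apply_body_def push_def)

lemma nwrites_greedy_weights: "nwrites greedy_weights = {21}"
  and rwrites_greedy_weights: "rwrites greedy_weights = {2}"
  by (auto simp: greedy_weights_def greedy_weight_body_def)

context cvrp
begin

definition penalty :: "nat \<Rightarrow> nat \<Rightarrow> real" where
  "penalty m v = (if m = 0 \<or> k < 3 * d v then 2 else 3 / 2) * radial v"

lemma penalty_nonneg: "v \<in> customers n \<Longrightarrow> 0 \<le> penalty m v"
  by (simp add: penalty_def radial_nonneg)

definition big :: "nat \<Rightarrow> nat set" where
  "big q = {v \<in> customers n. k < q * d v}"

lemma finite_big [simp]: "finite (big q)"
  by (rule finite_subset[OF _ finite_customers]) (auto simp: big_def)

text \<open>Demands above k / q leave room for at most q customers, so tuples of length q represent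
  all tours the greedy program has to consider.\<close>

lemma length_le_of_big:
  assumes "\<forall>v\<in>set ys. k < q * d v" "sum_list (map d ys) \<le> k"
  shows "length ys \<le> q"
proof -
  have "length ys * k \<le> q * sum_list (map d ys)"
    using assms(1) by (induction ys) (auto simp: algebra_simps)
  also have "\<dots> \<le> q * k" using assms(2) by simp
  finally show ?thesis using k_pos by simp
qed

text \<open>As x / 0 = 0, a free tour has ratio 0 and is never chosen. It only visits customers at
  distance 0 from the depot, whose penalties vanish too.\<close>

lemma zero_tour_cost:
  assumes "tour_cost c ys = 0" "set ys \<subseteq> customers n" "v \<in> set ys"
  shows "penalty m v = 0"
proof -
  have "2 * c 0 v \<le> 0" using radius_le_tour_cost[OF assms(3,2)] assms(1) by simp
  moreover have "0 \<le> c 0 v" using assms(2,3) customer_vertex by (intro cost_nonneg) auto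
  ultimately show ?thesis by (simp add: penalty_def radial_def)
qed

text \<open>If no tour covers more than r times its cost, neither does any tour of the given
  solution, shortcut to the uncovered customers. This supplies the premise \<open>W <= r * M\<close>
  of \<open>greedy_step\<close>.\<close>

lemma uncovered_bound:
  assumes feas: "feasible n k d S a" and K: "q \<le> K" and r: "0 \<le> r"
    and max: "\<And>x. length x = K \<Longrightarrow> set x \<subseteq> {..n} \<Longrightarrow> ratio (penalty m) (admitted q C x) \<le> r"
  shows "sum (penalty m) (big q - C) \<le> r * solution_cost c S"
proof (rule covering_bound[OF feas _ r])
  show "big q - C \<subseteq> customers n" by (auto simp: big_def)
  fix ys assume ys: "distinct ys" "set ys \<subseteq> big q - C" "sum d (set ys) \<le> k"
  then have cust: "set ys \<subseteq> customers n" by (auto simp: big_def)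
  have load: "sum_list (map d ys) \<le> k" using ys by (simp add: sum_list_distinct_conv_sum_set)
  have "length ys \<le> q" using ys(2) load by (intro length_le_of_big) (auto simp: big_def)
  define x where "x = ys @ replicate (K - length ys) 0"
  have "admitted q C x = ys"
    unfolding x_def using ys load by (intro admitted_all) (auto simp: big_def)
  moreover have "length x = K" using \<open>length ys \<le> q\<close> K by (simp add: x_def)
  moreover have "set x \<subseteq> {..n}" using cust by (auto simp: x_def customers_def)
  ultimately have rat: "ratio (penalty m) ys \<le> r" using max[of x] by simp
  show "sum (penalty m) (set ys) \<le> r * tour_cost c ys"
  proof (cases "tour_cost c ys = 0")
    case True
    then have "sum (penalty m) (set ys) = 0" using zero_tour_cost[OF True cust] by (intro sum.neutral) auto
    then show ?thesis using True by simp
  next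
    case False
    have "0 \<le> tour_cost c ys" using cust customer_vertex by (intro tour_cost_nonneg) auto
    then show ?thesis using rat False by (simp add: ratio_def field_simps)
  qed
qed

end

context cvrp_tsp
begin

lemma inputs_cong:
  assumes "inputs s" "nmem s' 0 = nmem s 0" "nmem s' 1 = nmem s 1" "nmem s' 2 = nmem s 2" "rmem s' 0 = rmem s 0"
  shows "inputs s'"
  using assms unfolding inputs_def by metis

lemma greedy_weights_value:
  assumes s: "inputs s" and v: "v \<in> customers n"
  shows "rmem (den greedy_weights s) 2 v 0 = penalty (nmem s 42 0 0) v"
proof -
  define m where "m = nmem s 42 0 0"
  define p where "p = greedy_weight_body"
  have p: "greedy_weights = For 21 None p" "nwrites p = {}" "rwrites p = {2}"
    by (simp_all add: greedy_weights_def p_def greedy_weight_body_def)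
  define I where "I i t \<longleftrightarrow> inputs t \<and> nmem t 42 0 0 = m \<and>
      (\<forall>v\<in>customers n. v < i \<longrightarrow> rmem t 2 v 0 = penalty m v)" for i t
  have "I (Suc n) (loop (den p) 21 (Suc n) s)"
  proof (rule loop_rule)
    show "I 0 (nset 21 0 0 0 s)" using s by (simp add: I_def inputs_nset nmem_nset m_def)
  next
    fix i t assume i: "i < Suc n" "nmem t 21 0 0 = i" and I: "I i t"
    have t: "inputs t" "nmem t 42 0 0 = m" using I by (simp_all add: I_def)
    have in': "inputs (den p t)" by (intro inputs_den t) (simp_all add: p)
    have other: "rmem (den p t) 2 v 0 = rmem t 2 v 0" if "v < i" for v
      using that i by (simp add: p_def greedy_weight_body_def rmem_rset)
    have "rmem (den p t) 2 i 0 = penalty m i" if ic: "i \<in> customers n"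
    proof -
      have c: "rmem t 0 0 i = c 0 i" "nmem t 1 i 0 = d i" "nmem t 0 0 1 = k"
        using inputsD(5)[OF t(1) depot_vertex customer_vertex[OF ic]] inputsD(2,3)[OF t(1)] ic by simp_all
      have "real k < 3 * real (d i) \<longleftrightarrow> k < 3 * d i" by linarith
      then show ?thesis
        using c t(2) i by (simp add: p_def greedy_weight_body_def rmem_rset penalty_def radial_def)
    qed
    then show "I (Suc i) (nset 21 0 0 (Suc i) (den p t))"
      using I in' other p by (auto simp: I_def inputs_nset nmem_nset nmem_den less_Suc_eq)
  qed
  then show ?thesis
    using v loop_count[OF s] by (simp add: I_def p(1) m_def customers_iff)
qed

text \<open>Cost plus potential never increases. Once the remaining penalty is at most
  \<open>M\<close> it stays so; before that, a round either serves a new customer or finds no ratio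
  above 1, and then \<open>uncovered_bound\<close> with r = 1 gives W <= M. Since n + 1 customers
  cannot be served, n + 1 rounds suffice, and for W <= M the potential is the remaining penalty
  itself.\<close>

lemma greedy_spec:
  assumes s: "inputs s" "buffer s [] []"
    and feas: "feasible n k d S a" and M: "0 < M" "solution_cost c S \<le> M"
    and K: "0 < q" "q \<le> K"
  defines "m \<equiv> nmem s 42 0 0"
  obtains D where "buffer (den (greedy q K) s) D []" "valid_tours D" "served D \<subseteq> big q"
    "tours_cost D + sum (penalty m) (big q - served D) \<le> greedy_potential M (sum (penalty m) (big q))"
proof -
  define p where "p = (search K (lit 1) (greedy_score q K) ;; greedy_apply q K)"
  define s1 where "s1 = den greedy_weights s"
  have s1: "inputs s1" "buffer s1 [] []"
    using s unfolding s1_def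
    by (intro inputs_den buffer_den; simp add: nwrites_greedy_weights rwrites_greedy_weights)+
  have w1: "rmem s1 2 v 0 = penalty m v" if "v \<in> customers n" for v
    unfolding s1_def m_def by (rule greedy_weights_value[OF s(1) that])
  define W where "W D = sum (penalty m) (big q - served D)" for D
  define I where "I i t \<longleftrightarrow> inputs t \<and> (\<forall>v\<in>customers n. rmem t 2 v 0 = penalty m v) \<and>
    (\<exists>D. buffer t D [] \<and> valid_tours D \<and> served D \<subseteq> big q \<and>
      tours_cost D + greedy_potential M (W D) \<le> greedy_potential M (W []) \<and>
      (i \<le> card (served D) \<or> W D \<le> M))" for i t
  have "I (Suc n) (loop (den p) 29 (Suc n) s1)"
  proof (rule loop_rule)
    show "I 0 (nset 29 0 0 0 s1)"
      using s1 w1 unfolding I_def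
      by (auto intro!: exI[of _ "[]"] inputs_nset buffer_nset simp: valid_tours_def tours_cost_def)
  next
    fix i t assume i: "i < Suc n" "nmem t 29 0 0 = i" and I: "I i t"
    then obtain D where t: "inputs t" "\<And>v. v \<in> customers n \<Longrightarrow> rmem t 2 v 0 = penalty m v"
      and D: "buffer t D []" "valid_tours D" "served D \<subseteq> big q"
        "tours_cost D + greedy_potential M (W D) \<le> greedy_potential M (W [])"
        "i \<le> card (served D) \<or> W D \<le> M"
      by (auto simp: I_def)
    define P where "P = search K (lit 1) (greedy_score q K)"
    define u where "u = den P t"
    define r where "r = rmem u 6 0 0"
    define bx where "bx = tuple K (nmem u 28)"
    define f where "f x = ratio (penalty m) (admitted q (served D) x)" for x
    have K0: "0 < K" using K by simp
    have wP: "nwrites P = {8, 22, 23, 24, 25, 26, 27, 28} \<union> {100..<100 + K}" "rwrites P = {3, 4, 5, 6}"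
      using K0 by (auto simp: P_def nwrites_search rwrites_search nwrites_greedy_score rwrites_greedy_score)
    have score: "rmem (den (greedy_score q K) z) 5 0 0 = f (tuple K (nmem z 8))"
      if "\<And>a. a \<notin> nwrites P \<Longrightarrow> nmem z a = nmem t a" "\<And>a. a \<notin> rwrites P \<Longrightarrow> rmem z a = rmem t a"
        "\<And>i. i < K \<Longrightarrow> nmem z 8 i 0 \<le> n" for z
      unfolding f_def
    proof (rule greedy_score_value)
      show "inputs z" by (rule inputs_cong[OF t(1)]) (intro that; simp add: wP)+
      have "nmem z 6 = nmem t 6" by (rule that) (simp add: wP)
      then show "nmem z 6 v 0 = of_bool (v \<in> served D)" if "v \<le> n" for v
        using buffer_served[OF D(1) that] by simp
      have "rmem z 2 = rmem t 2" by (rule that) (simp add: wP)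
      then show "rmem z 2 v 0 = penalty m v" if "v \<in> customers n" for v using t(2)[OF that] by simp
    qed (rule that(3))
    have zero: "nmem t 0 0 0 = n" by (rule inputsD(1)[OF t(1)])
    have frame: "nwrites (greedy_score q K) \<inter> {0, 8, 28} = {}" "6 \<notin> rwrites (greedy_score q K)"
      by (simp_all add: nwrites_greedy_score rwrites_greedy_score)
    note score' = score[unfolded P_def]
    have bx: "set bx \<subseteq> {..n}"
      unfolding bx_def u_def P_def by (rule search_spec(1)[where f = f, OF K0 zero frame]) (rule score')
    have max: "f x \<le> r" if "length x = K" "set x \<subseteq> {..n}" for x
      unfolding r_def u_def P_def by (rule search_spec(2)[where f = f, OF K0 zero frame _ that]) (rule score')
    have "r = rval (lit 1) t \<and> bx = replicate K 0 \<or> r = f bx \<and> rval (lit 1) t < r"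
      unfolding r_def bx_def u_def P_def
      by (rule search_spec(3)[where f = f, OF K0 zero frame]) (rule score')
    then have r: "r = 1 \<and> bx = replicate K 0 \<or> r = f bx \<and> 1 < r" by simp
    have u: "inputs u" "buffer u D []" "rmem u 2 = rmem t 2"
    proof -
      show "inputs u" unfolding u_def by (rule inputs_den[OF t(1)]) (simp_all add: wP)
      show "buffer u D []" unfolding u_def by (rule buffer_den[OF D(1)]) (simp_all add: wP)
      show "rmem u 2 = rmem t 2" unfolding u_def by (rule rmem_den) (simp add: wP)
    qed
    define ys where "ys = admitted q (served D) bx"
    define D' where "D' = (if ys = [] then D else D @ [ys])"
    define z where "z = den (greedy_apply q K) u"
    have z: "buffer z D' []"
      unfolding z_def D'_def ys_def bx_def by (rule greedy_apply_buffer[OF u(1,2)]) (rule bx[unfolded bx_def])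
    have z2: "inputs z" "rmem z 2 = rmem t 2"
    proof -
      show "inputs z" unfolding z_def
        by (rule inputs_den[OF u(1)]) (simp_all add: nwrites_greedy_apply rwrites_greedy_apply)
      have "rmem z 2 = rmem u 2" unfolding z_def by (rule rmem_den) (simp add: rwrites_greedy_apply)
      then show "rmem z 2 = rmem t 2" by (simp add: u(3))
    qed
    have r1: "1 \<le> r" using r by auto
    have "sum (penalty m) (big q - served D) \<le> r * solution_cost c S"
      using max r1 unfolding f_def by (intro uncovered_bound[OF feas K(2)]) auto
    also have "\<dots> \<le> r * M" using r1 M by (intro mult_left_mono) auto
    finally have WM: "W D \<le> r * M" by (simp add: W_def)
    have ys: "distinct ys" "set ys \<subseteq> big q - served D" "sum_list (map d ys) \<le> k"
      using admitted_props[OF bx, of q "served D"] by (auto simp: ys_def big_def)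
    have goal: "valid_tours D' \<and> served D' \<subseteq> big q \<and>
      tours_cost D' + greedy_potential M (W D') \<le> greedy_potential M (W []) \<and>
      (Suc i \<le> card (served D') \<or> W D' \<le> M)"
    proof (cases "r = 1 \<and> bx = replicate K 0")
      case True
      then have "ys = []" using admitted_all[of "[]" "served D" q K] by (simp add: ys_def)
      then show ?thesis using D True WM by (simp add: D'_def)
    next
      case False
      then have rf: "r = ratio (penalty m) ys" "1 < r" using r by (auto simp: f_def ys_def)
      have ne: "ys \<noteq> []" using rf by (auto simp: ratio_def)
      have "sum (penalty m) (set ys) = r * tour_cost c ys" using rf by (auto simp: ratio_def)
      moreover have Wd: "W D' = W D - sum (penalty m) (set ys)"
      proof -
        have "big q - served D' = (big q - served D) - set ys" using ne by (auto simp: D'_def)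
        then show ?thesis using ys(2) by (simp add: W_def sum_diff)
      qed
      moreover have "0 \<le> W D'" using penalty_nonneg unfolding W_def by (intro sum_nonneg) (auto simp: big_def)
      moreover have "0 \<le> sum (penalty m) (set ys)" using penalty_nonneg ys(2) by (intro sum_nonneg) (auto simp: big_def)
      ultimately have "tour_cost c ys + greedy_potential M (W D') \<le> greedy_potential M (W D)"
        using M(1) r1 WM by (intro greedy_step[of M _ _ r]) auto
      then have "tours_cost D' + greedy_potential M (W D') \<le> greedy_potential M (W [])"
        using D(4) ne by (simp add: D'_def tours_cost_snoc)
      moreover have "valid_tours D'" "served D' \<subseteq> big q"
        using ne D ys unfolding valid_tours_def D'_def by (auto simp: big_def)
      moreover have "Suc i \<le> card (served D') \<or> W D' \<le> M"
      proof (cases "W D \<le> M")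
        case True
        then show ?thesis using Wd \<open>0 \<le> sum (penalty m) (set ys)\<close> by simp
      next
        case False
        have "served D' = served D \<union> set ys" using ne by (auto simp: D'_def)
        moreover have "card (served D \<union> set ys) = card (served D) + card (set ys)"
          using ys(2) by (intro card_Un_disjoint) auto
        moreover have "0 < card (set ys)" using ne by (simp add: card_gt_0_iff)
        ultimately show ?thesis using False D(5) by simp
      qed
      ultimately show ?thesis by blast
    qed
    have "den p t = z" by (simp add: p_def z_def u_def P_def)
    then show "I (Suc i) (nset 29 0 0 (Suc i) (den p t))"
      unfolding I_def using z z2 goal t(2) by (auto intro!: exI[of _ D'] inputs_nset buffer_nset)
  qed
  moreover have "den (greedy q K) s = loop (den p) 29 (Suc n) s1"
    using loop_count[OF s1(1)] by (simp add: greedy_def p_def s1_def)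
  ultimately obtain D where D: "buffer (den (greedy q K) s) D []" "valid_tours D" "served D \<subseteq> big q"
        "tours_cost D + greedy_potential M (W D) \<le> greedy_potential M (W [])"
        "Suc n \<le> card (served D) \<or> W D \<le> M"
    by (auto simp: I_def)
  have "card (served D) \<le> card (customers n)"
    using D(2) by (intro card_mono) (auto simp: valid_tours_def)
  then have "W D \<le> M" using D(5) by (simp add: customers_def)
  then have "greedy_potential M (W D) = W D" using M(1) by (simp add: greedy_potential_def greedy_bound_def)
  then show ?thesis using that[OF D(1-3)] D(4) by (simp add: W_def)
qed

end

subsection \<open>The matching program\<close>

text \<open>The triple of the demand is a sum, as naturals cannot be multiplied.\<close>

abbreviation (input) is_large :: "nexp \<Rightarrow> bexp" where
  "is_large v \<equiv> Conj (NLess (Lit 0) v) (NLess cap (NPlus (cell 1 v) (NPlus (cell 1 v) (cell 1 v))))"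

abbreviation (input) is_neq :: "nexp \<Rightarrow> nexp \<Rightarrow> bexp" where
  "is_neq u v \<equiv> Neg (Conj (Neg (NLess u v)) (Neg (NLess v u)))"

definition link_prog :: "nat \<Rightarrow> prog" where
  "link_prog a =
     Ite (Conj (Conj (is_large (NV 32)) (is_large (NV 33)))
           (Conj (is_neq (NV 32) (NV 33)) (Neg (NLess cap (NPlus (cell 1 (NV 32)) (cell 1 (NV 33)))))))
       (NSet a (cell a (NV 32)) (Lit 0) (cell a (NV 32)) ;;
        NSet a (cell a (NV 33)) (Lit 0) (cell a (NV 33)) ;;
        NSet a (NV 32) (Lit 0) (NV 33) ;; NSet a (NV 33) (Lit 0) (NV 32))
       Noop"

text \<open>Links the pairs in cells \<open>2 i\<close> and \<open>2 i + 1\<close> of \<open>N[b]\<close> in the pairing \<open>N[a]\<close>.\<close>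

definition link_all :: "nat \<Rightarrow> nat \<Rightarrow> nat \<Rightarrow> prog" where
  "link_all p a b = For 22 (Some p)
     (setv 32 (cell b (NPlus (NV 22) (NV 22))) ;;
      setv 33 (cell b (NPlus (NV 22) (NPlus (NV 22) (Lit 1)))) ;; link_prog a)"

definition saving_body :: prog where
  "saving_body = Ite (Conj (is_large (NV 25)) (is_neq (NV 25) (cell 31 (NV 25))))
     (rsetv 5 (RPlus (RV 5) (RMinus (RPlus (RAt 0 (Lit 0) (NV 25)) (RAt 0 (Lit 0) (cell 31 (NV 25))))
        (RAt 0 (NV 25) (cell 31 (NV 25))))))
     Noop"

definition match_score :: "nat \<Rightarrow> prog" where
  "match_score p = For 25 None (NSet 31 (NV 25) (Lit 0) (cell 30 (NV 25))) ;;
     link_all p 31 8 ;; rsetv 5 (lit 0) ;; For 25 None saving_body"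

text \<open>The initial score -1 lies below every total saving, so some move is always recorded.
  Moves are scored on the copy \<open>N31\<close> of the pairing; the best one is applied to
  \<open>N30\<close>.\<close>

definition match_round :: "nat \<Rightarrow> prog" where
  "match_round p = search (2 * p) (RMinus (lit 0) (lit 1)) (match_score p) ;; link_all p 30 28"

definition emit_body :: prog where
  "emit_body = Ite (Conj (is_large (NV 21)) (NLess (cell 6 (NV 21)) (Lit 1)))
     (setv 20 (NV 21) ;; push ;;
      Ite (is_neq (NV 21) (cell 30 (NV 21))) (setv 20 (cell 30 (NV 21)) ;; push) Noop ;;
      setv 20 (Lit 0) ;; push)
     Noop"

text \<open>The two nested loops make (n + 1) p rounds, covering the n p rounds that
  \<open>local_search_final\<close> asks for.\<close>

definition matching :: "nat \<Rightarrow> prog" where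
  "matching p = For 21 None (NSet 30 (NV 21) (Lit 0) (NV 21)) ;;
     For 29 None (For 34 (Some p) (match_round p)) ;;
     For 21 None emit_body"

lemma nwrites_link_prog: "nwrites (link_prog a) = {a}" "rwrites (link_prog a) = {}"
  by (auto simp: link_prog_def)

lemma nwrites_link_all: "nwrites (link_all p a b) = {a, 22, 32, 33}" "rwrites (link_all p a b) = {}"
  by (auto simp: link_all_def nwrites_link_prog)

lemma nwrites_match_score: "nwrites (match_score p) = {22, 25, 31, 32, 33}" "rwrites (match_score p) = {5}"
  by (auto simp: match_score_def saving_body_def nwrites_link_all)

definition pairs :: "nat list \<Rightarrow> (nat \<times> nat) list" where
  "pairs x = map (\<lambda>i. (x ! (2 * i), x ! Suc (2 * i))) [0..<length x div 2]"

lemma pairs_flatten: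
  assumes "length ps = p"
  shows "\<exists>x. length x = 2 * p \<and> pairs x = ps \<and> set x = fst ` set ps \<union> snd ` set ps"
  using assms
proof (induction ps arbitrary: p)
  case Nil
  then show ?case by (simp add: pairs_def)
next
  case (Cons uv ps)
  obtain u v where uv: "uv = (u, v)" by (cases uv)
  obtain x where x: "length x = 2 * length ps" "pairs x = ps" "set x = fst ` set ps \<union> snd ` set ps"
    using Cons.IH by blast
  have "pairs (u # v # x) = (u, v) # pairs x"
    by (simp add: pairs_def map_upt_Suc del: upt_Suc)
  then show ?case using x uv Cons.prems by (intro exI[of _ "u # v # x"]) auto
qed

context cvrp_tsp
begin

lemma large_cond:
  assumes "inputs s" "nval e s = v" "v \<le> n"
  shows "bval (is_large e) s \<longleftrightarrow> large v"
proof (cases "0 < v")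
  case True
  then have v: "v \<in> customers n" using assms(3) by (simp add: customers_iff)
  then have "nmem s 1 v 0 = d v" using inputsD(3)[OF assms(1)] by simp
  moreover have "nmem s 0 0 1 = k" using inputsD(2)[OF assms(1)] by simp
  ultimately show ?thesis using v assms(2) True by (simp add: large_def numeral_3_eq_3 add.commute)
qed (use assms in \<open>simp add: large_def customers_def\<close>)

lemma link_prog_value:
  assumes s: "inputs s" and a: "2 < a" "a \<noteq> 32" "a \<noteq> 33"
    and uv: "nmem s 32 0 0 = u" "u \<le> n" "nmem s 33 0 0 = v" "v \<le> n"
    and \<pi>: "\<And>x. x \<le> n \<Longrightarrow> nmem s a x 0 = \<pi> x" and x: "x \<le> n"
  shows "nmem (den (link_prog a) s) a x 0 = link \<pi> (u, v) x"
proof (cases "large u \<and> large v \<and> u \<noteq> v \<and> d u + d v \<le> k")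
  case True
  define b where "b = Conj (Conj (is_large (NV 32)) (is_large (NV 33)))
           (Conj (is_neq (NV 32) (NV 33)) (Neg (NLess cap (NPlus (cell 1 (NV 32)) (cell 1 (NV 33))))))"
  have dm: "nmem s 1 u 0 = d u" "nmem s 1 v 0 = d v" "nmem s 0 0 1 = k"
    using inputsD(2,3)[OF s] True by (auto simp: large_def)
  have l: "bval (is_large (NV 32)) s" "bval (is_large (NV 33)) s"
    using large_cond[OF s, of "NV 32" u] large_cond[OF s, of "NV 33" v] uv True by simp_all
  have "bval b s" using l dm uv True unfolding b_def bval.simps(4) by auto
  then have eq: "den (link_prog a) s = den (NSet a (cell a (NV 32)) (Lit 0) (cell a (NV 32)) ;;
        NSet a (cell a (NV 33)) (Lit 0) (cell a (NV 33)) ;;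
        NSet a (NV 32) (Lit 0) (NV 33) ;; NSet a (NV 33) (Lit 0) (NV 32)) s"
    unfolding link_prog_def b_def[symmetric] by (simp only: den.simps if_True)
  show ?thesis
    using True uv a \<pi>[OF x] \<pi>[OF uv(2)] \<pi>[OF uv(4)] unfolding eq
    by (auto simp: nmem_nset link_def Let_def)
next
  case False
  define b where "b = Conj (Conj (is_large (NV 32)) (is_large (NV 33)))
           (Conj (is_neq (NV 32) (NV 33)) (Neg (NLess cap (NPlus (cell 1 (NV 32)) (cell 1 (NV 33))))))"
  have l: "bval (is_large (NV 32)) s \<longleftrightarrow> large u" "bval (is_large (NV 33)) s \<longleftrightarrow> large v"
    using large_cond[OF s, of "NV 32" u] large_cond[OF s, of "NV 33" v] uv by simp_all
  have "\<not> bval b s"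
  proof
    assume b: "bval b s"
    then have "large u" "large v" using l unfolding b_def bval.simps(4) by blast+
    moreover from this have "nmem s 1 u 0 = d u" "nmem s 1 v 0 = d v" "nmem s 0 0 1 = k"
      using inputsD(2,3)[OF s] by (auto simp: large_def)
    ultimately show False using b uv False unfolding b_def bval.simps(4) by auto
  qed
  then have "den (link_prog a) s = s"
    unfolding link_prog_def b_def[symmetric] by (simp only: den.simps if_False)
  then show ?thesis using False \<pi>[OF x] by (auto simp: link_def)
qed

lemma link_all_value:
  assumes s: "inputs s" and ab: "2 < a" "a \<notin> {22, 32, 33, b}" "b \<notin> {22, 32, 33}"
    and x: "set (tuple (2 * p) (nmem s b)) \<subseteq> {..n}"
    and \<pi>: "\<And>v. v \<le> n \<Longrightarrow> nmem s a v 0 = \<pi> v" and v: "v \<le> n"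
  shows "nmem (den (link_all p a b) s) a v 0 = foldl link \<pi> (pairs (tuple (2 * p) (nmem s b))) v"
proof -
  define X where "X = tuple (2 * p) (nmem s b)"
  have X: "length X = 2 * p" "set X \<subseteq> {..n}" using x by (simp_all add: X_def)
  have pX: "length (pairs X) = p" using X by (simp add: pairs_def)
  define f where "f = den (setv 32 (cell b (NPlus (NV 22) (NV 22))) ;;
      setv 33 (cell b (NPlus (NV 22) (NPlus (NV 22) (Lit 1)))) ;; link_prog a)"
  define I where "I i t \<longleftrightarrow> inputs t \<and> nmem t b = nmem s b \<and>
     (\<forall>v\<le>n. nmem t a v 0 = foldl link \<pi> (take i (pairs X)) v)" for i t
  have "I p (loop f 22 p s)"
  proof (rule loop_rule)
    show "I 0 (nset 22 0 0 0 s)" using s ab \<pi> by (simp add: I_def inputs_nset nmem_nset nmem_nset_other)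
  next
    fix i t assume i: "i < p" "nmem t 22 0 0 = i" and I: "I i t"
    define u where "u = X ! (2 * i)"
    define w where "w = X ! Suc (2 * i)"
    have "u \<in> set X" "w \<in> set X" using X i by (simp_all add: u_def w_def)
    then have uw: "u \<le> n" "w \<le> n" using X by auto
    define t1 where "t1 = nset 33 0 0 w (nset 32 0 0 u t)"
    have t1: "inputs t1" using I by (simp add: t1_def I_def inputs_nset)
    have "nmem t b (i + i) 0 = u" "nmem t b (i + (i + 1)) 0 = w"
      using I i X_def by (simp_all add: I_def u_def w_def mult_2)
    then have f: "f t = den (link_prog a) t1"
      using i ab by (simp add: f_def t1_def nmem_nset)
    have take: "take (Suc i) (pairs X) = take i (pairs X) @ [(u, w)]"
      using i pX by (simp add: take_Suc_conv_app_nth) (simp add: pairs_def u_def w_def X)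
    have "nmem (f t) a v 0 = link (foldl link \<pi> (take i (pairs X))) (u, w) v" if "v \<le> n" for v
      unfolding f
      by (rule link_prog_value[OF t1 ab(1)])
        (use ab uw that I in \<open>simp_all add: t1_def nmem_nset I_def\<close>)
    moreover have "inputs (f t)" unfolding f using t1 ab
      by (intro inputs_den) (auto simp: nwrites_link_prog)
    moreover have "nmem (f t) b = nmem s b"
      using ab I by (simp add: f nmem_den nwrites_link_prog t1_def nmem_nset_other I_def)
    ultimately show "I (Suc i) (nset 22 0 0 (Suc i) (f t))"
      using ab unfolding I_def take by (simp add: inputs_nset nmem_nset nmem_nset_other)
  qed
  then show ?thesis using v pX by (simp add: I_def link_all_def f_def X_def)
qed

lemma match_score_value:
  assumes s: "inputs s" and x: "\<And>i. i < 2 * p \<Longrightarrow> nmem s 8 i 0 \<le> n"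
    and \<pi>: "pairing \<pi>" "\<And>v. v \<le> n \<Longrightarrow> nmem s 30 v 0 = \<pi> v"
  shows "rmem (den (match_score p) s) 5 0 0 =
    total_saving (foldl link \<pi> (pairs (tuple (2 * p) (nmem s 8))))"
proof -
  define \<rho> where "\<rho> = foldl link \<pi> (pairs (tuple (2 * p) (nmem s 8)))"
  have \<rho>: "pairing \<rho>" unfolding \<rho>_def by (rule pairing_foldl_link[OF \<pi>(1)])
  define f where "f = den (NSet 31 (NV 25) (Lit 0) (cell 30 (NV 25)))"
  define s1 where "s1 = loop f 25 (Suc n) s"
  have s1_den: "s1 = den (For 25 None (NSet 31 (NV 25) (Lit 0) (cell 30 (NV 25)))) s"
    using loop_count[OF s] by (simp add: s1_def f_def)
  have "(\<forall>v<Suc n. nmem s1 31 v 0 = nmem s 30 v 0) \<and> nmem s1 30 = nmem s 30"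
    unfolding s1_def
    by (rule loop_rule[where I = "\<lambda>i t. (\<forall>v<i. nmem t 31 v 0 = nmem s 30 v 0) \<and> nmem t 30 = nmem s 30"])
      (auto simp: f_def nmem_nset nmem_nset_other less_Suc_eq)
  then have s1: "nmem s1 31 v 0 = \<pi> v" if "v \<le> n" for v using \<pi>(2) that by simp
  have s1_in: "inputs s1" unfolding s1_den by (rule inputs_den[OF s]) auto
  have s1_8: "nmem s1 8 = nmem s 8" unfolding s1_den by (rule nmem_den) auto
  define s2 where "s2 = rset 5 0 0 0 (den (link_all p 31 8) s1)"
  have s2_in: "inputs s2"
    unfolding s2_def by (intro inputs_rset inputs_den s1_in) (simp_all add: nwrites_link_all)
  have "nmem (den (link_all p 31 8) s1) 31 v 0 = foldl link \<pi> (pairs (tuple (2 * p) (nmem s1 8))) v" if "v \<le> n" for v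
    by (rule link_all_value[OF s1_in])
      (use s1 that set_tuple_le[of "2 * p" "nmem s 8" n] x in \<open>auto simp: s1_8\<close>)
  then have s2: "nmem s2 31 v 0 = \<rho> v" if "v \<le> n" for v
    using that by (simp add: s2_def \<rho>_def s1_8)
  define g where "g = den saving_body"
  define I where "I i t \<longleftrightarrow> inputs t \<and> nmem t 31 = nmem s2 31 \<and>
      rmem t 5 0 0 = (\<Sum>v | large v \<and> v < i. saving v (\<rho> v))" for i t
  have "I (Suc n) (loop g 25 (Suc n) s2)"
  proof (rule loop_rule)
    show "I 0 (nset 25 0 0 0 s2)"
      using s2_in by (simp add: I_def inputs_nset nmem_nset_other s2_def rmem_rset)
  next
    fix i t assume i: "i < Suc n" "nmem t 25 0 0 = i" and I: "I i t"
    have t: "inputs t" "nmem t 31 i 0 = \<rho> i" using I s2[of i] i by (simp_all add: I_def)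
    have L: "bval (is_large (NV 25)) t \<longleftrightarrow> large i" by (rule large_cond[OF t(1)]) (use i in simp_all)
    define b where "b = Conj (is_large (NV 25)) (is_neq (NV 25) (cell 31 (NV 25)))"
    have "bval (is_neq (NV 25) (cell 31 (NV 25))) t \<longleftrightarrow> \<rho> i \<noteq> i" using i t(2) by auto
    then have b: "bval b t \<longleftrightarrow> large i \<and> \<rho> i \<noteq> i"
      unfolding b_def bval.simps(4)[of "is_large (NV 25)"] L by blast
    have gt: "g t = (if bval b t then rset 5 0 0 (rmem t 5 0 0 + (rmem t 0 0 i + rmem t 0 0 (\<rho> i) - rmem t 0 i (\<rho> i))) t else t)"
      unfolding g_def saving_body_def b_def[symmetric] by (simp add: i t)
    have "rmem (g t) 5 0 0 = (\<Sum>v | large v \<and> v < i. saving v (\<rho> v)) + (if large i then saving i (\<rho> i) else 0)"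
    proof (cases "large i \<and> \<rho> i \<noteq> i")
      case True
      then have "i \<in> vertices n" "\<rho> i \<in> vertices n"
        using \<rho> large_vertex by (auto simp: pairing_def)
      then show ?thesis
        using True b gt I inputsD(5)[OF t(1)] by (simp add: I_def rmem_rset saving_def)
    next
      case False
      then have "(if large i then saving i (\<rho> i) else 0) = 0" by (auto simp: saving_def)
      moreover have "g t = t" using False b gt by (simp only: if_False)
      ultimately show ?thesis using I by (simp add: I_def)
    qed
    also have "\<dots> = (\<Sum>v | large v \<and> v < Suc i. saving v (\<rho> v))"
    proof (cases "large i")
      case True
      have "{v. large v \<and> v < Suc i} = insert i {v. large v \<and> v < i}" using True by (auto simp: less_Suc_eq)
      then show ?thesis using True by simp
    next
      case False
      then have "{v. large v \<and> v < Suc i} = {v. large v \<and> v < i}" by (auto simp: less_Suc_eq)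
      then show ?thesis using False by simp
    qed
    finally have "rmem (g t) 5 0 0 = (\<Sum>v | large v \<and> v < Suc i. saving v (\<rho> v))" .
    moreover have "inputs (g t)" "nmem (g t) 31 = nmem s2 31"
      using I unfolding gt by (auto simp: I_def inputs_rset)
    ultimately show "I (Suc i) (nset 25 0 0 (Suc i) (g t))"
      by (simp add: I_def inputs_nset nmem_nset_other)
  qed
  moreover have "{v. large v \<and> v < Suc n} = {v. large v}" by (auto simp: large_def customers_def)
  moreover have "den (match_score p) s = loop g 25 (Suc n) s2"
    using loop_count[OF s2_in] by (simp add: match_score_def s1_den s2_def g_def)
  ultimately show ?thesis unfolding \<rho>_def[symmetric] by (simp add: I_def total_saving_def)
qed

lemma match_round_value:
  assumes s: "inputs s" and p: "0 < p"
    and \<pi>: "pairing \<pi>" "\<And>v. v \<le> n \<Longrightarrow> nmem s 30 v 0 = \<pi> v"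
  obtains \<pi>' where "inputs (den (match_round p) s)" "pairing \<pi>'"
    "\<And>v. v \<le> n \<Longrightarrow> nmem (den (match_round p) s) 30 v 0 = \<pi>' v"
    "\<And>ps. length ps = p \<Longrightarrow> \<forall>(u, v)\<in>set ps. u \<le> n \<and> v \<le> n \<Longrightarrow>
       total_saving (foldl link \<pi> ps) \<le> total_saving \<pi>'"
proof -
  define P where "P = search (2 * p) (RMinus (lit 0) (lit 1)) (match_score p)"
  define f where "f x = total_saving (foldl link \<pi> (pairs x))" for x
  define u where "u = den P s"
  define bx where "bx = tuple (2 * p) (nmem u 28)"
  define r where "r = rmem u 6 0 0"
  have K0: "0 < 2 * p" using p by simp
  have wP: "nwrites P = {8, 22, 25, 28, 31, 32, 33} \<union> {100..<100 + 2 * p}" "rwrites P = {5, 6}"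
    using K0 by (auto simp: P_def nwrites_search rwrites_search nwrites_match_score)
  have score: "rmem (den (match_score p) z) 5 0 0 = f (tuple (2 * p) (nmem z 8))"
    if "\<And>a. a \<notin> nwrites P \<Longrightarrow> nmem z a = nmem s a" "\<And>a. a \<notin> rwrites P \<Longrightarrow> rmem z a = rmem s a"
        "\<And>i. i < 2 * p \<Longrightarrow> nmem z 8 i 0 \<le> n" for z
    unfolding f_def
  proof (rule match_score_value)
    show "inputs z" by (rule inputs_cong[OF s]) (intro that; simp add: wP)+
    have "nmem z 30 = nmem s 30" by (rule that) (simp add: wP)
    then show "nmem z 30 v 0 = \<pi> v" if "v \<le> n" for v using \<pi>(2)[OF that] by simp
  qed (rule that(3), assumption, rule \<pi>(1))
  note score' = score[unfolded P_def]
  have zero: "nmem s 0 0 0 = n" by (rule inputsD(1)[OF s])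
  have frame: "nwrites (match_score p) \<inter> {0, 8, 28} = {}" "6 \<notin> rwrites (match_score p)"
    by (simp_all add: nwrites_match_score)
  have bx: "set bx \<subseteq> {..n}"
    unfolding bx_def u_def P_def by (rule search_spec(1)[where f = f, OF K0 zero frame]) (rule score')
  have max: "f x \<le> r" if "length x = 2 * p" "set x \<subseteq> {..n}" for x
    unfolding r_def u_def P_def by (rule search_spec(2)[where f = f, OF K0 zero frame _ that]) (rule score')
  have r: "r = rval (RMinus (lit 0) (lit 1)) s \<and> bx = replicate (2 * p) 0 \<or>
      r = f bx \<and> rval (RMinus (lit 0) (lit 1)) s < r"
    unfolding r_def bx_def u_def P_def
    by (rule search_spec(3)[where f = f, OF K0 zero frame]) (rule score')
  have f_nonneg: "0 \<le> f x" for x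
  proof -
    have "pairing (foldl link \<pi> (pairs x))" by (rule pairing_foldl_link[OF \<pi>(1)])
    then show ?thesis
      unfolding f_def total_saving_def by (intro sum_nonneg saving_nonneg) (auto simp: pairing_def)
  qed
  have "f (replicate (2 * p) 0) \<le> r" by (rule max) auto
  then have "0 \<le> r" using f_nonneg order_trans by blast
  then have rf: "r = f bx" using r by simp
  have u: "inputs u" unfolding u_def by (rule inputs_den[OF s]) (simp_all add: wP)
  have "nmem u 30 = nmem s 30" unfolding u_def by (rule nmem_den) (simp add: wP)
  then have u30: "nmem u 30 v 0 = \<pi> v" if "v \<le> n" for v using \<pi>(2)[OF that] by simp
  have den: "den (match_round p) s = den (link_all p 30 28) u"
    by (simp add: match_round_def u_def P_def)
  show ?thesis
  proof (rule that[of "foldl link \<pi> (pairs bx)"])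
    show "inputs (den (match_round p) s)"
      unfolding den by (rule inputs_den[OF u]) (simp_all add: nwrites_link_all)
    show "pairing (foldl link \<pi> (pairs bx))" by (rule pairing_foldl_link[OF \<pi>(1)])
    show "nmem (den (match_round p) s) 30 v 0 = foldl link \<pi> (pairs bx) v" if "v \<le> n" for v
      unfolding den bx_def by (rule link_all_value[OF u]) (use bx u30 that in \<open>simp_all add: bx_def\<close>)
    fix ps :: "(nat \<times> nat) list" assume ps: "length ps = p" "\<forall>(u, v)\<in>set ps. u \<le> n \<and> v \<le> n"
    obtain x where x: "length x = 2 * p" "pairs x = ps" "set x = fst ` set ps \<union> snd ` set ps"
      using pairs_flatten[OF ps(1)] by blast
    have "set x \<subseteq> {..n}" using ps(2) x(3) by auto
    then have "f x \<le> r" using x(1) by (intro max)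
    then show "total_saving (foldl link \<pi> ps) \<le> total_saving (foldl link \<pi> (pairs bx))"
      using rf x(2) by (simp add: f_def)
  qed
qed

text \<open>The gap to \<sigma> after N rounds is at most (1 - 1/n)^N times its trivial initial
  bound p \<open>total_saving \<sigma>\<close>, which holds for the identity pairing because that
  saves nothing.\<close>

lemma match_rounds_value:
  assumes s: "inputs s" "\<And>v. v \<le> n \<Longrightarrow> nmem s 30 v 0 = v" and p: "0 < p" and \<sigma>: "pairing \<sigma>"
  obtains \<pi> where "inputs (den (For 29 None (For 34 (Some p) (match_round p))) s)" "pairing \<pi>"
    "\<And>v. v \<le> n \<Longrightarrow> nmem (den (For 29 None (For 34 (Some p) (match_round p))) s) 30 v 0 = \<pi> v"
    "total_saving \<sigma> - 2 / (real p + 1) * total_saving \<sigma> \<le> total_saving \<pi>"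
proof -
  define I where "I N t \<longleftrightarrow> inputs t \<and> (\<exists>\<pi>. pairing \<pi> \<and> (\<forall>v\<le>n. nmem t 30 v 0 = \<pi> v) \<and>
     max 0 (p * total_saving \<sigma> - (real p + 1) * total_saving \<pi>) \<le> (1 - 1 / n) ^ N * (p * total_saving \<sigma>))" for N t
  define f where "f = den (match_round p)"
  define g where "g = (\<lambda>t. loop f 34 p t)"
  have I_set: "I N (nset a i j x t)" if "I N t" "a \<notin> {0, 1, 2, 30}" for N t a i j x
    using that by (simp add: I_def inputs_nset nmem_nset_other)
  have T\<sigma>: "0 \<le> total_saving \<sigma>"
    using \<sigma> unfolding total_saving_def by (intro sum_nonneg saving_nonneg) (auto simp: pairing_def)
  have step: "I (Suc N) (f t)" if I: "I N t" for N t
  proof -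
    obtain \<pi> where \<pi>: "inputs t" "pairing \<pi>" "\<And>v. v \<le> n \<Longrightarrow> nmem t 30 v 0 = \<pi> v"
      "max 0 (p * total_saving \<sigma> - (real p + 1) * total_saving \<pi>) \<le> (1 - 1 / n) ^ N * (p * total_saving \<sigma>)"
      using I by (auto simp: I_def)
    obtain \<pi>' where \<pi>': "inputs (f t)" "pairing \<pi>'" "\<And>v. v \<le> n \<Longrightarrow> nmem (f t) 30 v 0 = \<pi>' v"
      "\<And>ps. length ps = p \<Longrightarrow> \<forall>(u, v)\<in>set ps. u \<le> n \<and> v \<le> n \<Longrightarrow>
       total_saving (foldl link \<pi> ps) \<le> total_saving \<pi>'"
      using match_round_value[OF \<pi>(1) p \<pi>(2,3)] unfolding f_def by blast
    have "foldl link \<pi> (replicate m (0, 0)) = \<pi>" for m by (induction m) simp_all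
    then have "total_saving \<pi> \<le> total_saving \<pi>'" using \<pi>'(4)[of "replicate p (0, 0)"] by simp
    then have "max 0 (p * total_saving \<sigma> - (real p + 1) * total_saving \<pi>') \<le>
        (1 - 1 / n) * max 0 (p * total_saving \<sigma> - (real p + 1) * total_saving \<pi>)"
      using \<pi>'(4) by (intro local_search_gap[OF \<pi>(2) \<sigma> p]) auto
    also have "\<dots> \<le> (1 - 1 / n) * ((1 - 1 / n) ^ N * (p * total_saving \<sigma>))"
      using \<pi>(4) n_pos by (intro mult_left_mono) auto
    finally show ?thesis using \<pi>'(1-3) by (auto simp: I_def intro!: exI[of _ \<pi>'])
  qed
  have inner: "I (N + p) (g t)" if I: "I N t" for N t
    unfolding g_def
  proof (rule loop_rule[where I = "\<lambda>i. I (N + i)"])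
    show "I (N + 0) (nset 34 0 0 0 t)" using I_set[OF I, of 34] by simp
    show "I (N + Suc i) (nset 34 0 0 (Suc i) (f s))" if "I (N + i) s" for i s
      using I_set[OF step[OF that], of 34] by simp
  qed
  have "I (Suc n * p) (loop g 29 (Suc n) s)"
  proof (rule loop_rule[where I = "\<lambda>i. I (i * p)"])
    have "I 0 s"
      using s T\<sigma> pairing_id unfolding I_def
      by (auto intro!: exI[of _ "\<lambda>v. v"] simp: total_saving_def saving_def)
    then show "I (0 * p) (nset 29 0 0 0 s)" using I_set[of 0 s 29] by simp
    show "I (Suc i * p) (nset 29 0 0 (Suc i) (g s))" if "I (i * p) s" for i s
      using I_set[OF inner[OF that], of 29] by (simp add: add.commute)
  qed
  moreover have den: "den (For 29 None (For 34 (Some p) (match_round p))) s = loop g 29 (Suc n) s"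
  proof -
    have "den (For 34 (Some p) (match_round p)) = g" by (rule ext) (simp add: g_def f_def)
    then show ?thesis unfolding den.simps(6)[of 29] using loop_count[OF s(1)] by simp
  qed
  ultimately obtain \<pi> where \<pi>: "inputs (loop g 29 (Suc n) s)" "pairing \<pi>"
    "\<And>v. v \<le> n \<Longrightarrow> nmem (loop g 29 (Suc n) s) 30 v 0 = \<pi> v"
    "max 0 (p * total_saving \<sigma> - (real p + 1) * total_saving \<pi>) \<le> (1 - 1 / n) ^ (Suc n * p) * (p * total_saving \<sigma>)"
    by (auto simp: I_def)
  have "total_saving \<sigma> - 2 / (real p + 1) * total_saving \<sigma> \<le> total_saving \<pi>"
    by (rule local_search_final[OF \<sigma> _ p \<pi>(4)]) simp
  then show ?thesis using that[of \<pi>] \<pi>(1-3) unfolding den by blast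
qed

text \<open>Divides the cost of a pair's tour between its two customers, the saving being shared
  equally.\<close>

definition half_cost :: "(nat \<Rightarrow> nat) \<Rightarrow> nat \<Rightarrow> real" where
  "half_cost \<pi> v = 2 * c 0 v - saving v (\<pi> v) / 2"

text \<open>A pair is emitted when the first of its ends is met. Since the served set is closed
  under \<pi>, its other end is then skipped, and a partner is never already served when its pair is
  emitted.\<close>

lemma emit_body_value:
  assumes s: "inputs s" "buffer s D []" "valid_tours D" and i: "nmem s 21 0 0 = i" "i \<le> n"
    and \<pi>: "pairing \<pi>" "\<And>v. v \<le> n \<Longrightarrow> nmem s 30 v 0 = \<pi> v"
    and closed: "\<And>v. v \<in> served D \<Longrightarrow> large v \<and> \<pi> v \<in> served D"
  obtains D' where "inputs (den emit_body s)" "buffer (den emit_body s) D' []" "valid_tours D'"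
    "served D' = served D \<union> (if large i then {i, \<pi> i} else {})"
    "tours_cost D' - (\<Sum>v\<in>served D'. half_cost \<pi> v) = tours_cost D - (\<Sum>v\<in>served D. half_cost \<pi> v)"
proof -
  define b where "b = Conj (is_large (NV 21)) (NLess (cell 6 (NV 21)) (Lit 1))"
  define e where "e = (setv 20 (NV 21) ;; push ;;
      Ite (is_neq (NV 21) (cell 30 (NV 21))) (setv 20 (cell 30 (NV 21)) ;; push) Noop ;;
      setv 20 (Lit 0) ;; push)"
  have L: "bval (is_large (NV 21)) s \<longleftrightarrow> large i" by (rule large_cond[OF s(1)]) (use i in simp_all)
  have "bval (NLess (cell 6 (NV 21)) (Lit 1)) s \<longleftrightarrow> i \<notin> served D"
    using buffer_served[OF s(2) i(2)] i(1) by simp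
  then have b: "bval b s \<longleftrightarrow> large i \<and> i \<notin> served D"
    unfolding b_def bval.simps(4)[of "is_large (NV 21)"] L by blast
  have den: "den emit_body s = (if bval b s then den e s else s)"
    unfolding emit_body_def b_def[symmetric] e_def[symmetric] by simp
  have inp: "inputs (den emit_body s)"
    by (rule inputs_den[OF s(1)]) (simp_all add: emit_body_def nwrites_push rwrites_push)
  show ?thesis
  proof (cases "large i \<and> i \<notin> served D")
    case False
    then have "den emit_body s = s" using den b by (simp only: if_False)
    moreover have "served D \<union> (if large i then {i, \<pi> i} else {}) = served D" using False closed[of i] by auto
    ultimately show ?thesis using that[of D] inp s by simp
  next
    case True
    define j where "j = \<pi> i"
    have ij: "large i" "i \<notin> served D" "large j" "\<pi> j = i" "j \<noteq> i \<Longrightarrow> d i + d j \<le> k"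
      using True \<pi>(1) by (auto simp: pairing_def j_def)
    have jD: "j \<notin> served D" using closed[of j] ij by auto
    have ic: "i \<in> customers n" "j \<in> customers n" using ij by (auto simp: large_def)
    define s1 where "s1 = nset 20 0 0 i s"
    define s2 where "s2 = den push s1"
    have s1: "inputs s1" "buffer s1 D []" "nmem s1 20 0 0 = i"
      using s by (simp_all add: s1_def inputs_nset buffer_nset nmem_nset)
    have s2: "inputs s2" "buffer s2 D [i]"
      using inputs_push[OF s1(1)] push_customer[OF s1 ic(1)] ij(2) by (simp_all add: s2_def)
    have "nmem s2 21 = nmem s 21" "nmem s2 30 = nmem s 30"
      by (simp_all add: s2_def nmem_den nwrites_push s1_def nmem_nset_other)
    then have s2m: "nmem s2 21 0 0 = i" "nmem s2 30 i 0 = j" using i \<pi>(2)[OF i(2)] by (simp_all add: j_def)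
    define ys where "ys = (if j = i then [i] else [i, j])"
    define s3 where "s3 = (if j = i then s2 else den push (nset 20 0 0 j s2))"
    have s3: "inputs s3" "buffer s3 D ys"
    proof -
      have "inputs (nset 20 0 0 j s2)" "buffer (nset 20 0 0 j s2) D [i]" "nmem (nset 20 0 0 j s2) 20 0 0 = j"
        using s2 by (simp_all add: inputs_nset buffer_nset nmem_nset)
      note st = this
      have "buffer (den push (nset 20 0 0 j s2)) D ([i] @ [j])" if "j \<noteq> i"
        using that jD by (intro push_customer[OF st ic(2)]) auto
      then show "buffer s3 D ys" using s2 by (auto simp: s3_def ys_def)
      show "inputs s3" using s2 inputs_push[OF st(1)] by (auto simp: s3_def)
    qed
    have e: "den e s = den push (nset 20 0 0 0 s3)"
    proof -
      have "bval (is_neq (NV 21) (cell 30 (NV 21))) s2 \<longleftrightarrow> j \<noteq> i" using s2m by auto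
      moreover have "den e s = den push (nset 20 0 0 0
          (if bval (is_neq (NV 21) (cell 30 (NV 21))) s2 then den push (nset 20 0 0 (nmem s2 30 (nmem s2 21 0 0) 0) s2) else s2))"
        by (simp add: e_def s2_def s1_def i)
      ultimately show ?thesis using s2m by (simp add: s3_def)
    qed
    have s4: "inputs (nset 20 0 0 0 s3)" "buffer (nset 20 0 0 0 s3) D ys" "nmem (nset 20 0 0 0 s3) 20 0 0 = 0"
      using s3 by (simp_all add: inputs_nset buffer_nset nmem_nset)
    have buf: "buffer (den emit_body s) (D @ [ys]) []"
    proof -
      have "bval b s" "ys \<noteq> []" using True b by (simp_all add: ys_def)
      then show ?thesis using push_depot[OF s4] unfolding den e by simp
    qed
    have load: "sum_list (map d ys) \<le> k" using ij(5) demand[OF ic(1)] by (auto simp: ys_def)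
    have val: "valid_tours (D @ [ys])"
      by (rule valid_tours_snoc[OF s3(2) _ load s(3)]) (simp add: ys_def)
    have set_ys: "set ys = {i, j}" by (auto simp: ys_def)
    have "tour_cost c ys = (\<Sum>v\<in>{i, j}. half_cost \<pi> v)"
    proof (cases "j = i")
      case True
      then show ?thesis
        using tour_cost_single[OF ic(1)] ij(4) by (simp add: ys_def half_cost_def saving_def)
    next
      case False
      have "c j 0 = c 0 j" "c j i = c i j" using cost_sym customer_vertex[OF ic(1)] customer_vertex[OF ic(2)] by auto
      then show ?thesis
        using False ij(4) by (simp add: ys_def half_cost_def saving_def tour_cost_eq_path j_def[symmetric] field_simps)
    qed
    moreover have "(\<Sum>v\<in>served D \<union> {i, j}. half_cost \<pi> v) = (\<Sum>v\<in>served D. half_cost \<pi> v) + (\<Sum>v\<in>{i, j}. half_cost \<pi> v)"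
      using ij(2) jD by (intro sum.union_disjoint) auto
    moreover have "served (D @ [ys]) = served D \<union> {i, j}" by (simp add: set_ys)
    ultimately show ?thesis
      using that[of "D @ [ys]"] inp buf val ij(1) by (simp add: tours_cost_snoc j_def)
  qed
qed

lemma matching_spec:
  assumes s: "inputs s" "buffer s [] []" and p: "0 < p" and feas: "feasible n k d S a"
  obtains D where "buffer (den (matching p) s) D []" "valid_tours D" "served D = {v. large v}"
    "tours_cost D \<le> solution_cost c S + 3 / (real p + 1) * sum radial {v. large v}"
proof -
  obtain \<sigma> where \<sigma>: "pairing \<sigma>" "pairing_cost \<sigma> \<le> solution_cost c S" using pairing_exists[OF feas] by blast
  define f where "f = den (NSet 30 (NV 21) (Lit 0) (NV 21))"
  define s1 where "s1 = loop f 21 (Suc n) s"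
  have s1_den: "s1 = den (For 21 None (NSet 30 (NV 21) (Lit 0) (NV 21))) s"
    using loop_count[OF s(1)] by (simp add: s1_def f_def)
  have "\<forall>v<Suc n. nmem s1 30 v 0 = v"
    unfolding s1_def
    by (rule loop_rule[where I = "\<lambda>i t. \<forall>v<i. nmem t 30 v 0 = v"]) (auto simp: f_def nmem_nset less_Suc_eq)
  then have s1_30: "nmem s1 30 v 0 = v" if "v \<le> n" for v using that by simp
  have s1: "inputs s1" unfolding s1_den by (rule inputs_den[OF s(1)]) auto
  have s1b: "buffer s1 [] []" unfolding s1_den by (rule buffer_den[OF s(2)]) auto
  define R where "R = For 29 None (For 34 (Some p) (match_round p))"
  define s2 where "s2 = den R s1"
  obtain \<pi> where \<pi>: "inputs s2" "pairing \<pi>" "\<And>v. v \<le> n \<Longrightarrow> nmem s2 30 v 0 = \<pi> v"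
    "total_saving \<sigma> - 2 / (real p + 1) * total_saving \<sigma> \<le> total_saving \<pi>"
    using match_rounds_value[OF s1 s1_30 p \<sigma>(1)] unfolding s2_def R_def by blast
  have s2b: "buffer s2 [] []"
    unfolding s2_def
  proof (rule buffer_den[OF s1b])
    have wR: "nwrites R = {8, 22, 25, 28, 29, 30, 31, 32, 33, 34} \<union> {100..<100 + 2 * p}" "rwrites R = {5, 6}"
      using p by (auto simp: R_def match_round_def nwrites_search rwrites_search nwrites_match_score nwrites_link_all)
    show "nwrites R \<inter> {6, 7, 13, 14, 15} = {}" "1 \<notin> rwrites R" unfolding wR by auto
  qed
  define g where "g = den emit_body"
  define I where "I i t \<longleftrightarrow> inputs t \<and> nmem t 30 = nmem s2 30 \<and> (\<exists>D. buffer t D [] \<and> valid_tours D \<and>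
      served D = {v. large v \<and> (v < i \<or> \<pi> v < i)} \<and> tours_cost D = (\<Sum>v\<in>served D. half_cost \<pi> v))" for i t
  have "I (Suc n) (loop g 21 (Suc n) s2)"
  proof (rule loop_rule)
    show "I 0 (nset 21 0 0 0 s2)"
      using \<pi>(1) s2b unfolding I_def
      by (auto intro!: exI[of _ "[]"] inputs_nset buffer_nset simp: valid_tours_def tours_cost_def nmem_nset_other)
  next
    fix i t assume i: "i < Suc n" "nmem t 21 0 0 = i" and I: "I i t"
    obtain D where D: "inputs t" "nmem t 30 = nmem s2 30" "buffer t D []" "valid_tours D"
      "served D = {v. large v \<and> (v < i \<or> \<pi> v < i)}" "tours_cost D = (\<Sum>v\<in>served D. half_cost \<pi> v)"
      using I by (auto simp: I_def)
    have inv: "large (\<pi> v)" "\<pi> (\<pi> v) = v" if "large v" for v using \<pi>(2) that by (auto simp: pairing_def)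
    have t30: "nmem t 30 v 0 = \<pi> v" if "v \<le> n" for v using D(2) \<pi>(3)[OF that] by simp
    have closed: "large v \<and> \<pi> v \<in> served D" if "v \<in> served D" for v
      using that inv unfolding D(5) by auto
    have "i \<le> n" using i by simp
    obtain D' where D': "inputs (g t)" "buffer (g t) D' []" "valid_tours D'"
      "served D' = served D \<union> (if large i then {i, \<pi> i} else {})"
      "tours_cost D' - (\<Sum>v\<in>served D'. half_cost \<pi> v) = tours_cost D - (\<Sum>v\<in>served D. half_cost \<pi> v)"
      using emit_body_value[OF D(1,3,4) i(2) \<open>i \<le> n\<close> \<pi>(2) t30 closed] unfolding g_def by blast
    have "served D' = {v. large v \<and> (v < Suc i \<or> \<pi> v < Suc i)}"
      unfolding D'(4) D(5) using inv by (auto simp: less_Suc_eq)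
    moreover have "nmem (g t) 30 = nmem s2 30"
      unfolding g_def D(2)[symmetric] by (rule nmem_den) (simp add: emit_body_def nwrites_push)
    moreover have "tours_cost D' = (\<Sum>v\<in>served D'. half_cost \<pi> v)" using D'(5) D(6) by simp
    ultimately show "I (Suc i) (nset 21 0 0 (Suc i) (g t))"
      using D'(1-3) unfolding I_def by (auto intro!: exI[of _ D'] inputs_nset buffer_nset simp: nmem_nset_other)
  qed
  moreover have "den (matching p) s = loop g 21 (Suc n) s2"
  proof -
    have "den (matching p) s = den (For 21 None emit_body) s2"
      by (simp only: matching_def den.simps(4) s2_def R_def s1_den)
    then show ?thesis using loop_count[OF \<pi>(1)] by (simp add: g_def)
  qed
  ultimately obtain D where D: "buffer (den (matching p) s) D []" "valid_tours D"
    "served D = {v. large v \<and> (v < Suc n \<or> \<pi> v < Suc n)}" "tours_cost D = (\<Sum>v\<in>served D. half_cost \<pi> v)"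
    by (auto simp: I_def)
  have sv: "served D = {v. large v}" unfolding D(3) by (auto simp: large_def customers_def)
  have "tours_cost D = pairing_cost \<pi>"
    unfolding D(4) sv by (simp add: half_cost_def pairing_cost_def total_saving_def sum_subtractf sum_divide_distrib)
  also have "\<dots> \<le> pairing_cost \<sigma> + 1 / (real p + 1) * total_saving \<sigma>"
    using \<pi>(4) by (simp add: pairing_cost_def field_simps)
  also have "\<dots> \<le> solution_cost c S + 1 / (real p + 1) * (3 * sum radial {v. large v})"
    using \<sigma>(2) total_saving_le[OF \<sigma>(1)] by (intro add_mono mult_left_mono) auto
  finally show ?thesis using that[OF D(1,2) sv] by simp
qed

end

subsection \<open>Partitioning the given tour\<close>

text \<open>Serving a customer above k / 2 alone costs at most 2 \<open>radial\<close>. Afterwards 2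
  d <= k holds for all remaining ones, on which the bound of \<open>cut_cost_coarse\<close> for
  large customers rests.\<close>

definition solo_body :: prog where
  "solo_body = Ite (Conj (Conj (NLess (Lit 0) (NV 21)) (NLess (cell 6 (NV 21)) (Lit 1)))
       (NLess cap (NPlus (cell 1 (NV 21)) (cell 1 (NV 21)))))
     (setv 20 (NV 21) ;; single_push) Noop"

definition solo :: prog where
  "solo = For 21 None solo_body"

definition sequence_body :: prog where
  "sequence_body = setv 20 (cell 2 (NV 21)) ;;
     Ite (NLess (Lit 0) (NV 20))
       (Ite (Conj (NLess (Lit 0) (NV 36)) (NLess (cell 6 (NV 20)) (Lit 1)))
         (setv 35 (NPlus (NV 35) (Lit 1)) ;; NSet 37 (NV 35) (Lit 0) (NV 20)) Noop)
       (setv 36 (NMinus (Lit 1) (NV 36)))"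

text \<open>Traverses the given tour twice and collects in \<open>N37\<close> the unserved customers met between the two
  visits of the depot, that is, in the cyclic order starting at the depot.\<close>

definition sequence :: prog where
  "sequence = setv 35 (Lit 0) ;; setv 36 (Lit 0) ;; NSet 37 (Lit 0) (Lit 0) (Lit 0) ;;
     For 34 (Some 2) (For 21 None sequence_body)"

definition scan :: "nat set \<Rightarrow> nat \<times> nat list \<Rightarrow> nat \<Rightarrow> nat \<times> nat list" where
  "scan C = (\<lambda>(f, us) v. if v = 0 then (1 - f, us) else if 0 < f \<and> v \<notin> C then (f, us @ [v]) else (f, us))"

lemma scan_off: "0 \<notin> set xs \<Longrightarrow> foldl (scan C) (0, us) xs = (0, us)"
  by (induction xs arbitrary: us) (auto simp: scan_def)

lemma scan_on: "0 \<notin> set xs \<Longrightarrow> foldl (scan C) (Suc 0, us) xs = (Suc 0, us @ filter (\<lambda>v. v \<notin> C) xs)"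
  by (induction xs arbitrary: us) (auto simp: scan_def)

text \<open>The flag is raised at the depot in the first pass, collecting \<open>ys\<close>, and
  lowered at the depot in the second, after \<open>xs\<close>; so the collected list is the rotation
  that starts behind the depot.\<close>

lemma scan_twice:
  assumes "0 \<notin> set xs" "0 \<notin> set ys"
  shows "foldl (scan C) (foldl (scan C) (0, []) (xs @ 0 # ys)) (xs @ 0 # ys) = (0, filter (\<lambda>v. v \<notin> C) (ys @ xs))"
proof -
  have "scan C (0, us) 0 = (Suc 0, us)" "scan C (Suc 0, us) 0 = (0, us)" for us by (simp_all add: scan_def)
  then show ?thesis using assms by (simp add: scan_off scan_on)
qed

context cvrp_tsp
begin

lemma solo_spec:
  assumes s: "inputs s" "buffer s D []" "valid_tours D"
  obtains D' where "inputs (den solo s)" "buffer (den solo s) D' []" "valid_tours D'"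
    "served D' = served D \<union> {v \<in> customers n. k < 2 * d v}"
    "tours_cost D' = tours_cost D + (\<Sum>v | v \<in> customers n \<and> k < 2 * d v \<and> v \<notin> served D. 2 * c 0 v)"
proof -
  define N where "N i = {v. v \<in> customers n \<and> k < 2 * d v \<and> v \<notin> served D \<and> v < i}" for i
  define f where "f = den solo_body"
  have finN: "finite (N i)" for i by (rule finite_subset[of _ "{..<i}"]) (auto simp: N_def)
  define I where "I i t \<longleftrightarrow> inputs t \<and> (\<exists>D'. buffer t D' [] \<and> valid_tours D' \<and>
      served D' = served D \<union> N i \<and> tours_cost D' = tours_cost D + (\<Sum>v\<in>N i. 2 * c 0 v))" for i t
  have "I (Suc n) (loop f 21 (Suc n) s)"
  proof (rule loop_rule)
    have "N 0 = {}" by (simp add: N_def)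
    then show "I 0 (nset 21 0 0 0 s)"
      using s unfolding I_def by (auto intro!: exI[of _ D] inputs_nset buffer_nset)
  next
    fix i t assume i: "i < Suc n" "nmem t 21 0 0 = i" and I: "I i t"
    obtain D' where D': "inputs t" "buffer t D' []" "valid_tours D'"
      "served D' = served D \<union> N i" "tours_cost D' = tours_cost D + (\<Sum>v\<in>N i. 2 * c 0 v)"
      using I by (auto simp: I_def)
    define b where "b = Conj (Conj (NLess (Lit 0) (NV 21)) (NLess (cell 6 (NV 21)) (Lit 1)))
       (NLess cap (NPlus (cell 1 (NV 21)) (cell 1 (NV 21))))"
    have i6: "nmem t 6 i 0 = of_bool (i \<in> served D')" using buffer_served[OF D'(2)] i by simp
    have iN: "i \<notin> N i" by (simp add: N_def)
    have b: "bval b t \<longleftrightarrow> i \<in> N (Suc i)"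
    proof (cases "0 < i")
      case True
      then have ic: "i \<in> customers n" using i by (simp add: customers_iff)
      have "nmem t 1 i 0 = d i" "nmem t 0 0 1 = k" using inputsD(2,3)[OF D'(1)] ic by auto
      then show ?thesis
        using True i6 i ic iN unfolding D'(4) by (auto simp: b_def N_def)
    next
      case False
      then show ?thesis using i by (simp add: b_def N_def)
    qed
    have f: "f t = (if bval b t then den single_push (nset 20 0 0 i t) else t)"
      unfolding f_def solo_body_def b_def[symmetric] by (simp add: i)
    have inp: "inputs (f t)"
      unfolding f_def by (rule inputs_den[OF D'(1)])
        (simp_all add: solo_body_def single_push_def nwrites_push rwrites_push)
    show "I (Suc i) (nset 21 0 0 (Suc i) (f t))"
    proof (cases "i \<in> N (Suc i)")
      case False
      then have "f t = t" using f b by (simp only: if_False)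
      moreover have "N (Suc i) = N i" using False by (auto simp: N_def less_Suc_eq)
      ultimately show ?thesis
        using D' unfolding I_def by (auto intro!: exI[of _ D'] inputs_nset buffer_nset)
    next
      case True
      then have ic: "i \<in> customers n" "i \<notin> served D'" using iN unfolding D'(4) by (auto simp: N_def)
      have "buffer (den single_push (nset 20 0 0 i t)) (D' @ [[i]]) []"
        by (rule push_single[OF inputs_nset[OF D'(1)] buffer_nset[OF D'(2)] _ ic]) (simp_all add: nmem_nset)
      then have buf: "buffer (f t) (D' @ [[i]]) []" using f b True by (simp only: if_True)
      have N: "N (Suc i) = insert i (N i)" using True by (auto simp: N_def less_Suc_eq)
      have 1: "valid_tours (D' @ [[i]])"
        using D'(3) ic demand[OF ic(1)] by (auto simp: valid_tours_def)
      have 2: "tours_cost (D' @ [[i]]) = tours_cost D + (\<Sum>v\<in>N (Suc i). 2 * c 0 v)"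
        unfolding N using finN iN D'(5) tour_cost_single[OF ic(1)] by (simp add: tours_cost_snoc)
      have 3: "served (D' @ [[i]]) = served D \<union> N (Suc i)" unfolding N using D'(4) by simp
      have 4: "buffer (nset 21 0 0 (Suc i) (f t)) (D' @ [[i]]) []" using buf by (simp add: buffer_nset)
      have 5: "inputs (nset 21 0 0 (Suc i) (f t))" using inp by (simp add: inputs_nset)
      show ?thesis unfolding I_def by (intro conjI exI[of _ "D' @ [[i]]"] 1 2 3 4 5)
    qed
  qed
  moreover have "den solo s = loop f 21 (Suc n) s"
    using loop_count[OF s(1)] by (simp add: solo_def f_def)
  moreover have "N (Suc n) = {v. v \<in> customers n \<and> k < 2 * d v \<and> v \<notin> served D}"
    by (auto simp: N_def customers_def)
  ultimately obtain D' where "inputs (den solo s)" "buffer (den solo s) D' []" "valid_tours D'"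
    "served D' = served D \<union> {v. v \<in> customers n \<and> k < 2 * d v \<and> v \<notin> served D}"
    "tours_cost D' = tours_cost D + (\<Sum>v | v \<in> customers n \<and> k < 2 * d v \<and> v \<notin> served D. 2 * c 0 v)"
    by (auto simp: I_def)
  moreover have "served D \<union> {v. v \<in> customers n \<and> k < 2 * d v \<and> v \<notin> served D} =
      served D \<union> {v \<in> customers n. k < 2 * d v}" by blast
  ultimately show ?thesis using that[of D'] by simp
qed

definition holds_sequence :: "state \<Rightarrow> nat list \<Rightarrow> bool" where
  "holds_sequence s us \<longleftrightarrow> nmem s 35 0 0 = length us \<and> nmem s 37 0 0 = 0 \<and>
     (\<forall>i<length us. nmem s 37 (Suc i) 0 = us ! i)"

lemma length_tsp: "length A = Suc n"
  using tsp_tour distinct_card[of A] by (simp add: tsp_tour_def vertices_def)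

lemma sequence_body_value:
  assumes s: "inputs s" "buffer s D []" and i: "nmem s 21 0 0 = i" "i \<le> n"
    and us: "nmem s 36 0 0 = f" "holds_sequence s us"
  defines "s' \<equiv> den sequence_body s" and "r \<equiv> scan (served D) (f, us) (A ! i)"
  shows "nmem s' 36 0 0 = fst r" "holds_sequence s' (snd r)"
proof -
  define v where "v = A ! i"
  have "A ! i \<in> set A" using i(2) length_tsp by (intro nth_mem) simp
  moreover have "set A = vertices n" using tsp_tour by (simp add: tsp_tour_def)
  ultimately have "v \<in> vertices n" by (simp only: v_def)
  then have v: "v \<le> n" by (simp add: vertices_iff)
  have Av: "nmem s 2 i 0 = v" using inputsD(4)[OF s(1) i(2)] by (simp only: v_def)
  have v6: "nmem s 6 v 0 < 1 \<longleftrightarrow> v \<notin> served D" using buffer_served[OF s(2) v] by simp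
  have hs: "nmem s 35 0 0 = length us" "nmem s 37 0 0 = 0" "\<And>i. i < length us \<Longrightarrow> nmem s 37 (Suc i) 0 = us ! i"
    using us(2) by (simp_all add: holds_sequence_def)
  define s0 where "s0 = nset 20 0 0 v s"
  define b where "b = Conj (NLess (Lit 0) (NV 36)) (NLess (cell 6 (NV 20)) (Lit 1))"
  have b: "bval b s0 \<longleftrightarrow> 0 < f \<and> v \<notin> served D"
    unfolding b_def s0_def v6[symmetric] using us(1) by (simp add: nmem_nset)
  have s': "s' = (if 0 < v then if bval b s0 then nset 37 (Suc (length us)) 0 v (nset 35 0 0 (Suc (length us)) s0) else s0
      else nset 36 0 0 (1 - f) s0)"
    unfolding s'_def sequence_body_def b_def[symmetric]
    using i(1) Av us(1) hs(1) by (simp add: s0_def nmem_nset)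
  have r: "r = (if 0 < v then if bval b s0 then (f, us @ [v]) else (f, us) else (1 - f, us))"
    unfolding r_def scan_def b v_def[symmetric] by simp
  have s0: "nmem s0 35 0 0 = length us" "nmem s0 37 i 0 = nmem s 37 i 0" "nmem s0 36 0 0 = f" for i
    using hs(1) us(1) by (simp_all add: s0_def nmem_nset)
  show "nmem s' 36 0 0 = fst r" unfolding s' r by (simp add: nmem_nset s0)
  show "holds_sequence s' (snd r)"
    unfolding s' r holds_sequence_def using hs(2,3) by (auto simp: nmem_nset s0 nth_append less_Suc_eq)
qed

lemma nwrites_sequence: "nwrites sequence = {20, 21, 34, 35, 36, 37}" "rwrites sequence = {}"
  by (auto simp: sequence_def sequence_body_def)

lemma sequence_spec:
  assumes s: "inputs s" "buffer s D []"
  obtains us where "holds_sequence (den sequence s) us" "distinct us" "set us = customers n - served D"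
    "walk_cost c 0 (us @ [0]) \<le> cycle_cost c A"
proof -
  define C where "C = served D"
  define s1 where "s1 = nset 37 0 0 0 (nset 36 0 0 0 (nset 35 0 0 0 s))"
  define f where "f = den sequence_body"
  define g where "g = (\<lambda>t. loop f 21 (Suc n) t)"
  define J where "J st t \<longleftrightarrow> inputs t \<and> buffer t D [] \<and> nmem t 36 0 0 = fst st \<and> holds_sequence t (snd st)" for st t
  have J_set: "J st (nset a i j x t)" if "J st t" "a \<in> {21, 34}" for st t a i j x
    using that by (auto simp: J_def inputs_nset buffer_nset nmem_nset_other holds_sequence_def)
  have inner: "J (foldl (scan C) st A) (g t)" if J: "J st t" for st t
  proof -
    have "J (foldl (scan C) st (take (Suc n) A)) (loop f 21 (Suc n) t)"
    proof (rule loop_rule[where I = "\<lambda>i. J (foldl (scan C) st (take i A))"])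
      show "J (foldl (scan C) st (take 0 A)) (nset 21 0 0 0 t)" using J_set[OF J] by simp
    next
      fix i u assume i: "i < Suc n" "nmem u 21 0 0 = i" and Ju: "J (foldl (scan C) st (take i A)) u"
      obtain e us where eu: "foldl (scan C) st (take i A) = (e, us)" by (cases "foldl (scan C) st (take i A)")
      have u: "inputs u" "buffer u D []" "nmem u 36 0 0 = e" "holds_sequence u us"
        using Ju unfolding eu by (simp_all add: J_def)
      have "i \<le> n" using i by simp
      note b = sequence_body_value[OF u(1,2) i(2) \<open>i \<le> n\<close> u(3,4)]
      have "inputs (f u)" unfolding f_def by (rule inputs_den[OF u(1)]) (simp_all add: sequence_body_def)
      moreover have "buffer (f u) D []" unfolding f_def by (rule buffer_den[OF u(2)]) (simp_all add: sequence_body_def)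
      ultimately have "J (scan C (e, us) (A ! i)) (f u)" using b by (simp add: J_def C_def f_def)
      moreover have "foldl (scan C) st (take (Suc i) A) = scan C (e, us) (A ! i)"
        using i length_tsp eu by (simp add: take_Suc_conv_app_nth)
      ultimately show "J (foldl (scan C) st (take (Suc i) A)) (nset 21 0 0 (Suc i) (f u))"
        using J_set[of _ _ 21] by simp
    qed
    then show ?thesis by (simp add: g_def length_tsp)
  qed
  have J0: "J (0, []) s1" using s by (simp add: J_def s1_def inputs_nset buffer_nset nmem_nset holds_sequence_def)
  define t1 where "t1 = nset 34 0 0 0 s1"
  define t2 where "t2 = nset 34 0 0 (Suc 0) (g t1)"
  have J1: "J (0, []) t1" unfolding t1_def by (rule J_set[OF J0]) simp
  have J2: "J (foldl (scan C) (0, []) A) t2" unfolding t2_def by (rule J_set[OF inner[OF J1]]) simp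
  have J3: "J (foldl (scan C) (foldl (scan C) (0, []) A) A) (nset 34 0 0 (Suc (Suc 0)) (g t2))"
    by (rule J_set[OF inner[OF J2]]) simp
  have dg: "den (For 21 None sequence_body) t = g t" if "J st t" for t st
  proof -
    have "inputs t" using that unfolding J_def by blast
    from loop_count[OF this] show ?thesis by (simp only: den.simps(6) g_def f_def)
  qed
  have "den sequence s = loop (den (For 21 None sequence_body)) 34 (Suc (Suc 0)) s1"
    by (simp only: sequence_def den.simps(2,4) den.simps(6)[of 34] loop_bound.simps nval.simps s1_def numeral_2_eq_2)
  also have "\<dots> = nset 34 0 0 (Suc (Suc 0)) (g t2)"
    by (simp only: loop.simps t1_def[symmetric] dg[OF J1] t2_def[symmetric] dg[OF J2])
  finally have J: "J (foldl (scan C) (foldl (scan C) (0, []) A) A) (den sequence s)" using J3 by simp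
  have "0 \<in> set A" using tsp_tour by (auto simp: tsp_tour_def)
  from split_list[OF this] obtain xs ys where A: "A = xs @ 0 # ys" by blast
  have "tsp_tour n (xs @ 0 # ys)" using tsp_tour by (simp only: A)
  then have dA: "distinct (xs @ 0 # ys)" "set (xs @ 0 # ys) = vertices n"
    unfolding tsp_tour_def by blast+
  have nz: "0 \<notin> set xs" "0 \<notin> set ys" using dA(1) by auto
  define us where "us = filter (\<lambda>v. v \<notin> C) (ys @ xs)"
  have fold: "foldl (scan C) (foldl (scan C) (0, []) A) A = (0, us)"
    using scan_twice[OF nz, of C] by (simp only: A us_def)
  have "set (ys @ xs) = set (xs @ 0 # ys) - {0}" using nz by auto
  then have "set (ys @ xs) = vertices n - {0}" by (simp only: dA(2))
  moreover have "vertices n - {0} = customers n" by (auto simp: vertices_def customers_def)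
  ultimately have cust: "set (ys @ xs) = customers n" by (rule trans)
  have "set us = set (ys @ xs) - C" unfolding us_def by auto
  then have set_us: "set us = customers n - served D" by (simp only: cust C_def)
  have dist: "distinct us" unfolding us_def using dA(1) by auto
  have cost: "walk_cost c 0 (us @ [0]) \<le> cycle_cost c A"
  proof -
    have "set (ys @ xs) \<subseteq> vertices n" unfolding cust using customer_vertex by blast
    then have "walk_cost c 0 (us @ [0]) \<le> walk_cost c 0 ((ys @ xs) @ [0])"
      unfolding us_def by (intro walk_cost_subseq subseq_filter_left depot_vertex)
    also have "\<dots> = cycle_cost c A" by (simp only: A cycle_cost_rotate append_assoc)
    finally show ?thesis .
  qed
  have "holds_sequence (den sequence s) us" using J unfolding fold J_def by simp
  from that[OF this dist set_us cost] show ?thesis .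
qed

end

text \<open>\<open>R7[j]\<close> is the least cost of a segmentation of the first \<open>j\<close> customers of the sequence, and
  \<open>N38[j]\<close> the start of its last segment. For the target \<open>j = N39\<close>, the starts \<open>j - 1, \<dots>, 0\<close> are
  tried in this order; \<open>N23\<close> and \<open>R3\<close> are the load and the length of the segment.\<close>

definition dp_inner :: prog where
  "dp_inner = Ite (NLess (NV 25) (NV 39))
     (setv 40 (NMinus (NMinus (NV 39) (Lit 1)) (NV 25)) ;;
      setv 23 (NPlus (NV 23) (cell 1 (cell 37 (NPlus (NV 40) (Lit 1))))) ;;
      rsetv 4 (RPlus (RAt 7 (NV 40) (Lit 0)) (RPlus (RAt 0 (Lit 0) (cell 37 (NPlus (NV 40) (Lit 1)))) (RV 3))) ;;
      Ite (Conj (Neg (NLess cap (NV 23))) (Neg (Conj (NLess (Lit 0) (NV 25)) (Neg (RLess (RV 4) (RAt 7 (NV 39) (Lit 0)))))))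
        (RSet 7 (NV 39) (Lit 0) (RV 4) ;; NSet 38 (NV 39) (Lit 0) (NV 40)) Noop ;;
      rsetv 3 (RPlus (RV 3) (RAt 0 (cell 37 (NV 40)) (cell 37 (NPlus (NV 40) (Lit 1))))))
     Noop"

definition dp_outer :: prog where
  "dp_outer = setv 39 (NPlus (NV 21) (Lit 1)) ;;
     Ite (Neg (NLess (NV 35) (NV 39)))
       (setv 23 (Lit 0) ;; rsetv 3 (RAt 0 (cell 37 (NV 39)) (Lit 0)) ;; For 25 None dp_inner) Noop"

definition dp :: prog where
  "dp = RSet 7 (Lit 0) (Lit 0) (lit 0) ;; For 21 None dp_outer"

definition recover_body :: prog where
  "recover_body = Ite (NLess (NV 21) (NV 35))
     (setv 40 (NMinus (NV 35) (NV 21)) ;; setv 20 (cell 37 (NV 40)) ;; push ;;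
      Ite (is_neq (NV 41) (NMinus (NV 40) (Lit 1))) Noop
        (setv 20 (Lit 0) ;; push ;; setv 41 (cell 38 (NMinus (NV 40) (Lit 1)))))
     Noop"

definition recover :: prog where
  "recover = setv 41 (cell 38 (NV 35)) ;; For 21 None recover_body"

text \<open>Index 0 is the depot: the last length update of \<open>dp_inner\<close> reaches one
  place before the first customer and must still read a vertex.\<close>

definition position :: "nat list \<Rightarrow> nat \<Rightarrow> nat" where
  "position us i = (if i = 0 then 0 else us ! (i - 1))"

section \<open>Correctness of the dynamic program\<close>

context cvrp_tsp
begin

definition segment_load :: "(nat \<Rightarrow> nat) \<Rightarrow> nat \<Rightarrow> nat \<Rightarrow> nat" where
  "segment_load U i j = (\<Sum>l\<in>{i<..j}. d (U l))"

text \<open>Two things are recorded about the e starts tried: the Bellman inequality, which bounds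
  the value by any segmentation, and its attainment at the stored start, which lets the segmentation
  be recovered at exactly this cost.\<close>

definition optimal_upto :: "(nat \<Rightarrow> nat) \<Rightarrow> (nat \<Rightarrow> real) \<Rightarrow> (nat \<Rightarrow> nat) \<Rightarrow> nat \<Rightarrow> nat \<Rightarrow> bool" where
  "optimal_upto U best prd j e \<longleftrightarrow>
     (\<forall>i. j - e \<le> i \<and> i < j \<and> segment_load U i j \<le> k \<longrightarrow> best j \<le> best i + segment_cost U i j) \<and>
     prd j < j \<and> segment_load U (prd j) j \<le> k \<and> best j = best (prd j) + segment_cost U (prd j) j"

lemma optimal_cong:
  assumes "optimal_upto U best prd j e" "\<And>i. i \<le> j \<Longrightarrow> best' i = best i" "prd' j = prd j"
  shows "optimal_upto U best' prd' j e"
  using assms unfolding optimal_upto_def by (metis less_imp_le order_refl)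

lemma position_customer:
  assumes "set us \<subseteq> customers n" "0 < i" "i \<le> length us"
  shows "position us i \<in> customers n"
  using assms nth_mem[of "i - 1" us] by (auto simp: position_def)

lemma position_vertex:
  assumes "set us \<subseteq> customers n" "i \<le> length us"
  shows "position us i \<in> vertices n"
  using position_customer[OF assms(1) _ assms(2)] customer_vertex by (cases "i = 0") (auto simp: position_def)

lemma holds_sequence_position:
  "holds_sequence s us \<Longrightarrow> i \<le> length us \<Longrightarrow> nmem s 37 i 0 = position us i"
  by (cases i) (auto simp: holds_sequence_def position_def)

text \<open>The state of the inner loop after the \<open>e\<close> starts \<open>j - 1, \<dots>, j - e\<close> have been tried.\<close>

definition dp_state :: "nat list \<Rightarrow> nat \<Rightarrow> nat \<Rightarrow> state \<Rightarrow> bool" where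
  "dp_state us j e t \<longleftrightarrow> inputs t \<and> holds_sequence t us \<and> nmem t 39 0 0 = j \<and>
     nmem t 23 0 0 = segment_load (position us) (j - e) j \<and>
     rmem t 3 0 0 = (\<Sum>l\<in>{j - e..<j}. c (position us l) (position us (Suc l))) + c (position us j) 0 \<and>
     (0 < e \<longrightarrow> optimal_upto (position us) (\<lambda>i. rmem t 7 i 0) (\<lambda>i. nmem t 38 i 0) j e)"

lemma dp_inner_value:
  assumes us: "set us \<subseteq> customers n" and j: "j \<le> length us"
    and t: "dp_state us j e t" "nmem t 25 0 0 = e" "e < j"
  shows "dp_state us j (Suc e) (den dp_inner t) \<and>
    (\<forall>i. i \<noteq> j \<longrightarrow> rmem (den dp_inner t) 7 i 0 = rmem t 7 i 0 \<and> nmem (den dp_inner t) 38 i 0 = nmem t 38 i 0)"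
proof -
  define U where "U = position us"
  define i where "i = j - 1 - e"
  have i: "Suc i = j - e" "i < j" "j - Suc e = i" using t(3) by (simp_all add: i_def)
  have inp: "inputs t" and seq: "holds_sequence t us" and t39: "nmem t 39 0 0 = j"
    and t23: "nmem t 23 0 0 = segment_load U (Suc i) j"
    and t3: "rmem t 3 0 0 = (\<Sum>l\<in>{Suc i..<j}. c (U l) (U (Suc l))) + c (U j) 0"
    and opt: "0 < e \<Longrightarrow> optimal_upto U (\<lambda>i. rmem t 7 i 0) (\<lambda>i. nmem t 38 i 0) j e"
    using t(1) i unfolding dp_state_def U_def by simp_all
  have Ui: "nmem t 37 i 0 = U i" "nmem t 37 (Suc i) 0 = U (Suc i)"
    using holds_sequence_position[OF seq] j i by (simp_all add: U_def)
  have cust: "U (Suc i) \<in> customers n" using position_customer[OF us, of "Suc i"] i j by (simp add: U_def)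
  have vert: "U i \<in> vertices n" "U (Suc i) \<in> vertices n"
    using position_vertex[OF us, of i] customer_vertex[OF cust] i j by (simp_all add: U_def)
  have du: "nmem t (Suc 0) (U (Suc i)) 0 = d (U (Suc i))" using inputsD(3)[OF inp cust] by simp
  have cu: "rmem t 0 0 (U (Suc i)) = c 0 (U (Suc i))" "rmem t 0 (U i) (U (Suc i)) = c (U i) (U (Suc i))"
    using inputsD(5)[OF inp] vert by simp_all
  have kk: "nmem t 0 0 (Suc 0) = k" using inputsD(2)[OF inp] by simp
  have load: "segment_load U (Suc i) j + d (U (Suc i)) = segment_load U i j"
  proof -
    have "{i<..j} = insert (Suc i) {Suc i<..j}" using i by auto
    then show ?thesis by (simp add: segment_load_def)
  qed
  define cand where "cand = rmem t 7 i 0 + segment_cost U i j"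
  have cand: "rmem t 7 i 0 + (c 0 (U (Suc i)) + rmem t 3 0 0) = cand"
    by (simp add: cand_def t3 segment_cost_def)
  have sum: "rmem t 3 0 0 + c (U i) (U (Suc i)) = (\<Sum>l\<in>{i..<j}. c (U l) (U (Suc l))) + c (U j) 0"
    using i by (simp add: t3 sum.atLeast_Suc_lessThan[of i j])
  \<comment> \<open>At e = 0 the cell holds no candidate yet. The segment of one customer always
    fits and is stored unconditionally, which replaces an infinite initial value.\<close>
  define b where "b \<longleftrightarrow> segment_load U i j \<le> k \<and> (e = 0 \<or> cand < rmem t 7 j 0)"
  define t1 where "t1 = rset 4 0 0 cand (nset 23 0 0 (segment_load U i j) (nset 40 0 0 i t))"
  define t2 where "t2 = (if b then nset 38 j 0 i (rset 7 j 0 cand t1) else t1)"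
  define t' where "t' = rset 3 0 0 (rmem t 3 0 0 + c (U i) (U (Suc i))) t2"
  define bb where "bb = Conj (Neg (NLess cap (NV 23))) (Neg (Conj (NLess (Lit 0) (NV 25)) (Neg (RLess (RV 4) (RAt 7 (NV 39) (Lit 0))))))"
  have bb: "bval bb t1 \<longleftrightarrow> b"
    unfolding bb_def b_def t1_def using kk t(2) t39 by (auto simp: nmem_nset rmem_rset)
  have lt: "bval (NLess (NV 25) (NV 39)) t" using t(2,3) t39 by simp
  have pre: "den (rsetv 4 (RPlus (RAt 7 (NV 40) (Lit 0)) (RPlus (RAt 0 (Lit 0) (cell 37 (NPlus (NV 40) (Lit 1)))) (RV 3))))
      (den (setv 23 (NPlus (NV 23) (cell 1 (cell 37 (NPlus (NV 40) (Lit 1))))))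
        (den (setv 40 (NMinus (NMinus (NV 39) (Lit 1)) (NV 25))) t)) = t1"
    by (simp add: t1_def nmem_nset t39 t(2) i(3) Ui du t23 load cu cand)
  have step: "den dp_inner t = den (rsetv 3 (RPlus (RV 3) (RAt 0 (cell 37 (NV 40)) (cell 37 (NPlus (NV 40) (Lit 1))))))
      (if bval bb t1 then den (RSet 7 (NV 39) (Lit 0) (RV 4) ;; NSet 38 (NV 39) (Lit 0) (NV 40)) t1 else t1)"
    unfolding dp_inner_def bb_def[symmetric] den.simps(4) den.simps(5)[of "NLess (NV 25) (NV 39)"] den.simps(5)[of bb]
    using lt pre by (simp only: if_True den.simps(1))
  have t2_mem: "nmem t2 37 = nmem t 37" "nmem t2 40 0 0 = i" "rmem t2 3 = rmem t 3" "rmem t2 0 = rmem t 0"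
    by (simp_all add: t2_def t1_def nmem_nset nmem_nset_other rmem_rset_other)
  have "(if bval bb t1 then den (RSet 7 (NV 39) (Lit 0) (RV 4) ;; NSet 38 (NV 39) (Lit 0) (NV 40)) t1 else t1) = t2"
    unfolding bb t2_def using t39 by (simp add: t1_def nmem_nset rmem_rset)
  then have den: "den dp_inner t = t'"
    unfolding step t'_def by (simp add: t2_mem Ui cu)
  have mem': "rmem t' 7 l 0 = (if b \<and> l = j then cand else rmem t 7 l 0)"
    "nmem t' 38 l 0 = (if b \<and> l = j then i else nmem t 38 l 0)" for l
    by (simp_all add: t'_def t2_def t1_def nmem_nset rmem_rset)
  have opt': "optimal_upto U (\<lambda>i. rmem t' 7 i 0) (\<lambda>i. nmem t' 38 i 0) j (Suc e)"
  proof (cases b)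
    case True
    have "cand \<le> rmem t 7 l 0 + segment_cost U l j"
      if l: "i \<le> l" "l < j" "segment_load U l j \<le> k" for l
    proof (cases "l = i")
      case False
      then have le: "Suc i \<le> l" using l by simp
      then have e: "0 < e" using i l by simp
      have "rmem t 7 j 0 \<le> rmem t 7 l 0 + segment_cost U l j"
      proof -
        have "j - e \<le> l" using le i(1) by simp
        then show ?thesis using opt[OF e] l unfolding optimal_upto_def by blast
      qed
      then show ?thesis using True e by (simp add: b_def)
    qed (simp add: cand_def)
    moreover have "segment_load U i j \<le> k" using True by (simp add: b_def)
    ultimately show ?thesis
      using True i unfolding optimal_upto_def mem' by (auto simp: cand_def)
  next
    case False
    have e: "0 < e"
    proof (rule ccontr)
      assume "\<not> 0 < e"
      then have "j = Suc i" using i by simp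
      then have "{i<..j} = {Suc i}" by auto
      then have "segment_load U i j \<le> k" using demand[OF cust] by (simp add: segment_load_def)
      then show False using False \<open>\<not> 0 < e\<close> by (simp add: b_def)
    qed
    have o: "optimal_upto U (\<lambda>i. rmem t 7 i 0) (\<lambda>i. nmem t 38 i 0) j e" by (rule opt[OF e])
    have "rmem t 7 j 0 \<le> rmem t 7 l 0 + segment_cost U l j"
      if l: "i \<le> l" "l < j" "segment_load U l j \<le> k" for l
    proof (cases "l = i")
      case True
      then show ?thesis using False l e by (simp add: b_def cand_def)
    next
      case False
      then have "j - e \<le> l" using l i(1) by simp
      then show ?thesis using o l unfolding optimal_upto_def by blast
    qed
    then show ?thesis using o False i unfolding optimal_upto_def mem' by simp
  qed
  have "inputs t'" "holds_sequence t' us" "nmem t' 39 0 0 = j" "nmem t' 23 0 0 = segment_load U i j"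
    using inp seq t39
    by (simp_all add: t'_def t2_def t1_def inputs_nset inputs_rset holds_sequence_def nmem_nset nmem_nset_other)
  moreover have "rmem t' 3 0 0 = (\<Sum>l\<in>{i..<j}. c (U l) (U (Suc l))) + c (U j) 0"
    by (simp add: t'_def rmem_rset sum)
  ultimately have "dp_state us j (Suc e) t'"
    using opt' unfolding dp_state_def i(3) U_def by simp
  then show ?thesis unfolding den using mem' by simp
qed

lemma dp_outer_value:
  assumes us: "set us \<subseteq> customers n" and j: "nmem s 21 0 0 = j" "j < length us" and len: "length us \<le> n"
    and s: "inputs s" "holds_sequence s us"
  shows "holds_sequence (den dp_outer s) us"
    "optimal_upto (position us) (\<lambda>i. rmem (den dp_outer s) 7 i 0) (\<lambda>i. nmem (den dp_outer s) 38 i 0) (Suc j) (Suc j)"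
    "\<And>i. i \<noteq> Suc j \<Longrightarrow> rmem (den dp_outer s) 7 i 0 = rmem s 7 i 0 \<and> nmem (den dp_outer s) 38 i 0 = nmem s 38 i 0"
proof -
  define J where "J = Suc j"
  define s1 where "s1 = rset 3 0 0 (c (position us J) 0) (nset 23 0 0 0 (nset 39 0 0 J s))"
  define f where "f = den dp_inner"
  have JU: "position us J \<in> vertices n" using position_vertex[OF us, of J] j by (simp add: J_def)
  have RJ: "rmem s 0 (nmem s 37 J 0) 0 = c (position us J) 0"
    using holds_sequence_position[OF s(2), of J] inputsD(5)[OF s(1) JU depot_vertex] j by (simp add: J_def)
  have s1: "inputs s1" "holds_sequence s1 us"
    using s by (simp_all add: s1_def inputs_nset inputs_rset holds_sequence_def nmem_nset)
  have m35: "nmem s 35 0 0 = length us" using s(2) by (simp add: holds_sequence_def)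
  have "den dp_outer s = den (For 25 None dp_inner) s1"
    using j RJ m35 by (simp add: dp_outer_def s1_def nmem_nset J_def del: den.simps(6))
  then have den: "den dp_outer s = loop f 25 (Suc n) s1"
    using loop_count[OF s1(1)] by (simp add: f_def)
  \<comment> \<open>The loop makes n + 1 rounds for every target; those after round J are
    idle.\<close>
  define I where "I e t \<longleftrightarrow> dp_state us J (min e J) t \<and>
     (\<forall>i. i \<noteq> J \<longrightarrow> rmem t 7 i 0 = rmem s 7 i 0 \<and> nmem t 38 i 0 = nmem s 38 i 0)" for e t
  have I_set: "I e (nset 25 a b x t)" if "I e t" for e a b x t
    using that by (simp add: I_def dp_state_def inputs_nset holds_sequence_def nmem_nset)
  have fin: "I (Suc n) (loop f 25 (Suc n) s1)"
  proof (rule loop_rule)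
    have "I 0 s1"
      using s1 by (simp add: I_def dp_state_def segment_load_def)
        (simp add: s1_def nmem_nset rmem_rset)
    then show "I 0 (nset 25 0 0 0 s1)" by (rule I_set)
  next
    fix e t assume e: "e < Suc n" "nmem t 25 0 0 = e" and I: "I e t"
    have "I (Suc e) (f t)"
    proof (cases "e < J")
      case True
      have "dp_state us J e t" using I True by (simp add: I_def)
      from dp_inner_value[OF us _ this e(2) True] show ?thesis
        using I True j(2) by (simp add: I_def f_def J_def)
    next
      case False
      have "nmem t 39 0 0 = J" using I by (simp add: I_def dp_state_def)
      then have "f t = t" using False e(2) by (simp add: f_def dp_inner_def)
      then show ?thesis using I False by (simp add: I_def min_absorb2)
    qed
    then show "I (Suc e) (nset 25 0 0 (Suc e) (f t))" by (rule I_set)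
  qed
  have "min (Suc n) J = J" using j len by (simp add: J_def)
  then have I: "dp_state us J J (den dp_outer s)"
    "\<And>i. i \<noteq> J \<Longrightarrow> rmem (den dp_outer s) 7 i 0 = rmem s 7 i 0 \<and> nmem (den dp_outer s) 38 i 0 = nmem s 38 i 0"
    using fin unfolding I_def den by simp_all
  then show "holds_sequence (den dp_outer s) us"
    "optimal_upto (position us) (\<lambda>i. rmem (den dp_outer s) 7 i 0) (\<lambda>i. nmem (den dp_outer s) 38 i 0) (Suc j) (Suc j)"
    "\<And>i. i \<noteq> Suc j \<Longrightarrow> rmem (den dp_outer s) 7 i 0 = rmem s 7 i 0 \<and> nmem (den dp_outer s) 38 i 0 = nmem s 38 i 0"
    by (simp_all add: dp_state_def J_def)
qed

lemma dp_spec: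
  assumes us: "set us \<subseteq> customers n" and len: "length us \<le> n"
    and s: "inputs s" "holds_sequence s us"
  defines "s' \<equiv> den dp s"
  shows "holds_sequence s' us" "rmem s' 7 0 0 = 0"
    "\<And>j. 0 < j \<Longrightarrow> j \<le> length us \<Longrightarrow> optimal_upto (position us) (\<lambda>i. rmem s' 7 i 0) (\<lambda>i. nmem s' 38 i 0) j j"
proof -
  define s1 where "s1 = rset 7 0 0 0 s"
  define f where "f = den dp_outer"
  have s1: "inputs s1" "holds_sequence s1 us" using s by (simp_all add: s1_def inputs_rset holds_sequence_def)
  define I where "I i t \<longleftrightarrow> inputs t \<and> holds_sequence t us \<and> rmem t 7 0 0 = 0 \<and>
     (\<forall>j. 0 < j \<and> j \<le> i \<and> j \<le> length us \<longrightarrow>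
        optimal_upto (position us) (\<lambda>i. rmem t 7 i 0) (\<lambda>i. nmem t 38 i 0) j j)" for i t
  have I_set: "I i (nset 21 a b x t)" if "I i t" for i a b x t
    using that by (simp add: I_def inputs_nset holds_sequence_def nmem_nset)
  have "I (Suc n) (loop f 21 (Suc n) s1)"
  proof (rule loop_rule)
    have "I 0 s1" using s1 by (simp add: I_def) (simp add: s1_def rmem_rset)
    then show "I 0 (nset 21 0 0 0 s1)" by (rule I_set)
  next
    fix i t assume i: "i < Suc n" "nmem t 21 0 0 = i" and I: "I i t"
    have t: "inputs t" "holds_sequence t us" "rmem t 7 0 0 = 0" using I by (simp_all add: I_def)
    have inp: "inputs (f t)" unfolding f_def by (rule inputs_den[OF t(1)]) (simp_all add: dp_outer_def dp_inner_def)
    have "I (Suc i) (f t)"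
    proof (cases "i < length us")
      case True
      note o = dp_outer_value[OF us i(2) True len t(1,2), folded f_def]
      have "optimal_upto (position us) (\<lambda>i. rmem (f t) 7 i 0) (\<lambda>i. nmem (f t) 38 i 0) j j"
        if j: "0 < j" "j \<le> Suc i" "j \<le> length us" for j
      proof (cases "j = Suc i")
        case False
        have "optimal_upto (position us) (\<lambda>i. rmem t 7 i 0) (\<lambda>i. nmem t 38 i 0) j j"
          using I j False by (simp add: I_def)
        then show ?thesis by (rule optimal_cong) (use o(3) j False in auto)
      qed (use o(2) in simp)
      moreover have "rmem (f t) 7 0 0 = 0" using o(3)[of 0] t(3) by simp
      ultimately show ?thesis unfolding I_def using inp o(1) by blast
    next
      case False
      have "nmem t 35 0 0 = length us" using t(2) by (simp add: holds_sequence_def)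
      then have "f t = nset 39 0 0 (Suc i) t" using False i(2) by (simp add: f_def dp_outer_def nmem_nset)
      moreover have "\<And>j. j \<le> Suc i \<and> j \<le> length us \<longleftrightarrow> j \<le> i \<and> j \<le> length us" using False by auto
      ultimately show ?thesis using I inp unfolding I_def
        by (simp add: holds_sequence_def nmem_nset)
    qed
    then show "I (Suc i) (nset 21 0 0 (Suc i) (f t))" by (rule I_set)
  qed
  moreover have "s' = loop f 21 (Suc n) s1"
    using loop_count[OF s1(1)] by (simp add: s'_def dp_def s1_def f_def)
  ultimately show "holds_sequence s' us" "rmem s' 7 0 0 = 0"
    "\<And>j. 0 < j \<Longrightarrow> j \<le> length us \<Longrightarrow> optimal_upto (position us) (\<lambda>i. rmem s' 7 i 0) (\<lambda>i. nmem s' 38 i 0) j j"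
    using len by (simp_all add: I_def)
qed

section \<open>Recovering the tours from the stored segment starts\<close>

text \<open>The segmentation is read off from its end, so each segment is emitted backwards;
  symmetry of the costs makes this harmless.\<close>

lemma walk_cost_rev_segment:
  assumes "i < j" "\<And>l. i < l \<Longrightarrow> l \<le> j \<Longrightarrow> U l \<in> vertices n"
  shows "walk_cost c u (map U (rev [Suc i..<Suc j])) = c u (U j) + (\<Sum>l\<in>{Suc i..<j}. c (U l) (U (Suc l)))"
  using assms
proof (induction j arbitrary: u)
  case (Suc j)
  show ?case
  proof (cases "i = j")
    case False
    then have ij: "i < j" using Suc.prems(1) by simp
    have "walk_cost c (U (Suc j)) (map U (rev [Suc i..<Suc j])) = c (U (Suc j)) (U j) + (\<Sum>l\<in>{Suc i..<j}. c (U l) (U (Suc l)))"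
      using ij Suc.prems(2) by (intro Suc.IH) auto
    moreover have "c (U (Suc j)) (U j) = c (U j) (U (Suc j))"
      using Suc.prems(2)[of j] Suc.prems(2)[of "Suc j"] ij by (intro cost_sym) auto
    moreover have "{Suc i..<Suc j} = insert j {Suc i..<j}" using ij by auto
    moreover have "[Suc i..<Suc (Suc j)] = [Suc i..<Suc j] @ [Suc j]" using ij by simp
    ultimately show ?thesis by (simp del: upt_Suc)
  qed simp
qed simp

lemma tour_cost_rev_segment:
  assumes "i < j" "\<And>l. i < l \<Longrightarrow> l \<le> j \<Longrightarrow> U l \<in> vertices n"
  shows "tour_cost c (map U (rev [Suc i..<Suc j])) = segment_cost U i j"
proof -
  have "rev [Suc i..<Suc j] = rev [Suc (Suc i)..<Suc j] @ [Suc i]"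
    using assms(1) by (simp add: upt_conv_Cons del: upt_Suc)
  then have "last (0 # map U (rev [Suc i..<Suc j])) = U (Suc i)" by (simp del: upt_Suc)
  then have "tour_cost c (map U (rev [Suc i..<Suc j])) = walk_cost c 0 (map U (rev [Suc i..<Suc j])) + c (U (Suc i)) 0"
    unfolding tour_cost_eq_path walk_cost_snoc by simp
  also have "walk_cost c 0 (map U (rev [Suc i..<Suc j])) = c 0 (U j) + (\<Sum>l\<in>{Suc i..<j}. c (U l) (U (Suc l)))"
    by (rule walk_cost_rev_segment[OF assms])
  finally show ?thesis
    using cost_sym[of "U j" 0] cost_sym[of "U (Suc i)" 0] assms(1) assms(2)[of j] assms(2)[of "Suc i"]
    by (simp add: segment_cost_def)
qed

lemma load_rev_segment: "i \<le> j \<Longrightarrow> sum_list (map d (map U (rev [Suc i..<Suc j]))) = segment_load U i j"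
proof -
  assume "i \<le> j"
  have "{i<..j} = set [Suc i..<Suc j]" by auto
  then have "segment_load U i j = sum_list (map (\<lambda>l. d (U l)) [Suc i..<Suc j])"
    unfolding segment_load_def by (simp only: sum_list_distinct_conv_sum_set distinct_upt)
  then show ?thesis by (simp add: rev_map[symmetric] comp_def del: upt_Suc)
qed

lemma position_inj:
  assumes "distinct us" "0 < i" "i \<le> length us" "0 < j" "j \<le> length us" "position us i = position us j"
  shows "i = j"
proof -
  have "us ! (i - 1) = us ! (j - 1)" using assms by (simp add: position_def)
  then have "i - 1 = j - 1" using assms nth_eq_iff_index_eq[OF assms(1), of "i - 1" "j - 1"] by simp
  then show ?thesis using assms by simp
qed

lemma position_image: "position us ` {0<..length us} = set us"
proof
  show "set us \<subseteq> position us ` {0<..length us}"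
  proof
    fix v assume "v \<in> set us"
    then obtain i where "i < length us" "us ! i = v" by (auto simp: in_set_conv_nth)
    then show "v \<in> position us ` {0<..length us}" by (intro image_eqI[of _ _ "Suc i"]) (auto simp: position_def)
  qed
qed (auto simp: position_def)

text \<open>The state after the customers at positions \<open>l + 1, \<dots>, m\<close> have been pushed, where \<open>j\<close> is the end of
  the segment being pushed.\<close>

definition recover_state ::
    "nat list \<Rightarrow> (nat \<Rightarrow> real) \<Rightarrow> (nat \<Rightarrow> nat) \<Rightarrow> nat list list \<Rightarrow> nat \<Rightarrow> nat \<Rightarrow> nat list list \<Rightarrow> state \<Rightarrow> bool" where
  "recover_state us best prd D l j D' t \<longleftrightarrow>
     inputs t \<and> holds_sequence t us \<and> (\<forall>i. nmem t 38 i 0 = prd i) \<and> l \<le> j \<and> j \<le> length us \<and>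
     (0 < j \<longrightarrow> nmem t 41 0 0 = prd j) \<and> (l < j \<longrightarrow> prd j < l) \<and>
     buffer t D' (map (position us) (rev [Suc l..<Suc j])) \<and> valid_tours D' \<and>
     served D' = served D \<union> position us ` {j<..length us} \<and>
     tours_cost D' + best j = tours_cost D + best (length us)"

lemma recover_body_value:
  assumes us: "set us = customers n - served D" "distinct us"
    and prd: "\<And>j. 0 < j \<Longrightarrow> j \<le> length us \<Longrightarrow>
      prd j < j \<and> segment_load (position us) (prd j) j \<le> k \<and> best j = best (prd j) + segment_cost (position us) (prd j) j"
    and t: "recover_state us best prd D (Suc l) j D' t" "nmem t 21 0 0 = length us - Suc l" "Suc l \<le> length us"
  shows "\<exists>j D'. recover_state us best prd D l j D' (den recover_body t)"
proof -
  define U where "U = position us"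
  define ys where "ys = map U (rev [Suc (Suc l)..<Suc j])"
  have inp: "inputs t" and seq: "holds_sequence t us" and t38: "\<And>i. nmem t 38 i 0 = prd i"
    and lj: "Suc l \<le> j" "j \<le> length us" and t41: "nmem t 41 0 0 = prd j" and pj: "Suc l < j \<Longrightarrow> prd j < Suc l"
    and buf: "buffer t D' ys" and val: "valid_tours D'"
    and sv: "served D' = served D \<union> U ` {j<..length us}"
    and cost: "tours_cost D' + best j = tours_cost D + best (length us)"
    using t(1) unfolding recover_state_def U_def ys_def by (auto simp del: upt_Suc)
  have j0: "0 < j" using lj by simp
  note P = prd[OF j0 lj(2), folded U_def]
  have prd_le: "prd j \<le> l" using P pj lj by (cases "Suc l < j") auto
  have cust: "set us \<subseteq> customers n" using us(1) by auto
  define v where "v = U (Suc l)"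
  have v: "v \<in> customers n" using position_customer[OF cust, of "Suc l"] t(3) by (simp add: v_def U_def)
  have v37: "nmem t 37 (Suc l) 0 = v" using holds_sequence_position[OF seq, of "Suc l"] t(3) by (simp add: v_def U_def)
  have "v \<in> set us" using position_image[of us] t(3) by (auto simp: v_def U_def)
  then have "v \<notin> served D" using us(1) by auto
  moreover have "v \<notin> U ` {Suc l<..length us}"
  proof
    assume "v \<in> U ` {Suc l<..length us}"
    then obtain x where x: "x \<in> {Suc l<..length us}" "v = U x" by (elim imageE) simp
    then have x': "Suc l < x" "x \<le> length us" by simp_all
    have "position us (Suc l) = position us x" using x(2) unfolding v_def U_def .
    from position_inj[OF us(2) _ t(3) _ x'(2) this] x' have "Suc l = x" by simp
    then show False using x'(1) by simp
  qed
  moreover have "served D' \<union> set ys \<subseteq> served D \<union> U ` {Suc l<..length us}"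
    using sv lj by (auto simp: ys_def)
  ultimately have fresh: "v \<notin> served D' \<union> set ys" by blast
  define t1 where "t1 = nset 20 0 0 v (nset 40 0 0 (Suc l) t)"
  have t1: "inputs t1" "buffer t1 D' ys" "nmem t1 20 0 0 = v"
    using inp buf by (simp_all add: t1_def inputs_nset buffer_nset nmem_nset)
  define t2 where "t2 = den push t1"
  define ys' where "ys' = map U (rev [Suc l..<Suc j])"
  have "[Suc l..<Suc j] = Suc l # [Suc (Suc l)..<Suc j]" using lj by (simp add: upt_conv_Cons del: upt_Suc)
  then have ys': "ys' = ys @ [v]" by (simp add: ys'_def ys_def v_def del: upt_Suc)
  have t2: "inputs t2" "buffer t2 D' ys'"
    unfolding ys' t2_def using inputs_push[OF t1(1)] push_customer[OF t1(1,2,3) v fresh] by simp_all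
  have keep: "nmem t2 a = nmem t1 a" if "a \<notin> {6, 7, 13, 14, 15}" for a
    unfolding t2_def by (rule nmem_den) (use that in \<open>simp add: nwrites_push\<close>)
  have t2m: "nmem t2 37 = nmem t 37" "nmem t2 38 = nmem t 38" "nmem t2 35 = nmem t 35" "nmem t2 41 0 0 = prd j" "nmem t2 40 0 0 = Suc l"
    using t41 by (simp_all add: keep t1_def nmem_nset nmem_nset_other)
  have t35: "nmem t 35 0 0 = length us" using seq by (simp add: holds_sequence_def)
  have seq2: "holds_sequence t2 us" using seq by (simp add: holds_sequence_def t2m)
  define last_prog where "last_prog = (setv 20 (Lit 0) ;; push ;; setv 41 (cell 38 (NMinus (NV 40) (Lit 1))))"
  define bb where "bb = is_neq (NV 41) (NMinus (NV 40) (Lit 1))"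
  have lt: "bval (NLess (NV 21) (NV 35)) t" using t(2,3) t35 by simp
  have pre: "den push (den (setv 20 (cell 37 (NV 40))) (den (setv 40 (NMinus (NV 35) (NV 21))) t)) = t2"
    using t(2,3) t35 v37 by (simp add: t2_def t1_def nmem_nset)
  have den: "den recover_body t = (if bval bb t2 then t2 else den last_prog t2)"
    unfolding recover_body_def last_prog_def[symmetric] bb_def[symmetric] den.simps(4)
      den.simps(5)[of "NLess (NV 21) (NV 35)"] den.simps(5)[of bb]
    using lt pre by (simp only: if_True den.simps(1))
  have bb: "bval bb t2 \<longleftrightarrow> prd j \<noteq> l" unfolding bb_def using t2m by auto
  show ?thesis
  proof (cases "prd j = l")
    case False
    then have "den recover_body t = t2" using den bb by (simp only: if_True not_False_eq_True)
    moreover have "prd j < l" using False prd_le by simp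
    ultimately have "recover_state us best prd D l j D' (den recover_body t)"
      unfolding recover_state_def
      using t2 seq2 t38 lj t2m val sv cost by (simp add: ys'_def U_def del: upt_Suc)
    then show ?thesis by blast
  next
    case True
    define t3 where "t3 = nset 20 0 0 0 t2"
    have t3: "inputs t3" "buffer t3 D' ys'" "nmem t3 20 0 0 = 0"
      using t2 by (simp_all add: t3_def inputs_nset buffer_nset nmem_nset)
    define D'' where "D'' = D' @ [ys']"
    have ne: "ys' \<noteq> []" by (simp add: ys')
    have t4: "inputs (den push t3)" "buffer (den push t3) D'' []"
      using inputs_push[OF t3(1)] push_depot[OF t3] ne by (simp_all add: D''_def)
    have keep': "nmem (den push t3) a = nmem t3 a" if "a \<notin> {6, 7, 13, 14, 15}" for a
      by (rule nmem_den) (use that in \<open>simp add: nwrites_push\<close>)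
    have den': "den recover_body t = nset 41 0 0 (prd l) (den push t3)"
    proof -
      have "den recover_body t = den last_prog t2" using den bb True by (simp only: if_False simp_thms)
      also have "\<dots> = nset 41 0 0 (prd l) (den push t3)"
        by (simp add: last_prog_def t3_def[symmetric] keep') (simp add: t3_def nmem_nset nmem_nset_other t2m t38)
      finally show ?thesis .
    qed
    have "sum_list (map d ys') = segment_load U l j"
      unfolding ys'_def using lj by (intro load_rev_segment) simp
    then have "sum_list (map d ys') \<le> k" using P True by simp
    then have val': "valid_tours D''" unfolding D''_def by (rule valid_tours_snoc[OF t3(2) ne _ val])
    have "tour_cost c ys' = segment_cost U l j"
      unfolding ys'_def using lj position_vertex[OF cust] by (intro tour_cost_rev_segment) (auto simp: U_def)
    then have cost': "tours_cost D'' + best l = tours_cost D + best (length us)"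
      using cost P True by (simp add: D''_def tours_cost_snoc)
    have "set ys' = U ` {l<..j}" by (auto simp: ys'_def)
    moreover have "{l<..length us} = {l<..j} \<union> {j<..length us}" using lj by auto
    ultimately have sv': "served D'' = served D \<union> U ` {l<..length us}"
      using sv by (auto simp: D''_def)
    have t4m: "nmem (den push t3) 35 = nmem t 35" "nmem (den push t3) 37 = nmem t 37" "nmem (den push t3) 38 = nmem t 38"
      by (simp_all add: keep') (simp_all add: t3_def nmem_nset_other t2m)
    have "recover_state us best prd D l l D'' (den recover_body t)"
      unfolding recover_state_def den'
      using t4 seq t38 t(3) val' sv' cost'
      by (simp add: inputs_nset buffer_nset U_def holds_sequence_def nmem_nset nmem_nset_other t4m)
    then show ?thesis by blast
  qed
qed

text \<open>Closing a segment moves its cost from \<open>best j\<close> to the emitted tours, so the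
  sum of both is invariant and telescopes down to \<open>best 0 = 0\<close>.\<close>

lemma recover_spec:
  assumes s: "inputs s" "buffer s D []" "valid_tours D" "holds_sequence s us" and len: "length us \<le> n"
    and us: "set us = customers n - served D" "distinct us"
    and best0: "best 0 = 0"
    and prd: "\<And>j. 0 < j \<Longrightarrow> j \<le> length us \<Longrightarrow>
      nmem s 38 j 0 < j \<and> segment_load (position us) (nmem s 38 j 0) j \<le> k \<and>
      best j = best (nmem s 38 j 0) + segment_cost (position us) (nmem s 38 j 0) j"
  obtains D' where "buffer (den recover s) D' []" "valid_tours D'" "served D' = served D \<union> set us"
    "tours_cost D' = tours_cost D + best (length us)"
proof -
  define m where "m = length us"
  define pr where "pr j = nmem s 38 j 0" for j
  define s1 where "s1 = nset 41 0 0 (pr m) s"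
  define f where "f = den recover_body"
  define I where "I e t \<longleftrightarrow> (\<exists>j D'. recover_state us best pr D (m - e) j D' t)" for e t
  have R_set: "recover_state us best pr D l j D' (nset 21 a b x t)"
    if "recover_state us best pr D l j D' t" for l j D' a b x t
    using that by (simp add: recover_state_def inputs_nset buffer_nset holds_sequence_def nmem_nset del: upt_Suc)
  have inp1: "inputs s1" using s by (simp add: s1_def inputs_nset)
  have "I (Suc n) (loop f 21 (Suc n) s1)"
  proof (rule loop_rule)
    have "recover_state us best pr D m m D s1"
      using s by (simp add: recover_state_def m_def s1_def inputs_nset buffer_nset holds_sequence_def nmem_nset pr_def)
    then show "I 0 (nset 21 0 0 0 s1)" unfolding I_def using R_set by fastforce
  next
    fix e t assume e: "e < Suc n" "nmem t 21 0 0 = e" and I: "I e t"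
    then obtain j D' where t: "recover_state us best pr D (m - e) j D' t" by (auto simp: I_def)
    have "\<exists>j D'. recover_state us best pr D (m - Suc e) j D' (f t)"
    proof (cases "e < m")
      case True
      define l where "l = m - Suc e"
      have l: "m - e = Suc l" "Suc l \<le> length us" "e = length us - Suc l" using True by (simp_all add: l_def m_def)
      show ?thesis
        unfolding l_def[symmetric] f_def
      proof (rule recover_body_value[OF us])
        show "recover_state us best pr D (Suc l) j D' t" using t l(1) by simp
        show "nmem t 21 0 0 = length us - Suc l" using e(2) l(3) by simp
        show "Suc l \<le> length us" by (rule l(2))
      qed (use prd in \<open>simp add: pr_def\<close>)
    next
      case False
      have "nmem t 35 0 0 = m" using t by (simp add: recover_state_def holds_sequence_def m_def)
      then have "f t = t" using False e(2) by (simp add: f_def recover_body_def)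
      then show ?thesis using t False by auto
    qed
    then show "I (Suc e) (nset 21 0 0 (Suc e) (f t))" unfolding I_def using R_set by blast
  qed
  moreover have "den recover s = loop f 21 (Suc n) s1"
  proof -
    have "nmem s 35 0 0 = m" using s(4) by (simp add: holds_sequence_def m_def)
    then have "den recover s = den (For 21 None recover_body) s1" by (simp add: recover_def s1_def pr_def)
    then show ?thesis using loop_count[OF inp1] by (simp add: f_def)
  qed
  ultimately obtain j D' where fin: "recover_state us best pr D 0 j D' (den recover s)"
    using len by (auto simp: I_def m_def)
  have "j = 0" using fin by (auto simp: recover_state_def)
  then show ?thesis
    using that[of D'] fin best0 position_image[of us] by (simp add: recover_state_def)
qed

end

section \<open>Output and the bound for the partitioned rest\<close>

definition copy_out :: prog where
  "copy_out = setv 3 (NV 13) ;;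
     For 21 None (NSet 5 (NV 21) (Lit 0) (cell 15 (NV 21)) ;;
       For 25 None (NSet 4 (NV 21) (NV 25) (NAt 14 (NV 21) (NV 25))))"

definition partition_rest :: prog where
  "partition_rest = solo ;; sequence ;; dp ;; recover"

lemma length_le_concat: "[] \<notin> set D \<Longrightarrow> length D \<le> length (concat D)"
proof (induction D)
  case (Cons x D)
  then have "1 \<le> length x" by (cases x) auto
  moreover have "length D \<le> length (concat D)" using Cons by simp
  ultimately show ?case by simp
qed simp

context cvrp_tsp
begin

lemma copy_out_value:
  assumes "inputs s"
  shows "nmem (den copy_out s) 3 0 0 = nmem s 13 0 0"
    "i \<le> n \<Longrightarrow> nmem (den copy_out s) 5 i 0 = nmem s 15 i 0"
    "i \<le> n \<Longrightarrow> j \<le> n \<Longrightarrow> nmem (den copy_out s) 4 i j = nmem s 14 i j"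
proof -
  define g where "g = den (NSet 4 (NV 21) (NV 25) (NAt 14 (NV 21) (NV 25)))"
  define s1 where "s1 = nset 3 0 0 (nmem s 13 0 0) s"
  have s1: "inputs s1" using assms by (simp add: s1_def inputs_nset)
  define f where "f = (\<lambda>t. loop g 25 (Suc n) (nset 5 (nmem t 21 0 0) 0 (nmem t 15 (nmem t 21 0 0) 0) t))"
  define I where "I m t \<longleftrightarrow> inputs t \<and> nmem t 3 = nmem s1 3 \<and> nmem t 14 = nmem s 14 \<and> nmem t 15 = nmem s 15 \<and>
      (\<forall>i<m. nmem t 5 i 0 = nmem s 15 i 0 \<and> (\<forall>j\<le>n. nmem t 4 i j = nmem s 14 i j))" for m t
  have I_set: "I m (nset 21 a b x t)" if "I m t" for m t a b x
    using that by (simp add: I_def inputs_nset nmem_nset nmem_nset_other)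
  have step: "I (Suc i) (f t)" if I: "I i t" and i: "nmem t 21 0 0 = i" for i t
  proof -
    define t1 where "t1 = nset 5 i 0 (nmem t 15 i 0) t"
    define J where "J m u \<longleftrightarrow> inputs u \<and> nmem u 21 0 0 = i \<and> nmem u 3 = nmem s1 3 \<and> nmem u 14 = nmem s 14 \<and>
      nmem u 15 = nmem s 15 \<and> nmem u 5 = nmem t1 5 \<and> (\<forall>l. l \<noteq> i \<longrightarrow> nmem u 4 l = nmem t 4 l) \<and>
      (\<forall>j<m. nmem u 4 i j = nmem s 14 i j)" for m u
    have "J (Suc n) (loop g 25 (Suc n) t1)"
    proof (rule loop_rule)
      show "J 0 (nset 25 0 0 0 t1)"
        using I i by (simp add: J_def I_def t1_def inputs_nset nmem_nset nmem_nset_other)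
    next
      fix m u assume m: "m < Suc n" "nmem u 25 0 0 = m" and J: "J m u"
      have u4: "nmem (g u) 4 l j = (if l = i \<and> j = m then nmem u 14 i m else nmem u 4 l j)" for l j
        using J m by (simp add: g_def nmem_nset J_def)
      have "g u = nset 4 i m (nmem u 14 i m) u" using J m by (simp add: g_def J_def)
      then show "J (Suc m) (nset 25 0 0 (Suc m) (g u))"
        using J u4 by (auto simp: J_def inputs_nset nmem_nset nmem_nset_other less_Suc_eq fun_eq_iff)
    qed
    moreover have "f t = loop g 25 (Suc n) t1" using i by (simp add: f_def t1_def)
    ultimately have J: "J (Suc n) (f t)" by simp
    show ?thesis
      unfolding I_def
    proof (intro conjI allI impI)
      fix l assume "l < Suc i"
      have f5: "nmem (f t) 5 = nmem t1 5" and f4: "\<And>l. l \<noteq> i \<Longrightarrow> nmem (f t) 4 l = nmem t 4 l"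
        and f4i: "\<And>j. j < Suc n \<Longrightarrow> nmem (f t) 4 i j = nmem s 14 i j"
        using J unfolding J_def by blast+
      have old: "l < i \<Longrightarrow> nmem t 5 l 0 = nmem s 15 l 0" "\<And>j. l < i \<Longrightarrow> j \<le> n \<Longrightarrow> nmem t 4 l j = nmem s 14 l j"
        and t15: "nmem t 15 = nmem s 15"
        using I unfolding I_def by blast+
      show "nmem (f t) 5 l 0 = nmem s 15 l 0"
        unfolding f5 t1_def using old(1) t15 \<open>l < Suc i\<close> by (cases "l = i") (simp_all add: nmem_nset)
      show "nmem (f t) 4 l j = nmem s 14 l j" if "j \<le> n" for j
        using f4[of l] f4i[of j] old(2)[of j] that \<open>l < Suc i\<close> by (cases "l = i") simp_all
    qed (use J in \<open>simp_all add: J_def\<close>)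
  qed
  have "I (Suc n) (loop f 21 (Suc n) s1)"
  proof (rule loop_rule)
    have "I 0 s1" using s1 by (simp add: I_def) (simp add: s1_def nmem_nset_other)
    then show "I 0 (nset 21 0 0 0 s1)" by (rule I_set)
    show "I (Suc i) (nset 21 0 0 (Suc i) (f t))" if "nmem t 21 0 0 = i" "I i t" for i t
      by (rule I_set[OF step[OF that(2,1)]])
  qed
  moreover have "den copy_out s = loop f 21 (Suc n) s1"
  proof -
    define h where "h = den (NSet 5 (NV 21) (Lit 0) (cell 15 (NV 21)) ;; For 25 None (NSet 4 (NV 21) (NV 25) (NAt 14 (NV 21) (NV 25))))"
    have hf: "h t = f t" if "inputs t" for t
    proof -
      have "inputs (nset 5 (nmem t 21 0 0) 0 (nmem t 15 (nmem t 21 0 0) 0) t)" using that by (simp add: inputs_nset)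
      from loop_count[OF this] show ?thesis by (simp add: h_def f_def g_def)
    qed
    have "inputs (loop f 21 m s1) \<and> loop h 21 m s1 = loop f 21 m s1" for m
    proof (induction m)
      case 0
      then show ?case using s1 by (simp add: inputs_nset)
    next
      case (Suc m)
      have "inputs (h (loop f 21 m s1))"
        unfolding h_def by (rule inputs_den[OF conjunct1[OF Suc]]) simp_all
      then show ?case using Suc hf by (simp add: inputs_nset)
    qed
    then have "loop h 21 (Suc n) s1 = loop f 21 (Suc n) s1" by blast
    moreover have "den copy_out s = loop h 21 (Suc n) s1"
      using loop_count[OF s1] by (simp add: copy_out_def h_def s1_def)
    ultimately show ?thesis by (simp only:)
  qed
  ultimately have I: "I (Suc n) (den copy_out s)" by simp
  then show "nmem (den copy_out s) 3 0 0 = nmem s 13 0 0" by (simp add: I_def s1_def nmem_nset)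
  show "i \<le> n \<Longrightarrow> nmem (den copy_out s) 5 i 0 = nmem s 15 i 0"
    "i \<le> n \<Longrightarrow> j \<le> n \<Longrightarrow> nmem (den copy_out s) 4 i j = nmem s 14 i j"
    using I by (simp_all add: I_def)
qed

lemma copy_out_spec:
  assumes s: "inputs s" "buffer s D []" "valid_tours D" "served D = customers n"
  defines "s' \<equiv> den copy_out s"
  shows "feasible n k d (output_tours s') (output_assignment s')"
    "solution_cost c (output_tours s') = tours_cost D"
proof -
  have dist: "distinct (concat D)" and ne: "[] \<notin> set D" and load: "\<And>t. t \<in> set D \<Longrightarrow> sum_list (map d t) \<le> k"
    using s(3) by (auto simp: valid_tours_def)
  have len: "length (concat D) = n"
    using distinct_card[OF dist] s(4) by (simp add: customers_def)
  \<comment> \<open>Only rows and columns 0, ..., n are copied. This suffices because nonempty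
    disjoint tours number at most n and none is longer than n.\<close>
  have lenD: "length D \<le> n" using length_le_concat[OF ne] len by simp
  have lenj: "length (D ! j) \<le> n" if "j < length D" for j
  proof -
    have "D ! j \<in> set D" using that by simp
    then obtain xs ys where "D = xs @ D ! j # ys" using split_list by metis
    then have "concat D = concat xs @ D ! j @ concat ys" by (metis concat.simps(2) concat_append)
    then show ?thesis using len by simp
  qed
  have hl: "holds_list (nmem s 14 j) (D ! j)" if "j < length D" for j
    using s(2) that by (simp add: buffer_def)
  have tour: "output_tour s' j = D ! j" if j: "j < length D" for j
  proof (rule nth_equalityI)
    have j': "j \<le> n" using j lenD by simp
    have l: "nmem s' 4 j 0 = length (D ! j)"
      using copy_out_value(3)[OF s(1) j', of 0] hl[OF j] by (simp add: s'_def holds_list_def)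
    then show "length (output_tour s' j) = length (D ! j)" by (simp add: output_tour_def del: upt_Suc)
    fix i assume "i < length (output_tour s' j)"
    then have i: "i < length (D ! j)" using l by (simp add: output_tour_def del: upt_Suc)
    then have "Suc i \<le> n" using lenj[OF j] by simp
    then have "nmem s' 4 j (Suc i) = D ! j ! i"
      using copy_out_value(3)[OF s(1) j', of "Suc i"] hl[OF j] i by (simp add: s'_def holds_list_def)
    then show "output_tour s' j ! i = D ! j ! i" using i l by (simp add: output_tour_def del: upt_Suc)
  qed
  have "nmem s' 3 0 0 = length D" using copy_out_value(1)[OF s(1)] s(2) by (simp add: s'_def buffer_def)
  then have "output_tours s' = (!) D ` {..<length D}" using tour by (auto simp: output_tours_def)
  then have tours: "output_tours s' = set D" by (auto simp: set_conv_nth)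
  \<comment> \<open>The output is a set of tours, so equal tours would be counted once; nonempty
    disjoint lists are distinct.\<close>
  have distD: "distinct D" using dist ne by (simp add: distinct_concat_iff)
  show "solution_cost c (output_tours s') = tours_cost D"
    using distD by (simp add: solution_cost_def tours tours_cost_def sum_list_distinct_conv_sum_set)
  have asg: "output_assignment s' v \<in> set D \<and> v \<in> set (output_assignment s' v)" if v: "v \<in> customers n" for v
  proof -
    have "v \<in> served D" using v s(4) by simp
    then obtain j where j: "j < length D" "v \<in> set (D ! j)" by (auto simp: set_conv_nth[of D])
    then have "nmem s 15 v 0 = j" using s(2) by (simp add: buffer_def)
    then have "nmem s' 5 v 0 = j" using copy_out_value(2)[OF s(1), of v] v by (simp add: s'_def customers_iff)
    then show ?thesis using j tour[OF j(1)] by (simp add: output_assignment_def)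
  qed
  have "is_tour n t" if "t \<in> set D" for t
  proof -
    have "distinct t" using dist that by (simp add: distinct_concat_iff)
    moreover have "set t \<subseteq> customers n" using that s(4) by auto
    ultimately show ?thesis using that ne by (auto simp: is_tour_def)
  qed
  moreover have "(\<Sum>v | v \<in> customers n \<and> output_assignment s' v = t. d v) \<le> k" if t: "t \<in> set D" for t
  proof -
    have "(\<Sum>v | v \<in> customers n \<and> output_assignment s' v = t. d v) \<le> sum d (set t)"
      using asg by (intro sum_mono2) auto
    also have "\<dots> = sum_list (map d t)"
      using dist t by (simp add: distinct_concat_iff sum_list_distinct_conv_sum_set)
    also have "\<dots> \<le> k" by (rule load[OF t])
    finally show ?thesis .
  qed
  ultimately show "feasible n k d (output_tours s') (output_assignment s')"
    unfolding feasible_def tours using asg by simp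
qed

text \<open>The expected cost of a customer under iterated tour partitioning with threshold \<open>p / q\<close>.\<close>

definition cut_cost :: "nat \<Rightarrow> nat \<Rightarrow> nat \<Rightarrow> real" where
  "cut_cost p q v = 2 * c 0 v * (real (q * d v) + real (q * d v - p * k)) / real ((q - p) * k)"

lemma sum_position:
  assumes "distinct us"
  shows "(\<Sum>l\<in>{1..length us}. f (position us l)) = sum f (set us)"
proof -
  have "inj_on (position us) {0<..length us}"
    using position_inj[OF assms] by (intro inj_onI) auto
  then have "sum f (position us ` {0<..length us}) = (\<Sum>l\<in>{0<..length us}. f (position us l))"
    by (simp add: sum.reindex)
  moreover have "{1..length us} = {0<..length us}" by auto
  ultimately show ?thesis by (simp only: position_image)
qed

lemma walk_cost_position:
  assumes "us \<noteq> []"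
  shows "segment_cost (position us) 0 (length us) = walk_cost c 0 (us @ [0])"
proof -
  obtain v vs where us: "us = v # vs" using assms by (cases us) auto
  have "walk_cost c v vs = (\<Sum>i<length vs. c ((v # vs) ! i) (vs ! i))" by (rule walk_cost_eq_sum)
  also have "\<dots> = (\<Sum>l\<in>{Suc 0..<Suc (length vs)}. c (us ! (l - 1)) (us ! l))"
    unfolding sum.shift_bounds_Suc_ivl atLeast0LessThan[symmetric] us by simp
  also have "\<dots> = (\<Sum>l\<in>{Suc 0..<length us}. c (position us l) (position us (Suc l)))"
    by (rule sum.cong) (auto simp: us position_def)
  finally have "walk_cost c v vs = \<dots>" .
  moreover have "position us (Suc 0) = v" "position us (length us) = last us" by (simp_all add: us position_def last_conv_nth)
  moreover have "walk_cost c 0 (us @ [0]) = c 0 v + walk_cost c v vs + c (last us) 0"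
    by (simp add: us walk_cost_append)
  ultimately show ?thesis by (simp add: segment_cost_def)
qed

text \<open>The dynamic program lies below every segmentation, so one and the same output obeys the
  bound for all thresholds p / q at once. The program knows neither offset nor threshold; the
  analysis picks 1/q or 1/3 afterwards.\<close>

lemma partition_rest_spec:
  assumes s: "inputs s" "buffer s D []" "valid_tours D"
  obtains D' where "buffer (den partition_rest s) D' []" "valid_tours D'" "served D' = customers n"
    "\<forall>p q. 0 < q \<and> 2 * p \<le> q \<longrightarrow> tours_cost D' \<le> tours_cost D +
       (\<Sum>v | v \<in> customers n - served D \<and> k < 2 * d v. 2 * c 0 v) + cycle_cost c A +
       (\<Sum>v | v \<in> customers n - served D \<and> 2 * d v \<le> k. cut_cost p q v)"
proof -
  define s1 where "s1 = den solo s"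
  obtain D1 where D1: "inputs s1" "buffer s1 D1 []" "valid_tours D1"
    "served D1 = served D \<union> {v \<in> customers n. k < 2 * d v}"
    "tours_cost D1 = tours_cost D + (\<Sum>v | v \<in> customers n \<and> k < 2 * d v \<and> v \<notin> served D. 2 * c 0 v)"
    by (rule solo_spec[OF s, folded s1_def])
  define s2 where "s2 = den sequence s1"
  obtain us where us: "holds_sequence s2 us" "distinct us" "set us = customers n - served D1"
    "walk_cost c 0 (us @ [0]) \<le> cycle_cost c A"
    by (rule sequence_spec[OF D1(1,2), folded s2_def])
  have s2: "inputs s2" unfolding s2_def by (rule inputs_den[OF D1(1)]) (simp_all add: nwrites_sequence)
  have s2b: "buffer s2 D1 []" unfolding s2_def by (rule buffer_den[OF D1(2)]) (simp_all add: nwrites_sequence)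
  have cust: "set us \<subseteq> customers n" using us(3) by blast
  have len: "length us \<le> n"
    using distinct_card[OF us(2)] card_mono[OF finite_customers cust] by (simp add: customers_def)
  define s3 where "s3 = den dp s2"
  note dps = dp_spec[OF cust len s2 us(1), folded s3_def]
  have s3: "inputs s3" unfolding s3_def
    by (rule inputs_den[OF s2]) (simp_all add: dp_def dp_outer_def dp_inner_def)
  have s3b: "buffer s3 D1 []" unfolding s3_def
    by (rule buffer_den[OF s2b]) (simp_all add: dp_def dp_outer_def dp_inner_def)
  define best where "best i = rmem s3 7 i 0" for i
  obtain D' where D': "buffer (den recover s3) D' []" "valid_tours D'" "served D' = served D1 \<union> set us"
    "tours_cost D' = tours_cost D1 + best (length us)"
  proof (rule recover_spec[OF s3 s3b D1(3) dps(1) len us(3,2), where best = best])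
    show "best 0 = 0" using dps(2) by (simp add: best_def)
    show "nmem s3 38 j 0 < j \<and> segment_load (position us) (nmem s3 38 j 0) j \<le> k \<and>
      best j = best (nmem s3 38 j 0) + segment_cost (position us) (nmem s3 38 j 0) j"
      if "0 < j" "j \<le> length us" for j
      using dps(3)[OF that] unfolding optimal_upto_def best_def by blast
  qed blast
  have den: "den partition_rest s = den recover s3"
    by (simp only: partition_rest_def den.simps s1_def s2_def s3_def)
  have served': "served D' = customers n"
  proof -
    have "served D1 \<subseteq> customers n" using D1(3) by (simp add: valid_tours_def)
    then show ?thesis unfolding D'(3) us(3) by blast
  qed
  have set_us: "set us = {v. v \<in> customers n - served D \<and> 2 * d v \<le> k}"
    unfolding us(3) D1(4) using not_less by blast
  have cyc: "0 \<le> cycle_cost c A"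
  proof -
    have "0 \<le> walk_cost c 0 (us @ [0])" using cust customer_vertex by (intro walk_cost_nonneg) auto
    then show ?thesis using us(4) by simp
  qed
  have "best (length us) \<le> cycle_cost c A + sum (cut_cost p q) (set us)" if q: "0 < q" "2 * p \<le> q" for p q
  proof (cases "us = []")
    case True
    then show ?thesis using cyc dps(2) by (simp add: best_def)
  next
    case False
    define U where "U = position us"
    have U: "U i \<in> customers n \<and> 2 * d (U i) \<le> k" if "1 \<le> i" "i \<le> length us" for i
    proof -
      have "U i \<in> set us" unfolding U_def position_image[symmetric] using that by auto
      then show ?thesis unfolding set_us by blast
    qed
    show ?thesis
    proof (rule tour_partition[of "length us" U q p])
      show "U i \<in> customers n \<and> 2 * d (U i) \<le> k" if "1 \<le> i" "i \<le> length us" for i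
        by (rule U[OF that])
      fix brk
      assume brk1: "\<And>i j. i < j \<Longrightarrow> j \<le> length us \<Longrightarrow> i = 0 \<or> brk i \<Longrightarrow>
          (\<And>l. i < l \<Longrightarrow> l < j \<Longrightarrow> \<not> brk l) \<Longrightarrow> (\<Sum>l\<in>{i<..j}. d (U l)) \<le> k"
        and brk2: "(\<Sum>l\<in>{1..<length us}. if brk l then detour U l else 0) \<le>
          (\<Sum>l\<in>{1..length us}. 2 * c 0 (U l) * (real (q * d (U l)) + real (q * d (U l) - p * k))) / real ((q - p) * k)"
      have "best (length us) \<le> segment_cost U 0 (length us) + (\<Sum>l\<in>{1..<length us}. if brk l then detour U l else 0)"
      proof (rule segmentation_bound[OF _ _ brk1])
        show "best 0 \<le> 0" using dps(2) by (simp add: best_def)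
        show "best j \<le> best i + segment_cost U i j"
          if "i < j" "j \<le> length us" "(\<Sum>l\<in>{i<..j}. d (U l)) \<le> k" for i j
        proof -
          have "0 < j" using that by simp
          from dps(3)[OF this that(2)]
          have "j - j \<le> i \<Longrightarrow> i < j \<Longrightarrow> segment_load U i j \<le> k \<Longrightarrow> best j \<le> best i + segment_cost U i j"
            unfolding optimal_upto_def best_def U_def by blast
          then show ?thesis using that by (simp add: segment_load_def)
        qed
        show "1 \<le> length us" using False by (simp add: Suc_le_eq)
      qed
      also have "segment_cost U 0 (length us) \<le> cycle_cost c A"
        unfolding U_def walk_cost_position[OF False] by (rule us(4))
      also have "(\<Sum>l\<in>{1..<length us}. if brk l then detour U l else 0) \<le> (\<Sum>l\<in>{1..length us}. cut_cost p q (U l))"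
        using brk2 by (simp add: cut_cost_def sum_divide_distrib)
      also have "\<dots> = sum (cut_cost p q) (set us)" unfolding U_def by (rule sum_position[OF us(2)])
      finally show ?thesis by simp
    qed (use q in simp_all)
  qed
  moreover have "{v. v \<in> customers n - served D \<and> k < 2 * d v} = {v. v \<in> customers n \<and> k < 2 * d v \<and> v \<notin> served D}"
    by blast
  ultimately have cost: "tours_cost D' \<le> tours_cost D +
       (\<Sum>v | v \<in> customers n - served D \<and> k < 2 * d v. 2 * c 0 v) + cycle_cost c A +
       (\<Sum>v | v \<in> customers n - served D \<and> 2 * d v \<le> k. cut_cost p q v)" if "0 < q" "2 * p \<le> q" for p q
    using that D'(4) D1(5) unfolding set_us by fastforce
  show ?thesis
    by (rule that[OF D'(1,2)[folded den] served']) (intro allI impI, elim conjE, rule cost)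
qed

end

section \<open>The complete program and the cost of each mode\<close>

definition solve :: "nat \<Rightarrow> prog" where
  "solve q = reset ;; Ite (NLess (NV 42) (Lit 2)) (greedy q q) (matching q) ;; partition_rest"

text \<open>Mode \<open>0\<close> and \<open>1\<close> run the greedy program with two different penalties, mode \<open>2\<close> the matching
  program. The cheapest solution is kept.\<close>

definition keep_best :: prog where
  "keep_best = Ite (Neg (Conj (NLess (Lit 0) (NV 42)) (Neg (RLess (RV 1) (RV 8))))) (rsetv 8 (RV 1) ;; copy_out) Noop"

definition vehicle_routing :: "nat \<Rightarrow> prog" where
  "vehicle_routing q = For 42 (Some 3) (solve q ;; keep_best)"

context cvrp_tsp
begin

lemma far_cost:
  assumes "v \<in> customers n" "k < 2 * d v"
  shows "2 * c 0 v \<le> 2 * radial v"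
proof -
  have "c 0 v * real k \<le> c 0 v * (2 * real (d v))"
    using assms cost_nonneg[of 0 v] customer_vertex by (intro mult_left_mono) auto
  then show ?thesis using k_pos by (simp add: radial_def field_simps)
qed

text \<open>If q d <= k, the customer is never solo and costs q / (q - 1) times
  \<open>radial\<close>; otherwise it costs at most twice that. The error term absorbs q / (q - 1) =
  1 + 1 / (q - 1).\<close>

lemma cut_cost_fine:
  assumes v: "v \<in> customers n" and q: "1 < q"
  shows "cut_cost 1 q v \<le> (if v \<in> big q then 2 else 1) * radial v + 2 / (real q - 1) * radial v"
proof -
  have c0: "0 \<le> c 0 v" using v cost_nonneg[of 0 v] customer_vertex by auto
  define X where "X = real (q * d v) + real (q * d v - 1 * k)"
  define e where "e = (if v \<in> big q then 2 else 1 :: real)"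
  have X: "X \<le> e * (real q * real (d v))"
    using v by (auto simp: X_def e_def big_def)
  have qk: "real ((q - 1) * k) = (real q - 1) * real k" using q by simp
  have pos: "0 < (real q - 1) * real k" using q k_pos by simp
  have "cut_cost 1 q v = 2 * c 0 v * X / ((real q - 1) * real k)" unfolding cut_cost_def qk X_def by simp
  also have "\<dots> \<le> 2 * c 0 v * (e * (real q * real (d v))) / ((real q - 1) * real k)"
    using X c0 pos by (intro divide_right_mono mult_left_mono) auto
  also have "\<dots> = e * radial v * (real q / (real q - 1))" using k_pos by (simp add: radial_def ac_simps)
  also have "real q / (real q - 1) = 1 + 1 / (real q - 1)" using q by (simp add: field_simps)
  also have "e * radial v * (1 + 1 / (real q - 1)) = e * radial v + e * (1 / (real q - 1) * radial v)"
    by (simp add: algebra_simps)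
  also have "\<dots> \<le> e * radial v + 2 * (1 / (real q - 1) * radial v)"
    using q radial_nonneg[OF v] by (intro add_left_mono mult_right_mono) (auto simp: e_def)
  finally show ?thesis by (simp add: e_def)
qed

text \<open>With threshold 1/3 and period 2 k, a customer with 3 d <= k costs 3/2
  \<open>radial\<close>. For a large one the numerator is 6 d - k, which exceeds neither 4 d nor,
  therefore, twice \<open>radial\<close>, because 2 d <= k fails to hold only for customers served
  alone before.\<close>

lemma cut_cost_coarse:
  assumes v: "v \<in> customers n" and d: "2 * d v \<le> k"
  shows "cut_cost 1 3 v \<le> (if large v then 2 else 3 / 2) * radial v"
proof -
  have c0: "0 \<le> c 0 v" using v cost_nonneg[of 0 v] customer_vertex by auto
  define X where "X = real (3 * d v) + real (3 * d v - 1 * k)"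
  have X: "X \<le> (if large v then 4 else 3) * real (d v)"
    using v d by (auto simp: X_def large_def)
  have "cut_cost 1 3 v = 2 * c 0 v * X / (2 * real k)" unfolding cut_cost_def X_def by simp
  also have "\<dots> \<le> 2 * c 0 v * ((if large v then 4 else 3) * real (d v)) / (2 * real k)"
    using X c0 by (intro divide_right_mono mult_left_mono) auto
  also have "\<dots> = (if large v then 2 else 3 / 2) * radial v" by (simp add: radial_def)
  finally show ?thesis .
qed

lemma rest_bound:
  assumes "X \<subseteq> customers n"
    "\<And>v. v \<in> X \<Longrightarrow> k < 2 * d v \<Longrightarrow> 2 * c 0 v \<le> w v" "\<And>v. v \<in> X \<Longrightarrow> 2 * d v \<le> k \<Longrightarrow> cut_cost p q v \<le> w v"
  shows "(\<Sum>v | v \<in> X \<and> k < 2 * d v. 2 * c 0 v) + (\<Sum>v | v \<in> X \<and> 2 * d v \<le> k. cut_cost p q v) \<le> sum w X"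
proof -
  have fin: "finite X" by (rule finite_subset[OF assms(1) finite_customers])
  have "X = {v. v \<in> X \<and> k < 2 * d v} \<union> {v. v \<in> X \<and> 2 * d v \<le> k}" by auto
  then have "sum w X = sum w {v. v \<in> X \<and> k < 2 * d v} + sum w {v. v \<in> X \<and> 2 * d v \<le> k}"
    using fin sum.union_disjoint[of "{v. v \<in> X \<and> k < 2 * d v}" "{v. v \<in> X \<and> 2 * d v \<le> k}" w] by fastforce
  moreover have "(\<Sum>v | v \<in> X \<and> k < 2 * d v. 2 * c 0 v) \<le> sum w {v. v \<in> X \<and> k < 2 * d v}"
    using assms(2) by (intro sum_mono) auto
  moreover have "(\<Sum>v | v \<in> X \<and> 2 * d v \<le> k. cut_cost p q v) \<le> sum w {v. v \<in> X \<and> 2 * d v \<le> k}"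
    using assms(3) by (intro sum_mono) auto
  ultimately show ?thesis by simp
qed

text \<open>This and the next two are the quantities t, m, l before division by the optimum.\<close>

definition tiny_part :: "nat \<Rightarrow> real" where
  "tiny_part q = sum radial (customers n - big q)"

definition mid_part :: "nat \<Rightarrow> real" where
  "mid_part q = sum radial (big q - {v. large v})"

definition large_part :: real where
  "large_part = sum radial {v. large v}"

lemma large_subset_big: "3 \<le> q \<Longrightarrow> {v. large v} \<subseteq> big q"
proof
  fix v assume q: "3 \<le> q" and v: "v \<in> {v. large v}"
  then have v: "k < 3 * d v" "v \<in> customers n" by (simp_all add: large_def)
  have "3 * d v \<le> q * d v" using q by (rule mult_right_mono) simp
  with v(1) have "k < q * d v" by (rule less_le_trans)
  then show "v \<in> big q" using v(2) by (simp add: big_def)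
qed

lemma big_subset: "big q \<subseteq> customers n"
  by (auto simp: big_def)

lemma parts:
  assumes "3 \<le> q"
  shows "0 \<le> tiny_part q" "0 \<le> mid_part q" "0 \<le> large_part"
    "tiny_part q + mid_part q + large_part = sum radial (customers n)"
    "sum (penalty m) (big q) = (if m = 0 then 2 else 3 / 2) * mid_part q + 2 * large_part"
proof -
  note sub = large_subset_big[OF assms] big_subset[of q]
  have L: "{v. large v} \<subseteq> customers n" using sub by (rule subset_trans)
  show "0 \<le> tiny_part q" unfolding tiny_part_def by (intro sum_nonneg radial_nonneg) auto
  show "0 \<le> mid_part q" unfolding mid_part_def using sub(2) by (intro sum_nonneg radial_nonneg) auto
  show "0 \<le> large_part" unfolding large_part_def using L by (intro sum_nonneg radial_nonneg) auto
  have "sum radial (customers n) = tiny_part q + sum radial (big q)"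
    unfolding tiny_part_def by (rule sum.subset_diff[OF sub(2) finite_customers])
  moreover have "sum radial (big q) = mid_part q + large_part"
    unfolding mid_part_def large_part_def by (rule sum.subset_diff[OF sub(1) finite_big])
  ultimately show "tiny_part q + mid_part q + large_part = sum radial (customers n)" by simp
  have "sum (penalty m) (big q) = sum (penalty m) (big q - {v. large v}) + sum (penalty m) {v. large v}"
    by (rule sum.subset_diff[OF sub(1) finite_big])
  moreover have "sum (penalty m) (big q - {v. large v}) = (if m = 0 then 2 else 3 / 2) * mid_part q"
    unfolding mid_part_def sum_distrib_left
    by (rule sum.cong) (auto simp: penalty_def large_def big_def)
  moreover have "sum (penalty m) {v. large v} = 2 * large_part"
    unfolding large_part_def sum_distrib_left by (rule sum.cong) (auto simp: penalty_def large_def)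
  ultimately show "sum (penalty m) (big q) = (if m = 0 then 2 else 3 / 2) * mid_part q + 2 * large_part" by simp
qed

lemma sum_split_big:
  assumes "C \<subseteq> big q"
  shows "sum w (customers n - C) = sum w (big q - C) + sum w (customers n - big q)"
proof -
  have "customers n - C = (big q - C) \<union> (customers n - big q)" using assms big_subset by auto
  then show ?thesis
    by (simp only:) (intro sum.union_disjoint; auto)
qed

text \<open>The terms with q in the denominator are the errors: 2 / (q - 1) from the fine threshold,
  3 / (q + 1) from the local search.\<close>

definition mode_bound :: "nat \<Rightarrow> real \<Rightarrow> nat \<Rightarrow> real" where
  "mode_bound q M m =
     (if m = 0 then tiny_part q + greedy_potential M (2 * mid_part q + 2 * large_part) + 2 / (real q - 1) * M
      else if m = 1 then 3 / 2 * tiny_part q + greedy_potential M (3 / 2 * mid_part q + 2 * large_part)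
      else M + 3 / (real q + 1) * M + 3 / 2 * (tiny_part q + mid_part q))"

lemma solve_spec:
  assumes s: "inputs s" "nmem s 42 0 0 = m" and feas: "feasible n k d S a"
    and M: "0 < M" "solution_cost c S \<le> M" and q: "3 \<le> q"
  obtains D where "buffer (den (solve q) s) D []" "valid_tours D" "served D = customers n"
    "tours_cost D \<le> cycle_cost c A + mode_bound q M m"
proof -
  define s1 where "s1 = den reset s"
  have s1: "inputs s1" "buffer s1 [] []" "nmem s1 42 0 0 = m"
  proof -
    show "inputs s1" unfolding s1_def by (rule inputs_den[OF s(1)]) (simp_all add: reset_def)
    show "buffer s1 [] []" unfolding s1_def by (rule buffer_reset[OF s(1)])
    have "nmem s1 42 = nmem s 42" unfolding s1_def by (rule nmem_den) (simp add: reset_def)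
    then show "nmem s1 42 0 0 = m" by (simp add: s(2))
  qed
  have P: "sum radial (customers n) \<le> M" using sum_radial_le[OF feas] M(2) by simp
  show ?thesis
  proof (cases "m < 2")
    case True
    define s2 where "s2 = den (greedy q q) s1"
    have q0: "0 < q" using q by simp
    obtain D1 where D1: "buffer s2 D1 []" "valid_tours D1" "served D1 \<subseteq> big q"
      "tours_cost D1 + sum (penalty m) (big q - served D1) \<le> greedy_potential M (sum (penalty m) (big q))"
      by (rule greedy_spec[OF s1(1,2) feas M q0 order_refl, unfolded s1(3), folded s2_def])
    have s2: "inputs s2" unfolding s2_def
      by (rule inputs_den[OF s1(1)])
        (use q0 in \<open>auto simp: greedy_def nwrites_greedy_weights rwrites_greedy_weights nwrites_search rwrites_search
          nwrites_greedy_score rwrites_greedy_score nwrites_greedy_apply rwrites_greedy_apply\<close>)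
    obtain D where D: "buffer (den partition_rest s2) D []" "valid_tours D" "served D = customers n"
      "\<forall>p q. 0 < q \<and> 2 * p \<le> q \<longrightarrow> tours_cost D \<le> tours_cost D1 +
         (\<Sum>v | v \<in> customers n - served D1 \<and> k < 2 * d v. 2 * c 0 v) + cycle_cost c A +
         (\<Sum>v | v \<in> customers n - served D1 \<and> 2 * d v \<le> k. cut_cost p q v)"
      by (rule partition_rest_spec[OF s2 D1(1,2)])
    have den: "den (solve q) s = den partition_rest s2"
      using True s1(3) by (simp add: solve_def s1_def[symmetric] s2_def del: den.simps(6))
    have bnd: "tours_cost D \<le> cycle_cost c A + mode_bound q M m"
    proof (cases "m = 0")
      case True
      define w where "w v = (if v \<in> big q then 2 else 1) * radial v + 2 / (real q - 1) * radial v" for v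
      have "(\<Sum>v | v \<in> customers n - served D1 \<and> k < 2 * d v. 2 * c 0 v) +
          (\<Sum>v | v \<in> customers n - served D1 \<and> 2 * d v \<le> k. cut_cost 1 q v) \<le> sum w (customers n - served D1)"
      proof (rule rest_bound)
        fix v assume v: "v \<in> customers n - served D1"
        show "cut_cost 1 q v \<le> w v" unfolding w_def using v q by (intro cut_cost_fine) auto
        assume h: "k < 2 * d v"
        have "2 * d v \<le> q * d v" using q by (intro mult_right_mono) auto
        with h have "k < q * d v" by (rule less_le_trans)
        then have "v \<in> big q" using v by (simp add: big_def)
        moreover have "0 \<le> 2 / (real q - 1) * radial v" using v q radial_nonneg by auto
        ultimately show "2 * c 0 v \<le> w v" using far_cost[of v] h v by (simp add: w_def)
      qed auto
      also have "sum w (customers n - served D1) =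
          (\<Sum>v\<in>customers n - served D1. (if v \<in> big q then 2 else 1) * radial v) + 2 / (real q - 1) * sum radial (customers n - served D1)"
        by (simp add: w_def sum.distrib sum_distrib_left)
      also have "(\<Sum>v\<in>customers n - served D1. (if v \<in> big q then 2 else 1) * radial v) =
          sum (penalty m) (big q - served D1) + tiny_part q"
      proof -
        have "(\<Sum>v\<in>big q - served D1. (if v \<in> big q then 2 else 1) * radial v) = sum (penalty m) (big q - served D1)"
          by (rule sum.cong) (auto simp: penalty_def True)
        moreover have "(\<Sum>v\<in>customers n - big q. (if v \<in> big q then 2 else 1) * radial v) = tiny_part q"
          unfolding tiny_part_def by (rule sum.cong) auto
        ultimately show ?thesis unfolding sum_split_big[OF D1(3)] by (simp only:)
      qed
      also have "2 / (real q - 1) * sum radial (customers n - served D1) \<le> 2 / (real q - 1) * M"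
      proof -
        have "sum radial (customers n - served D1) \<le> sum radial (customers n)"
          by (intro sum_mono2) (auto intro: radial_nonneg)
        then show ?thesis using P q by (intro mult_left_mono) auto
      qed
      finally show ?thesis
        using D(4)[rule_format, of q 1] q D1(4) parts(5)[OF q, of m] True by (simp add: mode_bound_def)
    next
      case False
      then have m1: "m = 1" using True by simp
      define w where "w v = (if large v then 2 else 3 / 2) * radial v" for v
      have "(\<Sum>v | v \<in> customers n - served D1 \<and> k < 2 * d v. 2 * c 0 v) +
          (\<Sum>v | v \<in> customers n - served D1 \<and> 2 * d v \<le> k. cut_cost 1 3 v) \<le> sum w (customers n - served D1)"
      proof (rule rest_bound)
        fix v assume v: "v \<in> customers n - served D1"
        show "cut_cost 1 3 v \<le> w v" if "2 * d v \<le> k" unfolding w_def using v that by (intro cut_cost_coarse) auto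
        assume h: "k < 2 * d v"
        then have "large v" using v by (simp add: large_def)
        then show "2 * c 0 v \<le> w v" using far_cost[of v] h v by (simp add: w_def)
      qed auto
      also have "\<dots> = sum (penalty m) (big q - served D1) + 3 / 2 * tiny_part q"
      proof -
        have "sum w (big q - served D1) = sum (penalty m) (big q - served D1)"
          by (rule sum.cong) (auto simp: w_def penalty_def m1 large_def big_def)
        moreover have "sum w (customers n - big q) = 3 / 2 * tiny_part q"
          unfolding tiny_part_def sum_distrib_left
          using large_subset_big[OF q] by (intro sum.cong) (auto simp: w_def)
        ultimately show ?thesis unfolding sum_split_big[OF D1(3)] by (simp only:)
      qed
      finally show ?thesis
        using D(4)[rule_format, of 3 1] D1(4) parts(5)[OF q, of m] m1 by (simp add: mode_bound_def)
    qed
    show ?thesis by (rule that[OF D(1-3)[folded den] bnd])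
  next
    case False
    define s2 where "s2 = den (matching q) s1"
    have q0: "0 < q" using q by simp
    obtain D1 where D1: "buffer s2 D1 []" "valid_tours D1" "served D1 = {v. large v}"
      "tours_cost D1 \<le> solution_cost c S + 3 / (real q + 1) * sum radial {v. large v}"
      by (rule matching_spec[OF s1(1,2) q0 feas, folded s2_def])
    have s2: "inputs s2" unfolding s2_def
      by (rule inputs_den[OF s1(1)])
        (use q0 in \<open>auto simp: matching_def match_round_def emit_body_def nwrites_push rwrites_push nwrites_search rwrites_search
          nwrites_match_score nwrites_link_all\<close>)
    obtain D where D: "buffer (den partition_rest s2) D []" "valid_tours D" "served D = customers n"
      "\<forall>p q. 0 < q \<and> 2 * p \<le> q \<longrightarrow> tours_cost D \<le> tours_cost D1 +
         (\<Sum>v | v \<in> customers n - served D1 \<and> k < 2 * d v. 2 * c 0 v) + cycle_cost c A +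
         (\<Sum>v | v \<in> customers n - served D1 \<and> 2 * d v \<le> k. cut_cost p q v)"
      by (rule partition_rest_spec[OF s2 D1(1,2)])
    have den: "den (solve q) s = den partition_rest s2"
      using False s1(3) by (simp add: solve_def s1_def[symmetric] s2_def del: den.simps(6))
    have "(\<Sum>v | v \<in> customers n - served D1 \<and> k < 2 * d v. 2 * c 0 v) +
        (\<Sum>v | v \<in> customers n - served D1 \<and> 2 * d v \<le> k. cut_cost 1 3 v)
        \<le> (\<Sum>v\<in>customers n - served D1. 3 / 2 * radial v)"
    proof (rule rest_bound)
      fix v assume v: "v \<in> customers n - served D1"
      then have nl: "\<not> large v" unfolding D1(3) by blast
      show "cut_cost 1 3 v \<le> 3 / 2 * radial v" if "2 * d v \<le> k"
        using cut_cost_coarse[of v] v that nl by simp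
      show "2 * c 0 v \<le> 3 / 2 * radial v" if "k < 2 * d v"
        using nl v that by (simp add: large_def)
    qed auto
    also have "\<dots> = 3 / 2 * sum radial (customers n - {v. large v})" unfolding D1(3) by (rule sum_distrib_left[symmetric])
    also have "sum radial (customers n - {v. large v}) = mid_part q + tiny_part q"
      unfolding mid_part_def tiny_part_def by (rule sum_split_big[OF large_subset_big[OF q]])
    finally have rest: "(\<Sum>v | v \<in> customers n - served D1 \<and> k < 2 * d v. 2 * c 0 v) +
        (\<Sum>v | v \<in> customers n - served D1 \<and> 2 * d v \<le> k. cut_cost 1 3 v) \<le> 3 / 2 * (mid_part q + tiny_part q)" .
    have "sum radial {v. large v} \<le> M"
      using parts(1,2,4)[OF q] P by (simp add: large_part_def)
    then have "3 / (real q + 1) * sum radial {v. large v} \<le> 3 / (real q + 1) * M" by (intro mult_left_mono) auto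
    then have "3 / (real q + 1) * sum radial {v. large v} \<le> 3 / (real q + 1) * M" .
    moreover have "tours_cost D \<le> tours_cost D1 +
         (\<Sum>v | v \<in> customers n - served D1 \<and> k < 2 * d v. 2 * c 0 v) + cycle_cost c A +
         (\<Sum>v | v \<in> customers n - served D1 \<and> 2 * d v \<le> k. cut_cost 1 3 v)"
      by (rule D(4)[rule_format]) simp
    moreover have "t \<le> y + (M + e' + 3 / 2 * (b + a))"
      if "e \<le> e'" "t \<le> d1 + x + y + z" "x + z \<le> 3 / 2 * (a + b)" "d1 \<le> f + e" "f \<le> M"
      for t d1 x y z a b e e' f :: real
      using that by (simp add: field_simps)
    ultimately have "tours_cost D \<le> cycle_cost c A + (M + 3 / (real q + 1) * M + 3 / 2 * (tiny_part q + mid_part q))"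
      using rest D1(4) M(2) by blast
    then have bnd: "tours_cost D \<le> cycle_cost c A + mode_bound q M m"
      using False unfolding mode_bound_def by auto
    show ?thesis by (rule that[OF D(1-3)[folded den] bnd])
  qed
qed

end

section \<open>Well-formedness, running time and approximation ratio\<close>

lemmas program_defs = vehicle_routing_def solve_def keep_best_def copy_out_def partition_rest_def
  reset_def greedy_def greedy_weights_def greedy_weight_body_def search_def record_best_def greedy_score_def
  greedy_body_def greedy_apply_def greedy_apply_body_def matching_def match_round_def match_score_def
  link_all_def link_prog_def saving_body_def emit_body_def solo_def solo_body_def single_push_def
  sequence_def sequence_body_def dp_def dp_outer_def dp_inner_def recover_def recover_body_def push_def

lemma nwrites_solve: "0 < q \<Longrightarrow> nwrites (solve q) \<inter> {0, 1, 2, 3, 4, 5, 42} = {}"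
  and rwrites_solve: "rwrites (solve q) \<inter> {0, 8} = {}"
  by (auto simp: program_defs nwrites_nest rwrites_nest)

lemma wf_vehicle_routing: "0 < q \<Longrightarrow> wf_prog (vehicle_routing q)"
proof -
  assume q: "0 < q"
  have "wf_prog (nest K (greedy_score q K ;; record_best K))" for K
    by (rule wf_nest) (simp_all add: greedy_score_def greedy_body_def record_best_def)
  then have g: "wf_prog (greedy q q)"
    using q by (simp add: greedy_def greedy_weights_def greedy_weight_body_def search_def greedy_apply_def
      greedy_apply_body_def push_def nwrites_nest nwrites_greedy_score record_best_def)
  have "wf_prog (nest K (match_score q ;; record_best K))" for K
    by (rule wf_nest) (simp_all add: match_score_def link_all_def link_prog_def saving_body_def record_best_def)
  then have m: "wf_prog (matching q)"
    using q by (simp add: matching_def match_round_def search_def link_all_def link_prog_def emit_body_def push_def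
      nwrites_nest nwrites_match_score record_best_def)
  have p: "wf_prog (reset ;; partition_rest ;; keep_best)"
    by (simp add: program_defs)
  have "42 \<notin> nwrites (solve q)" using nwrites_solve[OF q] by blast
  moreover have "42 \<notin> nwrites keep_best" by (simp add: keep_best_def copy_out_def)
  ultimately show ?thesis using g m p by (simp add: vehicle_routing_def solve_def)
qed

text \<open>The q nested loops of a search add to the exponent instead of multiplying it, so it is
  linear in q; this is the source of the running time n^O(1/\<delta>).\<close>

lemma weight_vehicle_routing: "weight (vehicle_routing q) \<le> 100 * q + 1000"
  by (simp add: program_defs weight_nest)

context cvrp_tsp
begin

text \<open>\<open>R8\<close> always holds the cost of the solution currently in the output cells,
  and it never increases after the first mode; so the final cost is below the bounds of all three
  modes.\<close>

lemma vehicle_routing_spec: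
  assumes s: "inputs s" and feas: "feasible n k d S a" and M: "0 < M" "solution_cost c S \<le> M" and q: "3 \<le> q"
  defines "s' \<equiv> den (vehicle_routing q) s"
  shows "feasible n k d (output_tours s') (output_assignment s')"
    "m < 3 \<Longrightarrow> solution_cost c (output_tours s') \<le> cycle_cost c A + mode_bound q M m"
proof -
  have q0: "0 < q" using q by simp
  define f where "f = den (solve q ;; keep_best)"
  define out where "out i t \<longleftrightarrow> feasible n k d (output_tours t) (output_assignment t) \<and>
     solution_cost c (output_tours t) = rmem t 8 0 0 \<and> (\<forall>m<i. rmem t 8 0 0 \<le> cycle_cost c A + mode_bound q M m)" for i t
  have out_cong: "out i t'" if "out i t" "nmem t' 3 = nmem t 3" "nmem t' 4 = nmem t 4" "nmem t' 5 = nmem t 5" "rmem t' 8 = rmem t 8" for i t t'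
  proof -
    have "output_tour t' = output_tour t" using that by (simp add: output_tour_def fun_eq_iff)
    then have "output_tours t' = output_tours t" "output_assignment t' = output_assignment t"
      using that by (simp_all add: output_tours_def output_assignment_def fun_eq_iff)
    then show ?thesis using that by (simp add: out_def)
  qed
  define I where "I i t \<longleftrightarrow> inputs t \<and> (0 < i \<longrightarrow> out i t)" for i t
  have I_set: "I i (nset 42 a b x t)" if "I i t" for i a b x t
    using that out_cong[of i t "nset 42 a b x t"] by (simp add: I_def inputs_nset nmem_nset_other)
  have step: "I (Suc i) (f t)" if i: "nmem t 42 0 0 = i" and I: "I i t" for i t
  proof -
    have t: "inputs t" using I by (simp add: I_def)
    define u where "u = den (solve q) t"
    obtain D where D: "buffer u D []" "valid_tours D" "served D = customers n"
      "tours_cost D \<le> cycle_cost c A + mode_bound q M i"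
      by (rule solve_spec[OF t i feas M q, folded u_def])
    have nw: "a \<notin> nwrites (solve q)" if "a \<in> {0, 1, 2, 3, 4, 5, 42}" for a using nwrites_solve[OF q0] that by blast
    have rw: "a \<notin> rwrites (solve q)" if "a \<in> {0, 8}" for a using rwrites_solve[of q] that by blast
    have keep: "nmem u a = nmem t a" if "a \<in> {0, 1, 2, 3, 4, 5, 42}" for a
      unfolding u_def by (rule nmem_den[OF nw[OF that]])
    have keep8: "rmem u 8 = rmem t 8" unfolding u_def by (rule rmem_den[OF rw]) simp
    have u: "inputs u" unfolding u_def by (rule inputs_den[OF t]) (simp_all add: nw rw)
    have u1: "rmem u 1 0 0 = tours_cost D" using D(1) by (simp add: buffer_def)
    \<comment> \<open>Mode 0 is kept unconditionally, since \<open>R8\<close> does not yet hold the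
      cost of a solution.\<close>
    define bb where "bb = Neg (Conj (NLess (Lit 0) (NV 42)) (Neg (RLess (RV 1) (RV 8))))"
    have bb: "bval bb u \<longleftrightarrow> i = 0 \<or> tours_cost D < rmem t 8 0 0"
      using i keep[of 42] keep8 D(1) by (auto simp: bb_def buffer_def)
    have f: "f t = (if bval bb u then den copy_out (rset 8 0 0 (tours_cost D) u) else u)"
      unfolding f_def den.simps(4) u_def[symmetric] keep_best_def bb_def[symmetric] den.simps(5)[of bb]
      using u1 by simp
    show ?thesis
    proof (cases "bval bb u")
      case True
      define z where "z = rset 8 0 0 (tours_cost D) u"
      have z: "inputs z" "buffer z D []" using u D(1) by (simp_all add: z_def inputs_rset buffer_rset)
      have ft: "f t = den copy_out z" using f True by (simp only: if_True z_def)
      have "rmem (f t) 8 = rmem z 8" unfolding ft by (rule rmem_den) (simp add: copy_out_def)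
      then have r8: "rmem (f t) 8 0 0 = tours_cost D" by (simp add: z_def rmem_rset)
      have "inputs (f t)" unfolding ft by (rule inputs_den[OF z(1)]) (simp_all add: copy_out_def)
      moreover have "out (Suc i) (f t)"
        unfolding out_def
      proof (intro conjI allI impI)
        show "feasible n k d (output_tours (f t)) (output_assignment (f t))"
          unfolding ft by (rule copy_out_spec(1)[OF z D(2,3)])
        show "solution_cost c (output_tours (f t)) = rmem (f t) 8 0 0"
          unfolding r8 unfolding ft by (rule copy_out_spec(2)[OF z D(2,3)])
        fix m assume m: "m < Suc i"
        show "rmem (f t) 8 0 0 \<le> cycle_cost c A + mode_bound q M m"
        proof (cases "m = i")
          case False
          then have "0 < i" "m < i" using m by simp_all
          then have "rmem t 8 0 0 \<le> cycle_cost c A + mode_bound q M m" using I by (simp add: I_def out_def)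
          then show ?thesis using True bb \<open>0 < i\<close> r8 by simp
        qed (use D(4) r8 in simp)
      qed
      ultimately show ?thesis by (simp add: I_def)
    next
      case False
      then have ft: "f t = u" using f by (simp only: if_False)
      have i0: "0 < i" "rmem t 8 0 0 \<le> tours_cost D" using False bb by simp_all
      have "out i t" using I i0 by (simp add: I_def)
      then have "out i u" by (rule out_cong) (simp_all add: keep keep8)
      then have "out (Suc i) u" using i0(2) D(4) keep8 by (auto simp: out_def less_Suc_eq)
      then show ?thesis using u by (simp add: I_def ft)
    qed
  qed
  have "I 3 (loop f 42 3 s)"
  proof (rule loop_rule)
    show "I 0 (nset 42 0 0 0 s)" by (rule I_set) (simp add: I_def s)
    show "I (Suc i) (nset 42 0 0 (Suc i) (f t))" if "nmem t 42 0 0 = i" "I i t" for i t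
      by (rule I_set[OF step[OF that]])
  qed
  moreover have "s' = loop f 42 3 s" by (simp only: s'_def vehicle_routing_def den.simps(6) loop_bound.simps nval.simps f_def)
  ultimately have "out 3 s'" by (simp add: I_def)
  then show "feasible n k d (output_tours s') (output_assignment s')"
    "m < 3 \<Longrightarrow> solution_cost c (output_tours s') \<le> cycle_cost c A + mode_bound q M m"
    by (simp_all add: out_def)
qed

text \<open>\<open>best_of_three\<close> after division by \<open>M\<close>; the term 3 / (q - 1)
  dominates the errors of all modes.\<close>

lemma mode_bound_min:
  assumes feas: "feasible n k d S a" and M: "0 < M" "solution_cost c S \<le> M" and q: "3 \<le> q"
  shows "\<exists>m<3. mode_bound q M m \<le> (1 + excess + 3 / (real q - 1)) * M"
proof -
  define t where "t = tiny_part q / M"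
  define u where "u = mid_part q / M"
  define l where "l = large_part / M"
  have pos: "0 \<le> t" "0 \<le> u" "0 \<le> l" using parts(1-3)[OF q] M(1) by (simp_all add: t_def u_def l_def)
  have "tiny_part q + mid_part q + large_part \<le> M"
    using parts(4)[OF q] sum_radial_le[OF feas] M(2) by simp
  then have "t + u + l \<le> 1" using M(1) by (simp add: t_def u_def l_def add_divide_distrib[symmetric])
  note three = best_of_three[OF pos this]
  have tM: "tiny_part q = t * M" "mid_part q = u * M" "large_part = l * M"
    using M(1) by (simp_all add: t_def u_def l_def)
  have gp: "greedy_potential M (x * (u * M) + y * (l * M)) = greedy_bound (x * u + y * l) * M" for x y
  proof -
    have "(x * (u * M) + y * (l * M)) / M = x * u + y * l" using M(1) by (simp add: field_simps)
    then show ?thesis by (simp add: greedy_potential_def)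
  qed
  have e: "2 / (real q - 1) \<le> 3 / (real q - 1)" "3 / (real q + 1) \<le> 3 / (real q - 1)" "0 \<le> 3 / (real q - 1)"
    using q by (auto intro: divide_right_mono divide_left_mono)
  have b0: "mode_bound q M 0 = (t + greedy_bound (2 * u + 2 * l) + 2 / (real q - 1)) * M"
    unfolding mode_bound_def tM gp by (simp add: algebra_simps)
  have b1: "mode_bound q M 1 = (3 / 2 * t + greedy_bound (3 / 2 * u + 2 * l)) * M"
    unfolding mode_bound_def tM gp by (simp add: algebra_simps)
  have b2: "mode_bound q M 2 = (1 + 3 / 2 * (t + u) + 3 / (real q + 1)) * M"
    by (simp add: mode_bound_def tM algebra_simps)
  from three show ?thesis
  proof (elim disjE)
    assume "t + greedy_bound (2 * u + 2 * l) \<le> 1 + excess"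
    then have "mode_bound q M 0 \<le> (1 + excess + 3 / (real q - 1)) * M"
      unfolding b0 using e(1) M(1) by (intro mult_right_mono[OF add_mono]) auto
    then show ?thesis by (intro exI[of _ 0]) simp
  next
    assume a: "3 / 2 * t + greedy_bound (3 / 2 * u + 2 * l) \<le> 1 + excess"
    have "3 / 2 * t + greedy_bound (3 / 2 * u + 2 * l) \<le> 1 + excess + 3 / (real q - 1)"
      using add_mono[OF a e(3)] by (simp only: add_0_right)
    then have "mode_bound q M 1 \<le> (1 + excess + 3 / (real q - 1)) * M"
      unfolding b1 using M(1) by (intro mult_right_mono) auto
    then show ?thesis by (intro exI[of _ 1]) simp
  next
    assume "1 + 3 / 2 * (t + u) \<le> 1 + excess"
    then have "mode_bound q M 2 \<le> (1 + excess + 3 / (real q - 1)) * M"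
      unfolding b2 using e(2) M(1) by (intro mult_right_mono[OF add_mono]) auto
    then show ?thesis by (intro exI[of _ 2]) simp
  qed
qed

text \<open>The potential argument needs a positive scale, but the optimum is 0 if all customers are
  at distance 0 from the depot. The program does not use the scale, so its output obeys the bound
  for every positive M >= OPT, and M tends to OPT.\<close>

lemma vehicle_routing_cost:
  assumes s: "inputs s" and \<alpha>: "0 \<le> \<alpha>" and A: "approx_tsp_tour \<alpha> n c A" and q: "3 \<le> q"
  defines "s' \<equiv> den (vehicle_routing q) s"
  shows "feasible n k d (output_tours s') (output_assignment s')"
    "solution_cost c (output_tours s') \<le> (\<alpha> + 1 + excess + 3 / (real q - 1)) * OPT n c k d"
proof -
  obtain S a where feas: "feasible n k d S a" and OPT: "solution_cost c S = OPT n c k d" by (rule OPT_attained)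
  define \<rho> where "\<rho> = \<alpha> + 1 + excess + 3 / (real q - 1)"
  have \<rho>: "0 < \<rho>" using \<alpha> excess_bounds q unfolding \<rho>_def by (intro add_nonneg_pos add_pos_nonneg) auto
  have OPT0: "0 \<le> OPT n c k d"
  proof -
    have "set t \<subseteq> vertices n" if "t \<in> S" for t
      using feas that customer_vertex by (auto simp: feasible_def is_tour_def)
    then show ?thesis
      unfolding OPT[symmetric] solution_cost_def by (intro sum_nonneg tour_cost_nonneg) auto
  qed
  have bound: "solution_cost c (output_tours s') \<le> \<rho> * M" if M: "0 < M" "solution_cost c S \<le> M" for M
  proof -
    obtain m where m: "m < 3" "mode_bound q M m \<le> (1 + excess + 3 / (real q - 1)) * M"
      using mode_bound_min[OF feas M q] by blast
    have "cycle_cost c A \<le> \<alpha> * Min {cycle_cost c B |B. tsp_tour n B}" using A by (simp add: approx_tsp_tour_def)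
    also have "\<dots> \<le> \<alpha> * M" using tsp_le[OF feas] M(2) \<alpha> by (intro mult_left_mono) auto
    finally have "cycle_cost c A \<le> \<alpha> * M" .
    moreover have "solution_cost c (output_tours s') \<le> cycle_cost c A + mode_bound q M m"
      unfolding s'_def by (rule vehicle_routing_spec(2)[OF s feas M q m(1)])
    ultimately have "solution_cost c (output_tours s') \<le> \<alpha> * M + (1 + excess + 3 / (real q - 1)) * M" using m(2) by linarith
    also have "\<dots> = \<rho> * M" by (simp add: \<rho>_def algebra_simps)
    finally show ?thesis .
  qed
  show "feasible n k d (output_tours s') (output_assignment s')"
    unfolding s'_def
    by (rule vehicle_routing_spec(1)[OF s feas _ _ q, of "OPT n c k d + 1"]) (use OPT OPT0 in auto)
  show "solution_cost c (output_tours s') \<le> (\<alpha> + 1 + excess + 3 / (real q - 1)) * OPT n c k d"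
    unfolding \<rho>_def[symmetric]
  \<comment> \<open>The slack e / \<rho> makes the scale positive even if the optimum is 0.\<close>
  proof (rule field_le_epsilon)
    fix e :: real assume e: "0 < e"
    have "solution_cost c (output_tours s') \<le> \<rho> * (OPT n c k d + e / \<rho>)"
      using e \<rho> OPT0 by (intro bound) (auto simp: OPT add_nonneg_pos)
    also have "\<dots> = \<rho> * OPT n c k d + e" using \<rho> by (simp add: distrib_left)
    finally show "solution_cost c (output_tours s') \<le> \<rho> * OPT n c k d + e" .
  qed
qed

lemma inputs_input: "inputs (input n c k d A)"
  by (auto simp: inputs_def input_def length_tsp)

lemma run_vehicle_routing:
  assumes "0 < q"
  shows "run ((n + 2) ^ weight (vehicle_routing q)) (compile (vehicle_routing q)) (input n c k d A) =
    return_pmf (Skip, den (vehicle_routing q) (input n c k d A))"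
proof -
  obtain t where t: "t \<le> time (n + 2) (vehicle_routing q)"
    "steps (compile (vehicle_routing q)) (input n c k d A) t Skip (den (vehicle_routing q) (input n c k d A))"
    using steps_compile[OF wf_vehicle_routing[OF assms], of "input n c k d A" "n + 2"] by (auto simp: input_def)
  show ?thesis
    by (rule steps_run[OF t(2)]) (rule order_trans[OF t(1)], rule time_le_power, simp)
qed

end

theorem theorem2:
  shows "\<exists>y1::real.
    (\<forall>y::real. y < 1 \<and> y / 2 + 6 * (1 - y) * (1 - exp (- (y / 2))) = ln (2 - 2 * y) \<longleftrightarrow> y = y1) \<and>
    y1 > 0.17458 \<and>
    (\<exists>C>0. \<forall>\<alpha>\<ge>1. \<forall>\<delta>::real. 0 < \<delta> \<and> \<delta> < 1 / 10 ^ 5 \<longrightarrow>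
       \<alpha> + 1 + y1 + ln (2 - 2 * y1) + \<delta> < \<alpha> + 1.6759 \<and>
       (\<exists>P T. (\<forall>n\<ge>2. real (T n) \<le> real n powr (C / \<delta>)) \<and>
          runs_in_time \<alpha> P T \<and>
          has_approx_ratio \<alpha> P T (\<alpha> + 1 + y1 + ln (2 - 2 * y1) + \<delta>)))"
proof (rule exI[of _ balance_root], intro conjI)
  show "\<forall>y. y < 1 \<and> y / 2 + 6 * (1 - y) * (1 - exp (- (y / 2))) = ln (2 - 2 * y) \<longleftrightarrow> y = balance_root"
    using balance_root_unique by (simp add: balance_def)
  show "0.17458 < balance_root" by (rule balance_root_bounds)
  show "\<exists>C>0. \<forall>\<alpha>\<ge>1. \<forall>\<delta>::real. 0 < \<delta> \<and> \<delta> < 1 / 10 ^ 5 \<longrightarrow>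
       \<alpha> + 1 + balance_root + ln (2 - 2 * balance_root) + \<delta> < \<alpha> + 1.6759 \<and>
       (\<exists>P T. (\<forall>n\<ge>2. real (T n) \<le> real n powr (C / \<delta>)) \<and>
          runs_in_time \<alpha> P T \<and>
          has_approx_ratio \<alpha> P T (\<alpha> + 1 + balance_root + ln (2 - 2 * balance_root) + \<delta>))"
  \<comment> \<open>(n + 2)^w <= n^(2 w) for n >= 2. With w <= 100 q + 1000 and q <= 4 / \<delta> +
    1 the exponent is at most 800 / \<delta> + 2200, below 4000 / \<delta> as \<delta> < 1e-5. The
    constant depends neither on \<alpha> nor on \<delta>.\<close>
  proof (intro exI[of _ 4000] conjI allI impI)
    fix \<alpha> \<delta> :: real assume \<alpha>: "1 \<le> \<alpha>" and \<delta>: "0 < \<delta> \<and> \<delta> < 1 / 10 ^ 5"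
    have "excess + \<delta> < 0.6759"
    proof -
      have "\<delta> < 1 / 100000" using \<delta> by simp
      then show ?thesis using excess_bounds(2) by (simp add: field_simps)
    qed
    then show "\<alpha> + 1 + balance_root + ln (2 - 2 * balance_root) + \<delta> < \<alpha> + 1.6759" by (simp add: excess_def)
    \<comment> \<open>Taking 4 / \<delta> rather than 3 / \<delta> makes up for the -1 in the error
      3 / (q - 1). The program depends on \<delta> through this integer only.\<close>
    define q where "q = nat \<lceil>4 / \<delta>\<rceil>"
    have "100000 < 1 / \<delta>" using \<delta> by (simp add: field_simps)
    then have d4: "400000 < 4 / \<delta>" by simp
    have q_low: "4 / \<delta> \<le> real q" unfolding q_def by (rule real_nat_ceiling_ge)
    have "real q = of_int \<lceil>4 / \<delta>\<rceil>" using d4 by (simp add: q_def)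
    then have q_up: "real q \<le> 4 / \<delta> + 1" using ceiling_correct[of "4 / \<delta>"] by linarith
    have "400000 < real q" using q_low d4 by simp
    then have q: "3 \<le> q" "0 < q" by linarith+
    have err: "3 / (real q - 1) \<le> \<delta>"
    proof -
      have "3 / \<delta> \<le> real q - 1" using q_low \<open>100000 < 1 / \<delta>\<close> by (simp add: field_simps)
      then show ?thesis using \<delta> \<open>400000 < real q\<close> by (simp add: field_simps)
    qed
    define P where "P = compile (vehicle_routing q)"
    define T where "T n = (n + 2) ^ weight (vehicle_routing q)" for n :: nat
    have spec: "run (T n) P (input n c k d A) = return_pmf (Skip, den (vehicle_routing q) (input n c k d A)) \<and>
       feasible n k d (output_tours (den (vehicle_routing q) (input n c k d A)))
         (output_assignment (den (vehicle_routing q) (input n c k d A))) \<and>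
       solution_cost c (output_tours (den (vehicle_routing q) (input n c k d A))) \<le> (\<alpha> + 1 + excess + \<delta>) * OPT n c k d"
      if inst: "cvrp_instance n c k d" and A: "approx_tsp_tour \<alpha> n c A" for n c k d A
    proof -
      interpret cvrp_tsp n c k d A
        by unfold_locales (use inst A in \<open>auto simp: approx_tsp_tour_def\<close>)
      have "\<alpha> \<ge> 0" using \<alpha> by simp
      note cost = vehicle_routing_cost[OF inputs_input this A q(1)]
      have "0 \<le> OPT n c k d"
      proof -
        obtain S a where S: "feasible n k d S a" "solution_cost c S = OPT n c k d" by (rule OPT_attained)
        have "0 \<le> sum radial (customers n)" by (intro sum_nonneg radial_nonneg)
        then show ?thesis using sum_radial_le[OF S(1)] S(2) by simp
      qed
      then have "(\<alpha> + 1 + excess + 3 / (real q - 1)) * OPT n c k d \<le> (\<alpha> + 1 + excess + \<delta>) * OPT n c k d"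
        using err by (intro mult_right_mono) auto
      then show ?thesis using cost run_vehicle_routing[OF q(2)] unfolding T_def P_def by auto
    qed
    have time: "real (T n) \<le> real n powr (4000 / \<delta>)" if n: "2 \<le> n" for n
    proof -
      define w where "w = weight (vehicle_routing q)"
      have "real w \<le> 100 * real q + 1000"
        using weight_vehicle_routing[of q] unfolding w_def by linarith
      then have w: "2 * real w \<le> 4000 / \<delta>" using q_up d4 by simp
      have "n + 2 \<le> 2 * n" using n by simp
      also have "\<dots> \<le> n ^ 2" using mult_le_mono1[OF n, of n] by (simp only: power2_eq_square)
      finally have "n + 2 \<le> n ^ 2" .
      then have "T n \<le> (n ^ 2) ^ w" unfolding T_def w_def by (rule power_mono) simp
      then have "real (T n) \<le> real ((n ^ 2) ^ w)" by (simp only: of_nat_le_iff)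
      also have "\<dots> = real n powr (2 * real w)"
        using n by (simp add: powr_realpow[symmetric] powr_powr power_mult[symmetric])
      also have "\<dots> \<le> real n powr (4000 / \<delta>)" using n w by (intro powr_mono) auto
      finally show ?thesis .
    qed
    have rho: "\<alpha> + 1 + balance_root + ln (2 - 2 * balance_root) + \<delta> = \<alpha> + 1 + excess + \<delta>" by (simp add: excess_def)
    show "\<exists>P T. (\<forall>n\<ge>2. real (T n) \<le> real n powr (4000 / \<delta>)) \<and> runs_in_time \<alpha> P T \<and>
        has_approx_ratio \<alpha> P T (\<alpha> + 1 + balance_root + ln (2 - 2 * balance_root) + \<delta>)"
      unfolding rho
    proof (intro exI[of _ P] exI[of _ T] conjI allI impI)
      show "runs_in_time \<alpha> P T"
        unfolding runs_in_time_def
      proof (intro allI impI)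
        fix n c k d A assume "cvrp_instance n c k d \<and> approx_tsp_tour \<alpha> n c A"
        then have "run (T n) P (input n c k d A) = return_pmf (Skip, den (vehicle_routing q) (input n c k d A))"
          using spec by blast
        then show "\<forall>(Q, s)\<in>set_pmf (run (T n) P (input n c k d A)). Q = Skip" by simp
      qed
      show "has_approx_ratio \<alpha> P T (\<alpha> + 1 + excess + \<delta>)"
        unfolding has_approx_ratio_def
      proof (intro allI impI)
        fix n c k d A assume "cvrp_instance n c k d \<and> approx_tsp_tour \<alpha> n c A"
        then have sp: "run (T n) P (input n c k d A) = return_pmf (Skip, den (vehicle_routing q) (input n c k d A))"
          "feasible n k d (output_tours (den (vehicle_routing q) (input n c k d A)))
             (output_assignment (den (vehicle_routing q) (input n c k d A)))"
          "solution_cost c (output_tours (den (vehicle_routing q) (input n c k d A))) \<le> (\<alpha> + 1 + excess + \<delta>) * OPT n c k d"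
          using spec by blast+
        show "(\<forall>(Q, s)\<in>set_pmf (run (T n) P (input n c k d A)).
             feasible n k d (output_tours s) (output_assignment s)) \<and>
           measure_pmf.expectation (run (T n) P (input n c k d A)) (\<lambda>(Q, s). solution_cost c (output_tours s))
           \<le> (\<alpha> + 1 + excess + \<delta>) * OPT n c k d"
          unfolding sp(1) using sp(2,3) by simp
      qed
    qed (rule time)
  qed simp
qed

end
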